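(* Let $G\subset\mathbb{R}^2\subset\mathbb{R}^3$ be a finite planar trivalent graph. For $\rho\in R_\Phi(\pi_1(G);SU(3))$ let $\mathcal{D}(\rho)$ be the decoration of $G$ that assigns to each edge $e$ the $1$-eigenspace of $\rho(x_e)$, where $x_e$ is the meridian of $e$. Then the map $$R_\Phi(\pi_1(G);SU(3))\longrightarrow\mathcal{M}(G),\qquad \rho\longmapsto\mathcal{D}(\rho),$$ is well defined (that is, each $\mathcal{D}(\rho)$ is an admissible decoration of $G$) and is a homeomorphism.
   Context: Graphs are finite; multiple edges are allowed, and closed circle components without vertices are allowed (such a circle counts as a single edge with no vertices). Trivalent means that every vertex has exactly three incident edge-ends. A decoration of $G$ assigns to each edge $e\in E(G)$ a point $D(e)\in\mathbb{CP}^2$, i.e. a complex line through the origin in $\mathbb{C}^3$. It is admissible if at every vertex the three lines attached to the three incident edges are pairwise orthogonal in $\mathbb{C}^3$ with respect to the standard Hermitian inner product. $\mathcal{M}(G)$ is the set of admissible decorations with the subspace topology from $\prod_{e\in E(G)}\mathbb{CP}^2$. Let $\Phi=\mathrm{diag}(1,-1,-1)\in SU(3)$, and let $\pi_1(G):=\pi_1(\mathbb{R}^3\setminus G)$, with base point above the plane $\mathbb{R}^2$. Choosing an orientation of an edge $e$ determines a meridian $x_e\in\pi_1(G)$: the loop that descends from the base point through the plane on one side of $e$, passes below $e$, and returns to the base point through the plane on the other side of $e$; here descending and ascending pieces are vertical-type paths meeting the plane only once, in the faces adjacent to $e$. Reversing the orientation of $e$ replaces $x_e$ by $x_e^{-1}$.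 The meridians generate $\pi_1(G)$. $R_\Phi(\pi_1(G);SU(3))$ is the subspace of $\mathrm{Hom}(\pi_1(G),SU(3))$ (with the topology of pointwise convergence) consisting of all homomorphisms $\rho$ such that $\rho(x_e)$ is conjugate to $\Phi$ in $SU(3)$ for every edge $e$. Since $\rho(x_e)$ and $\rho(x_e)^{-1}$ have the same $1$-eigenspace, $\mathcal{D}(\rho)$ does not depend on the chosen orientations of edges. *)

theory Defs
  imports "HOL-Analysis.Analysis" "HOL-Algebra.Group"
begin

section \<open>Graphs in the plane\<close>

text \<open>
  The plane \<open>\<real>\<^sup>2\<close> is \<^typ>\<open>complex\<close> and \<open>\<real>\<^sup>3\<close> is \<^typ>\<open>complex \<times> real\<close>; the plane sits in it at height \<open>0\<close>.
  Edges are abstract names, each with a parametrised curve on \<open>[0,1]\<close>.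
  A curve either runs between vertices (a non-loop edge or a loop edge), or it is closed and
  contains no vertex (a circle component, whose starting point carries no meaning).
  The curves are arbitrary topological arcs and simple closed curves.
\<close>

record 'e graph_data =
  verts :: "complex set"
  edges :: "'e set"
  curve :: "'e \<Rightarrow> real \<Rightarrow> complex"

definition finite_plane_graph :: "'e graph_data \<Rightarrow> bool" where
  "finite_plane_graph G \<longleftrightarrow>
     finite (verts G) \<and> finite (edges G) \<and>
     (\<forall>e \<in> edges G.
        simple_path (curve G e) \<and>
        curve G e ` {0<..<1} \<inter> verts G = {} \<and>
        (pathstart (curve G e) \<in> verts G \<and> pathfinish (curve G e) \<in> verts G
          \<or> pathstart (curve G e) = pathfinish (curve G e))) \<and>
     (\<forall>e \<in> edges G. \<forall>e' \<in> edges G. e \<noteq> e' \<longrightarrow>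
        path_image (curve G e) \<inter> path_image (curve G e') \<subseteq> verts G)"

text \<open>An edge-end is an edge together with one of the parameters \<open>0\<close>, \<open>1\<close>, so that a loop edge
  has two ends at its vertex.\<close>

definition ends_at :: "'e graph_data \<Rightarrow> complex \<Rightarrow> ('e \<times> real) set" where
  "ends_at G v = {(e, i). e \<in> edges G \<and> i \<in> {0, 1} \<and> curve G e i = v}"

definition trivalent :: "'e graph_data \<Rightarrow> bool" where
  "trivalent G \<longleftrightarrow> (\<forall>v \<in> verts G. card (ends_at G v) = 3)"

definition graph_set :: "'e graph_data \<Rightarrow> complex set" where
  "graph_set G = verts G \<union> (\<Union>e \<in> edges G. path_image (curve G e))"

definition graph_complement :: "'e graph_data \<Rightarrow> (complex \<times> real) set" where
  "graph_complement G = - (graph_set G \<times> {0})"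

definition faces :: "'e graph_data \<Rightarrow> complex set set" where
  "faces G = components (- graph_set G)"

text \<open>Faces that touch \<open>e\<close> only at an end vertex do not count as adjacent to \<open>e\<close>.\<close>

definition adjacent_faces :: "'e graph_data \<Rightarrow> 'e \<Rightarrow> complex set set" where
  "adjacent_faces G e = {F \<in> faces G. frontier F \<inter> curve G e ` {0<..<1} \<noteq> {}}"


section \<open>Fundamental groups\<close>

definition loops_at :: "'a::topological_space set \<Rightarrow> 'a \<Rightarrow> (real \<Rightarrow> 'a) set" where
  "loops_at S b = {p. path p \<and> path_image p \<subseteq> S \<and> pathstart p = b \<and> pathfinish p = b}"

definition loop_class :: "'a::topological_space set \<Rightarrow> (real \<Rightarrow> 'a) \<Rightarrow> (real \<Rightarrow> 'a) set" where
  "loop_class S p = {q. homotopic_paths S p q}"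

definition fundamental_group ::
    "'a::topological_space set \<Rightarrow> 'a \<Rightarrow> (real \<Rightarrow> 'a) set monoid" where
  "fundamental_group S b =
     \<lparr>carrier = loop_class S ` loops_at S b,
      mult = (\<lambda>A B. \<Union>p\<in>A. \<Union>q\<in>B. loop_class S (p +++ q)),
      one = loop_class S (\<lambda>_. b)\<rparr>"

lemma loop_class_eqI:
  assumes "homotopic_paths S p q"
  shows "loop_class S p = loop_class S q"
  using assms homotopic_paths_trans[of S] homotopic_paths_sym[of S p q]
  unfolding loop_class_def by (intro Collect_cong iffI) metis+

lemma loops_at_join:
  "p \<in> loops_at S b \<Longrightarrow> q \<in> loops_at S b \<Longrightarrow> p +++ q \<in> loops_at S b"
  by (auto simp: loops_at_def path_image_join)

lemma fundamental_group_mult: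
  assumes "p \<in> loops_at S b" "q \<in> loops_at S b"
  shows "loop_class S p \<otimes>\<^bsub>fundamental_group S b\<^esub> loop_class S q = loop_class S (p +++ q)"
proof -
  have "loop_class S (p' +++ q') = loop_class S (p +++ q)"
    if "p' \<in> loop_class S p" "q' \<in> loop_class S q" for p' q'
  proof -
    have "homotopic_paths S (p +++ q) (p' +++ q')"
      using that assms by (simp add: loop_class_def loops_at_def homotopic_paths_join)
    then show ?thesis
      by (rule loop_class_eqI[symmetric])
  qed
  moreover have "p \<in> loop_class S p" "q \<in> loop_class S q"
    using assms by (auto simp: loop_class_def loops_at_def)
  ultimately have "(\<Union>p'\<in>loop_class S p. \<Union>q'\<in>loop_class S q. loop_class S (p' +++ q'))
      = loop_class S (p +++ q)"
    by blast
  then show ?thesis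
    by (simp add: fundamental_group_def)
qed

lemma group_fundamental_group:
  fixes S :: "'a::real_normed_vector set"
  assumes "b \<in> S"
  shows "group (fundamental_group S b)"
proof -
  let ?G = "fundamental_group S b"
  have carr: "carrier ?G = loop_class S ` loops_at S b"
    by (simp add: fundamental_group_def)
  have one: "\<one>\<^bsub>?G\<^esub> = loop_class S (linepath b b)"
    by (simp add: fundamental_group_def linepath_refl)
  have b: "linepath b b \<in> loops_at S b"
    using assms by (simp add: loops_at_def)
  show ?thesis
  proof (rule groupI)
    show "x \<otimes>\<^bsub>?G\<^esub> y \<in> carrier ?G" if "x \<in> carrier ?G" "y \<in> carrier ?G" for x y
      using that by (auto simp: carr fundamental_group_mult loops_at_join)
    show "\<one>\<^bsub>?G\<^esub> \<in> carrier ?G"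
      using b by (auto simp: carr one)
    show "x \<otimes>\<^bsub>?G\<^esub> y \<otimes>\<^bsub>?G\<^esub> z = x \<otimes>\<^bsub>?G\<^esub> (y \<otimes>\<^bsub>?G\<^esub> z)"
      if xyz: "x \<in> carrier ?G" "y \<in> carrier ?G" "z \<in> carrier ?G" for x y z
    proof -
      obtain p q r where pqr: "p \<in> loops_at S b" "q \<in> loops_at S b" "r \<in> loops_at S b"
        and "x = loop_class S p" "y = loop_class S q" "z = loop_class S r"
        using xyz unfolding carr by blast
      moreover have "loop_class S ((p +++ q) +++ r) = loop_class S (p +++ (q +++ r))"
        using pqr
        by (intro loop_class_eqI[OF homotopic_paths_sym[OF homotopic_paths_assoc]])
          (simp_all add: loops_at_def)
      ultimately show ?thesis
        using pqr by (simp add: fundamental_group_mult loops_at_join)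
    qed
    show "\<one>\<^bsub>?G\<^esub> \<otimes>\<^bsub>?G\<^esub> x = x" if x: "x \<in> carrier ?G" for x
    proof -
      obtain p where p: "p \<in> loops_at S b" "x = loop_class S p"
        using x unfolding carr by blast
      then have "loop_class S (linepath b b +++ p) = loop_class S p"
        using loop_class_eqI[OF homotopic_paths_lid[of p S]] by (simp add: loops_at_def)
      then show ?thesis
        using p b by (simp add: one fundamental_group_mult)
    qed
    show "\<exists>y \<in> carrier ?G. y \<otimes>\<^bsub>?G\<^esub> x = \<one>\<^bsub>?G\<^esub>" if x: "x \<in> carrier ?G" for x
    proof -
      obtain p where p: "p \<in> loops_at S b" "x = loop_class S p"
        using x unfolding carr by blast
      then have r: "reversepath p \<in> loops_at S b"
        by (simp add: loops_at_def)
      have "loop_class S (reversepath p +++ p) = loop_class S (linepath b b)"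
        using p loop_class_eqI[OF homotopic_paths_linv[of p S]] by (simp add: loops_at_def)
      then have "loop_class S (reversepath p) \<otimes>\<^bsub>?G\<^esub> x = \<one>\<^bsub>?G\<^esub>"
        using p r by (simp add: one fundamental_group_mult)
      then show ?thesis
        using r by (auto simp: carr)
    qed
  qed
qed

abbreviation graph_group ::
    "'e graph_data \<Rightarrow> complex \<times> real \<Rightarrow> (real \<Rightarrow> complex \<times> real) set monoid" where
  "graph_group G b \<equiv> fundamental_group (graph_complement G) b"

text \<open>
  The loop descends from the base point through the face \<open>F\<close> on one side of \<open>e\<close>, passes below
  the plane, and returns through the face \<open>F'\<close> on the other side. If the same face lies on both
  sides of \<open>e\<close>, then \<open>F = F'\<close>. The two orientations of \<open>e\<close> correspond to the two
  orders of its sides.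
\<close>

definition meridian_loop ::
    "'e graph_data \<Rightarrow> complex \<times> real \<Rightarrow> 'e \<Rightarrow> (real \<Rightarrow> complex \<times> real) \<Rightarrow> bool" where
  "meridian_loop G b e p \<longleftrightarrow>
     p \<in> loops_at (graph_complement G) b \<and>
     (\<exists>F F' s t. adjacent_faces G e = {F, F'} \<and> 0 < s \<and> s < t \<and> t < 1 \<and>
        (\<forall>u \<in> {0..<s} \<union> {t<..1}. snd (p u) > 0) \<and>
        (\<forall>u \<in> {s<..<t}. snd (p u) < 0) \<and>
        snd (p s) = 0 \<and> fst (p s) \<in> F \<and>
        snd (p t) = 0 \<and> fst (p t) \<in> F')"

definition meridians ::
    "'e graph_data \<Rightarrow> complex \<times> real \<Rightarrow> 'e \<Rightarrow> (real \<Rightarrow> complex \<times> real) set set" where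
  "meridians G b e = loop_class (graph_complement G) ` {p. meridian_loop G b e p}"


section \<open>The group \<open>SU(3)\<close> and the space of representations\<close>

definition adjoint_matrix :: "complex^'n^'m \<Rightarrow> complex^'m^'n" where
  "adjoint_matrix A = (\<chi> i j. cnj (A $ j $ i))"

definition SU3 :: "(complex^3^3) monoid" where
  "SU3 = \<lparr>carrier = {A. A ** adjoint_matrix A = mat 1 \<and> det A = 1},
          mult = (**), one = mat 1\<rparr>"

definition Phi :: "complex^3^3" where
  "Phi = vector [vector [1, 0, 0], vector [0, -1, 0], vector [0, 0, -1]]"

definition conjugate_in_SU3 :: "complex^3^3 \<Rightarrow> complex^3^3 \<Rightarrow> bool" where
  "conjugate_in_SU3 A B \<longleftrightarrow> (\<exists>U \<in> carrier SU3. A = U ** B ** matrix_inv U)"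

text \<open>Homomorphisms are extensional, so that they correspond to maps on the carrier.\<close>

definition R_Phi ::
    "'e graph_data \<Rightarrow> complex \<times> real \<Rightarrow> ((real \<Rightarrow> complex \<times> real) set \<Rightarrow> complex^3^3) set" where
  "R_Phi G b =
     {\<rho> \<in> hom (graph_group G b) SU3 \<inter> extensional (carrier (graph_group G b)).
        \<forall>e \<in> edges G. \<forall>x \<in> meridians G b e. conjugate_in_SU3 (\<rho> x) Phi}"

definition R_Phi_topology ::
    "'e graph_data \<Rightarrow> complex \<times> real \<Rightarrow> ((real \<Rightarrow> complex \<times> real) set \<Rightarrow> complex^3^3) topology" where
  "R_Phi_topology G b =
     subtopology
       (product_topology (\<lambda>_. top_of_set (carrier SU3)) (carrier (graph_group G b)))
       (R_Phi G b)"


section \<open>The projective plane and admissible decorations\<close>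

definition complex_line :: "complex^3 \<Rightarrow> (complex^3) set" where
  "complex_line v = range (\<lambda>c. c *s v)"

definition CP2 :: "(complex^3) set set" where
  "CP2 = complex_line ` (- {0})"

text \<open>The quotient topology of \<open>\<complex>\<^sup>3 - {0}\<close> by complex scalars.\<close>

definition CP2_topology :: "(complex^3) set topology" where
  "CP2_topology =
     topology (\<lambda>U. U \<subseteq> CP2 \<and> openin (top_of_set (- {0})) {v \<in> - {0}. complex_line v \<in> U})"

lemma openin_CP2_topology:
  "openin CP2_topology U \<longleftrightarrow>
     U \<subseteq> CP2 \<and> openin (top_of_set (- {0})) {v \<in> - {0}. complex_line v \<in> U}"
proof -
  have "istopology (\<lambda>U. U \<subseteq> CP2 \<and>
          openin (top_of_set (- {0})) {v \<in> - {0}. complex_line v \<in> U})"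
  proof -
    have "openin (top_of_set (- {0})) {v \<in> - {0}. complex_line v \<in> S \<inter> T}"
      if "openin (top_of_set (- {0})) {v \<in> - {0}. complex_line v \<in> S}"
         "openin (top_of_set (- {0})) {v \<in> - {0}. complex_line v \<in> T}" for S T
    proof -
      have "{v \<in> - {0}. complex_line v \<in> S \<inter> T} =
              {v \<in> - {0}. complex_line v \<in> S} \<inter> {v \<in> - {0}. complex_line v \<in> T}"
        by blast
      then show ?thesis
        using openin_Int[OF that] by (simp only:)
    qed
    moreover have "openin (top_of_set (- {0})) {v \<in> - {0}. complex_line v \<in> \<Union>\<K>}"
      if "\<And>K. K \<in> \<K> \<Longrightarrow> openin (top_of_set (- {0})) {v \<in> - {0}. complex_line v \<in> K}" for \<K>
    proof -
      have "{v \<in> - {0}. complex_line v \<in> \<Union>\<K>} =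
              \<Union>((\<lambda>K. {v \<in> - {0}. complex_line v \<in> K}) ` \<K>)"
        by blast
      moreover have "openin (top_of_set (- {0})) \<dots>"
        using that by (intro openin_Union) blast
      ultimately show ?thesis
        by (simp only:)
    qed
    ultimately show ?thesis
      unfolding istopology_def by (intro conjI allI impI Sup_least le_infI1) blast+
  qed
  then show ?thesis
    unfolding CP2_topology_def by (subst topology_inverse') auto
qed

lemma topspace_CP2_topology [simp]: "topspace CP2_topology = CP2"
proof
  show "topspace CP2_topology \<subseteq> CP2"
    using openin_CP2_topology openin_topspace by blast
  have "{v \<in> - {0}. complex_line v \<in> CP2} = - {0}"
    by (auto simp: CP2_def)
  then have "openin CP2_topology CP2"
    by (simp add: openin_CP2_topology)
  then show "CP2 \<subseteq> topspace CP2_topology"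
    by (rule openin_subset)
qed

lemma quotient_map_complex_line:
  "quotient_map (top_of_set (- {0})) CP2_topology complex_line"
  unfolding quotient_map_def
  by (auto simp: openin_CP2_topology CP2_def)

definition hermitian :: "complex^'n \<Rightarrow> complex^'n \<Rightarrow> complex" where
  "hermitian x y = (\<Sum>i\<in>UNIV. x $ i * cnj (y $ i))"

definition orthogonal_lines :: "(complex^3) set \<Rightarrow> (complex^3) set \<Rightarrow> bool" where
  "orthogonal_lines L L' \<longleftrightarrow> (\<forall>x \<in> L. \<forall>y \<in> L'. hermitian x y = 0)"

text \<open>Both ends of a loop edge occur at its vertex, so a graph with a loop edge has no
  admissible decoration.\<close>

definition admissible_decorations :: "'e graph_data \<Rightarrow> ('e \<Rightarrow> (complex^3) set) set" where
  "admissible_decorations G =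
     {D \<in> edges G \<rightarrow>\<^sub>E CP2.
        \<forall>v \<in> verts G. \<forall>h \<in> ends_at G v. \<forall>h' \<in> ends_at G v.
          h \<noteq> h' \<longrightarrow> orthogonal_lines (D (fst h)) (D (fst h'))}"

definition decoration_topology :: "'e graph_data \<Rightarrow> ('e \<Rightarrow> (complex^3) set) topology" where
  "decoration_topology G =
     subtopology (product_topology (\<lambda>_. CP2_topology) (edges G)) (admissible_decorations G)"

definition eigenspace_1 :: "complex^3^3 \<Rightarrow> (complex^3) set" where
  "eigenspace_1 A = {v. A *v v = v}"

text \<open>The choice of a meridian of \<open>e\<close> is the choice of an orientation of \<open>e\<close>.\<close>

definition decoration_of ::
    "'e graph_data \<Rightarrow> complex \<times> real \<Rightarrow> ((real \<Rightarrow> complex \<times> real) set \<Rightarrow> complex^3^3)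
      \<Rightarrow> 'e \<Rightarrow> (complex^3) set" where
  "decoration_of G b \<rho> = (\<lambda>e \<in> edges G. eigenspace_1 (\<rho> (SOME x. x \<in> meridians G b e)))"

end

theory Submission
  imports Defs
begin

text \<open>
  The complement of the graph in space is the union of an upper and a lower part, both contractible, whose
  intersection is the product of the complement in the plane with a line. Hence a homomorphism from the
  fundamental group to \<open>SU(3)\<close> is the holonomy of a flat bundle glued from two trivial ones along a
  function \<open>\<gamma>\<close> on the faces, which is unique up to right multiplication by a constant, and the meridian that
  descends through \<open>F\<close> and ascends through \<open>F'\<close> is sent to \<open>\<gamma> F (\<gamma> F')\<^sup>-\<^sup>1\<close>. The conjugates
  of \<open>\<Phi>\<close> are the reflections \<open>2 v v\<^sup>* / \<bar>v\<bar>\<^sup>2 - 1\<close> in complex lines. So the representations correspond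
  to the functions that jump by the reflection in the line of \<open>e\<close> across each edge \<open>e\<close>. Around a vertex three
  reflections then have product \<open>1\<close>, which means that their lines are orthogonal.

  Conversely, given an admissible decoration, one defines \<open>\<gamma>\<close> along a spanning tree of the dual graph.
  If the jump condition failed on a nonempty set of edges, then this set would either contain a cycle, which separates
  two faces although the tree does not cross it, or have a leaf, where the condition at the two other edges
  implies it at the third.

  The edges are arbitrary arcs, so the adjacency of faces and edges is obtained from Janiszewski's theorem and
  from continuous logarithms of the functions \<open>(z - p) / (z - q)\<close> on compact sets. The space of representations
  is compact and the space of decorations is Hausdorff, so a continuous bijection between them is a homeomorphism.
\<close>

section \<open>Reflections in complex lines\<close>

text \<open>The edges have no tubular neighbourhoods, so the two sides of an edge are not a local
  notion: only the faces whose closure meets a subarc are available. Three facts replace the local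
  picture: a face that touches an edge at an inner point touches every subarc of it, an edge touches
  at most two faces, and the three edges at a vertex touch the pairs \<open>{F2, F3}\<close>,
  \<open>{F3, F1}\<close>, \<open>{F1, F2}\<close>. Faces may coincide in these pairs, so bridges
  and loop edges run through the same argument; for a bridge the jump condition says that a
  reflection is the identity, and both spaces are then empty.

  A reflection is an involution, so the jump condition across an edge does not depend on the order
  of its two faces. This is why neither the orientation of an edge nor the choice of its meridian
  matters.

  The bundle takes the place of a presentation of the fundamental group: the overlap of the upper
  and the lower part is disconnected in general, with one component for each face, and the values of
  \<open>\<gamma>\<close> on these components carry what generators and relations would
  encode.\<close>

definition line_reflection :: "complex^3 \<Rightarrow> complex^3^3" where
  "line_reflection v = (\<chi> i j. 2 * (v$i * cnj (v$j)) / hermitian v v - (if i = j then 1 else 0))"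

lemma hermitian_3: "hermitian x y = x$1 * cnj (y$1) + x$2 * cnj (y$2) + x$3 * cnj (y$3)"
  for x :: "complex^3"
  by (simp add: hermitian_def sum_3)

lemma hermitian_self: "hermitian v v = of_real ((norm (v$1))\<^sup>2 + (norm (v$2))\<^sup>2 + (norm (v$3))\<^sup>2)"
  for v :: "complex^3"
  by (simp add: hermitian_3 complex_norm_square[symmetric] flip: of_real_power of_real_add)

lemma hermitian_self_eq_0_iff [simp]: "hermitian v v = 0 \<longleftrightarrow> v = 0" for v :: "complex^3"
proof -
  have "hermitian v v = 0 \<longleftrightarrow> (norm (v$1))\<^sup>2 + (norm (v$2))\<^sup>2 + (norm (v$3))\<^sup>2 = 0"
    unfolding hermitian_self of_real_eq_0_iff ..
  also have "\<dots> \<longleftrightarrow> v = 0"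
    by (simp add: vec_eq_iff forall_3 add_nonneg_eq_0_iff)
  finally show ?thesis .
qed

lemma hermitian_scale_left [simp]: "hermitian (c *s x) y = c * hermitian x y" for x :: "complex^3"
  by (simp add: hermitian_3 algebra_simps)

lemma hermitian_scale_right [simp]: "hermitian x (c *s y) = cnj c * hermitian x y" for x :: "complex^3"
  by (simp add: hermitian_3 algebra_simps)

lemma cnj_hermitian: "cnj (hermitian x y) = hermitian y x" for x :: "complex^3"
  by (simp add: hermitian_3 mult.commute)

lemma hermitian_add_left: "hermitian (x + y) z = hermitian x z + hermitian y z" for x :: "complex^3"
  by (simp add: hermitian_3 algebra_simps)

lemma hermitian_diff_left: "hermitian (x - y) z = hermitian x z - hermitian y z" for x :: "complex^3"
  by (simp add: hermitian_3 algebra_simps)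

lemma hermitian_add_right: "hermitian x (y + z) = hermitian x y + hermitian x z" for x :: "complex^3"
  by (simp add: hermitian_3 algebra_simps)

lemma line_reflection_mult_vec:
  "line_reflection v *v x = (2 * hermitian x v / hermitian v v) *s v - x"
  by (simp add: vec_eq_iff forall_3 line_reflection_def matrix_vector_mult_def sum_3 hermitian_3[of x v]
      algebra_simps add_divide_distrib)

lemma adjoint_line_reflection [simp]: "adjoint_matrix (line_reflection v) = line_reflection v"
  by (simp add: vec_eq_iff adjoint_matrix_def line_reflection_def cnj_hermitian mult.commute)

lemma line_reflection_involution:
  assumes "v \<noteq> 0" shows "line_reflection v ** line_reflection v = mat 1"
proof -
  have "(line_reflection v ** line_reflection v) *v x = mat 1 *v x" for x
    using assms
    by (simp add: matrix_vector_mul_assoc[symmetric] line_reflection_mult_vec hermitian_diff_left)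
  then show ?thesis
    by (simp add: matrix_eq)
qed

lemma det_line_reflection:
  assumes "v \<noteq> 0" shows "det (line_reflection v) = 1"
proof -
  define n where "n = hermitian v v"
  have n: "n = v$1 * cnj (v$1) + v$2 * cnj (v$2) + v$3 * cnj (v$3)" "n \<noteq> 0"
    using assms by (auto simp: n_def hermitian_3[symmetric])
  \<comment> \<open>Multiplying by \<open>n^3\<close> clears all denominators; what remains is a
    polynomial identity modulo the equation for \<open>n\<close>.\<close>
  have "det (line_reflection v) * n^3 = n^3"
    using n(2) unfolding det_3 line_reflection_def n_def[symmetric]
    apply (simp add: field_simps power3_eq_cube)
    using n(1) by algebra
  then show ?thesis
    using n(2) by simp
qed

lemma line_reflection_scale:
  assumes "c \<noteq> 0" shows "line_reflection (c *s v) = line_reflection v"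
  using assms by (simp add: vec_eq_iff line_reflection_def)

lemma complex_line_scale:
  assumes "c \<noteq> 0" shows "complex_line (c *s v) = complex_line v"
proof -
  have "d *s v = (d / c) *s (c *s v)" for d
    using assms by simp
  then show ?thesis
    unfolding complex_line_def by (fastforce simp: image_iff)
qed

lemma eigenspace_line_reflection:
  assumes "v \<noteq> 0" shows "eigenspace_1 (line_reflection v) = complex_line v"
proof -
  have "line_reflection v *v x = x \<longleftrightarrow> x \<in> complex_line v" for x
  proof
    assume "line_reflection v *v x = x"
    then have "2 *s x = (2 * hermitian x v / hermitian v v) *s v"
      by (simp add: line_reflection_mult_vec vec_eq_iff forall_3 algebra_simps)
    then have "(1/2) *s (2 *s x) = (1/2) *s ((2 * hermitian x v / hermitian v v) *s v)"
      by (rule arg_cong)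
    then have "x = (hermitian x v / hermitian v v) *s v"
      by simp
    then show "x \<in> complex_line v"
      unfolding complex_line_def by blast
  next
    assume "x \<in> complex_line v"
    then obtain c where "x = c *s v"
      unfolding complex_line_def by blast
    then show "line_reflection v *v x = x"
      using assms by (simp add: line_reflection_mult_vec) (simp add: vec_eq_iff)
  qed
  then show ?thesis
    by (auto simp: eigenspace_1_def)
qed

text \<open>The 1-eigenspace of the reflection is the line itself, so passing from lines to
  reflections loses nothing. This lets \<open>CP2\<close> be treated as a set of matrices.\<close>

lemma complex_line_eq_iff:
  assumes "v \<noteq> 0" "w \<noteq> 0"
  shows "complex_line v = complex_line w \<longleftrightarrow> line_reflection v = line_reflection w"
proof
  assume "complex_line v = complex_line w"
  then have "1 *s v \<in> complex_line w"
    unfolding complex_line_def by blast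
  then obtain c where c: "v = c *s w"
    unfolding complex_line_def by auto
  with assms have "c \<noteq> 0"
    by auto
  with c show "line_reflection v = line_reflection w"
    by (simp add: line_reflection_scale)
next
  assume "line_reflection v = line_reflection w"
  then show "complex_line v = complex_line w"
    using assms by (metis eigenspace_line_reflection)
qed

section \<open>The group SU(3) and the conjugates of Phi\<close>

lemma SU3_carrier: "A \<in> carrier SU3 \<longleftrightarrow> A ** adjoint_matrix A = mat 1 \<and> det A = 1"
  by (simp add: SU3_def)

lemma SU3_mult [simp]: "A \<otimes>\<^bsub>SU3\<^esub> B = A ** B" and SU3_one [simp]: "\<one>\<^bsub>SU3\<^esub> = mat 1"
  by (simp_all add: SU3_def)

lemma adjoint_matrix_mult: "adjoint_matrix (A ** B) = adjoint_matrix B ** adjoint_matrix A"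
  for A B :: "complex^3^3"
  by (simp add: vec_eq_iff adjoint_matrix_def matrix_matrix_mult_def mult.commute)

lemma adjoint_adjoint [simp]: "adjoint_matrix (adjoint_matrix A) = A"
  by (simp add: vec_eq_iff adjoint_matrix_def)

lemma adjoint_mat_1 [simp]: "adjoint_matrix (mat 1 :: complex^3^3) = mat 1"
  by (simp add: vec_eq_iff adjoint_matrix_def mat_def)

lemma det_adjoint: "det (adjoint_matrix A) = cnj (det A)" for A :: "complex^3^3"
  by (simp add: det_3 adjoint_matrix_def algebra_simps)

lemma SU3_adjoint_left: "A \<in> carrier SU3 \<Longrightarrow> adjoint_matrix A ** A = mat 1"
  using matrix_left_right_inverse by (auto simp: SU3_carrier)

lemma SU3_adjoint: "A \<in> carrier SU3 \<Longrightarrow> adjoint_matrix A \<in> carrier SU3"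
  using SU3_adjoint_left by (auto simp: SU3_carrier det_adjoint)

lemma SU3_closed: "A \<in> carrier SU3 \<Longrightarrow> B \<in> carrier SU3 \<Longrightarrow> A ** B \<in> carrier SU3"
  unfolding SU3_carrier det_mul adjoint_matrix_mult
  by (metis matrix_mul_assoc matrix_mul_rid mult_1)

lemma group_SU3: "group SU3"
proof (rule groupI)
  show "\<exists>y\<in>carrier SU3. y \<otimes>\<^bsub>SU3\<^esub> x = \<one>\<^bsub>SU3\<^esub>" if "x \<in> carrier SU3" for x
    using SU3_adjoint[OF that] SU3_adjoint_left[OF that] by auto
qed (auto simp: SU3_closed matrix_mul_assoc, simp add: SU3_carrier)

lemma SU3_inv: "A \<in> carrier SU3 \<Longrightarrow> inv\<^bsub>SU3\<^esub> A = adjoint_matrix A"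
  by (intro group.inv_equality[OF group_SU3]) (auto simp: SU3_adjoint SU3_adjoint_left)

lemma SU3_matrix_inv: "A \<in> carrier SU3 \<Longrightarrow> matrix_inv A = adjoint_matrix A"
proof -
  assume A: "A \<in> carrier SU3"
  then have "invertible A"
    using SU3_adjoint_left unfolding invertible_def SU3_carrier by blast
  then have "adjoint_matrix A ** (A ** matrix_inv A) = adjoint_matrix A"
    unfolding invertible_def matrix_inv_def by (metis (mono_tags, lifting) matrix_mul_rid someI_ex)
  then show ?thesis
    using A by (simp add: matrix_mul_assoc SU3_adjoint_left)
qed

lemma line_reflection_SU3: "v \<noteq> 0 \<Longrightarrow> line_reflection v \<in> carrier SU3"
  by (simp add: SU3_carrier line_reflection_involution det_line_reflection)

lemma hermitian_mult_vec: "hermitian (A *v x) y = hermitian x (adjoint_matrix A *v y)"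
  for A :: "complex^3^3"
  by (simp add: hermitian_3 matrix_vector_mult_def sum_3 adjoint_matrix_def algebra_simps)

lemma SU3_mult_vec_nonzero:
  assumes "U \<in> carrier SU3" "v \<noteq> 0" shows "U *v v \<noteq> 0"
  by (metis SU3_adjoint_left assms matrix_vector_mul_assoc matrix_vector_mul_lid matrix_vector_mult_0_right)

lemma conjugate_line_reflection:
  assumes "U \<in> carrier SU3"
  shows "U ** line_reflection v ** adjoint_matrix U = line_reflection (U *v v)"
proof -
  have "(U ** line_reflection v ** adjoint_matrix U) *v x = line_reflection (U *v v) *v x" for x
  proof -
    have 1: "hermitian (U *v v) (U *v v) = hermitian v v"
      using assms by (simp add: hermitian_mult_vec matrix_vector_mul_assoc SU3_adjoint_left)
    have 2: "hermitian (adjoint_matrix U *v x) v = hermitian x (U *v v)"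
      by (simp add: hermitian_mult_vec)
    have 3: "U *v (adjoint_matrix U *v x) = x"
      using assms by (simp add: matrix_vector_mul_assoc SU3_carrier)
    show ?thesis
      unfolding matrix_vector_mul_assoc[symmetric] line_reflection_mult_vec matrix_vector_mult_diff_distrib 1 2 3
      by (simp add: vector_scalar_commute)
  qed
  then show ?thesis
    by (simp add: matrix_eq)
qed

lemma Phi_eq_line_reflection: "Phi = line_reflection (axis 1 1)"
  by (simp add: Phi_def line_reflection_def vec_eq_iff forall_3 hermitian_3 axis_def)

text \<open>For two unit vectors with real inner product, the line of the sum is a bisector. Reality
  enters as \<open>hermitian e u = hermitian u e\<close>, which makes the squared norm of
  \<open>e + u\<close> equal to \<open>2 * hermitian e (e + u)\<close>.\<close>

lemma line_reflection_swap:
  fixes u e :: "complex^3"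
  assumes "hermitian u u = 1" "hermitian e e = 1" "hermitian e u = hermitian u e" "e + u \<noteq> 0"
  shows "line_reflection (e + u) *v e = u"
proof -
  have *: "hermitian (e + u) (e + u) = 2 * hermitian e (e + u)"
    using assms by (simp add: hermitian_add_left hermitian_add_right)
  then have "hermitian e (e + u) \<noteq> 0"
    using assms(4) hermitian_self_eq_0_iff[of "e+u"] by force
  then have "2 * hermitian e (e + u) / hermitian (e + u) (e + u) = 1"
    unfolding * by simp
  then show ?thesis
    by (simp add: line_reflection_mult_vec)
qed

text \<open>The phase makes the first coordinate real and nonnegative. Then the inner product with
  the first basis vector is real and the sum with that vector cannot vanish, as
  \<open>line_reflection_swap\<close> requires.\<close>

lemma unit_vector_on_line:
  fixes v :: "complex^3"
  assumes "v \<noteq> 0"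
  obtains c r where "c \<noteq> 0" "hermitian (c *s v) (c *s v) = 1" "(c *s v) $ 1 = of_real r" "r \<ge> 0"
proof -
  define s where "s = sqrt ((norm (v$1))\<^sup>2 + (norm (v$2))\<^sup>2 + (norm (v$3))\<^sup>2)"
  have s2: "hermitian v v = of_real (s\<^sup>2)"
    unfolding hermitian_self s_def by (subst real_sqrt_pow2) auto
  have s0: "s > 0"
  proof -
    have "s \<noteq> 0" using assms s2 hermitian_self_eq_0_iff[of v] by auto
    moreover have "s \<ge> 0" unfolding s_def by simp
    ultimately show ?thesis by simp
  qed
  define w where "w = (if v$1 = 0 then 1 else cnj (sgn (v$1)))"
  have w: "norm w = 1"
    by (simp add: w_def norm_sgn)
  have w1: "w * v$1 = of_real (norm (v$1))"
    by (auto simp: w_def sgn_eq complex_norm_square[symmetric] power2_eq_square field_simps)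
  show thesis
  proof (rule that[of "w / of_real s" "norm (v$1) / s"])
    show "w / of_real s \<noteq> 0" using w s0 by auto
    have "w * cnj w = 1" using w by (simp add: complex_norm_square[symmetric])
    then show "hermitian ((w / of_real s) *s v) ((w / of_real s) *s v) = 1"
      using s0 by (simp add: s2 power2_eq_square field_simps)
    show "((w / of_real s) *s v) $ 1 = of_real (norm (v$1) / s)"
      using w1 s0 by (simp add: field_simps)
    show "norm (v$1) / s \<ge> 0" using s0 by simp
  qed
qed

text \<open>Conjugation by \<open>U\<close> moves the line of a reflection by \<open>U\<close>, and
  \<open>Phi\<close> is the reflection in the first basis vector. Conversely, the conjugating
  element is itself a reflection, in the bisector of that basis vector and a normalised
  \<open>v\<close>, so it has determinant 1 from the start.\<close>

lemma conjugate_Phi_iff: "conjugate_in_SU3 A Phi \<longleftrightarrow> (\<exists>v. v \<noteq> 0 \<and> A = line_reflection v)"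
proof
  assume "conjugate_in_SU3 A Phi"
  then obtain U where U: "U \<in> carrier SU3" "A = U ** Phi ** adjoint_matrix U"
    by (auto simp: conjugate_in_SU3_def SU3_matrix_inv)
  then have "A = line_reflection (U *v axis 1 1)"
    by (simp add: Phi_eq_line_reflection conjugate_line_reflection)
  then show "\<exists>v. v \<noteq> 0 \<and> A = line_reflection v"
    using SU3_mult_vec_nonzero[OF U(1)] by (metis axis_eq_0_iff zero_neq_one)
next
  assume "\<exists>v. v \<noteq> 0 \<and> A = line_reflection v"
  then obtain v where v: "v \<noteq> 0" "A = line_reflection v"
    by blast
  obtain c r where c: "c \<noteq> 0" "hermitian (c *s v) (c *s v) = 1" "(c *s v) $ 1 = of_real r" "r \<ge> 0"
    using unit_vector_on_line[OF v(1)] .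
  define u where "u = c *s v"
  define e where "e = (axis 1 1 :: complex^3)"
  have e: "hermitian e e = 1"
    by (simp add: e_def hermitian_3 axis_def)
  have "hermitian e u = hermitian u e"
    using c(3) by (simp add: e_def u_def[symmetric] hermitian_3 axis_def)
  moreover have "(e + u) $ 1 = of_real (1 + r)"
    using c(3) by (simp add: e_def u_def[symmetric])
  then have "(e + u) $ 1 \<noteq> 0"
    using c(4) by (simp only: of_real_eq_0_iff)
  then have 0: "e + u \<noteq> 0"
    by (metis zero_index)
  ultimately have eq: "line_reflection (e + u) *v e = u"
    using line_reflection_swap[of u e] c(2) e by (simp add: u_def)
  define U where "U = line_reflection (e + u)"
  have U: "U \<in> carrier SU3"
    using 0 by (simp add: U_def line_reflection_SU3)
  have "U ** Phi ** matrix_inv U = line_reflection u"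
    using conjugate_line_reflection[OF U, of e] eq U by (simp add: SU3_matrix_inv Phi_eq_line_reflection U_def e_def)
  then have "A = U ** Phi ** matrix_inv U"
    using v(2) c(1) by (simp add: u_def line_reflection_scale)
  then show "conjugate_in_SU3 A Phi"
    using U unfolding conjugate_in_SU3_def by blast
qed

lemma orthogonal_complex_lines:
  "orthogonal_lines (complex_line v) (complex_line w) \<longleftrightarrow> hermitian v w = 0"
proof
  assume *: "orthogonal_lines (complex_line v) (complex_line w)"
  have "1 *s v \<in> complex_line v" "1 *s w \<in> complex_line w"
    unfolding complex_line_def by blast+
  then show "hermitian v w = 0"
    using * by (simp add: orthogonal_lines_def)
next
  assume "hermitian v w = 0"
  then show "orthogonal_lines (complex_line v) (complex_line w)"
    by (auto simp: orthogonal_lines_def complex_line_def)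
qed

lemma line_reflection_ne_1:
  assumes "v \<noteq> 0" shows "line_reflection v \<noteq> mat 1"
proof
  assume *: "line_reflection v = mat 1"
  have "trace (line_reflection v) = -1"
  proof -
    have "trace (line_reflection v) = 2 * hermitian v v / hermitian v v - 3"
      unfolding hermitian_3[of v v] by (simp add: trace_def sum_3 line_reflection_def hermitian_3 add_divide_distrib distrib_left)
    then show ?thesis
      using assms by simp
  qed
  then show False
    unfolding * by (simp add: trace_def sum_3 mat_def)
qed

text \<open>Taking adjoints of the product shows that the two reflections commute, so the first one
  maps the line of \<open>b\<close> to itself. If \<open>a\<close> and \<open>b\<close> were not
  orthogonal, their lines would coincide and the third reflection would be the identity.\<close>

lemma orthogonal_if_reflections_commute:
  assumes "a \<noteq> 0" "b \<noteq> 0" "c \<noteq> 0" "line_reflection a ** line_reflection b = line_reflection c"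
  shows "hermitian a b = 0"
proof (rule ccontr)
  assume *: "hermitian a b \<noteq> 0"
  have "line_reflection a ** line_reflection b = line_reflection b ** line_reflection a"
    using arg_cong[OF assms(4), of adjoint_matrix] assms(4) by (metis adjoint_matrix_mult adjoint_line_reflection)
  moreover have "line_reflection b *v b = b"
    using assms(2) by (simp add: line_reflection_mult_vec vec_eq_iff)
  ultimately have "line_reflection b *v (line_reflection a *v b) = line_reflection a *v b"
    by (metis matrix_vector_mul_assoc)
  then have "line_reflection a *v b \<in> complex_line b"
    using eigenspace_line_reflection[OF assms(2)] by (auto simp: eigenspace_1_def)
  then obtain d where "(2 * hermitian b a / hermitian a a) *s a - b = d *s b"
    unfolding complex_line_def line_reflection_mult_vec by blast
  then have eq: "(2 * hermitian b a / hermitian a a) *s a = (d + 1) *s b"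
    by (simp add: vec_eq_iff algebra_simps)
  have nz: "2 * hermitian b a / hermitian a a \<noteq> 0"
    using * assms cnj_hermitian[of b a] by auto
  then have "d + 1 \<noteq> 0"
    using eq assms(1) by (metis vector_mul_eq_0)
  then have "line_reflection a = line_reflection b"
    using nz eq line_reflection_scale by metis
  then show False
    using assms line_reflection_involution line_reflection_ne_1 by metis
qed

text \<open>On the line of \<open>c\<close> both reflections act as -1, on each of the other two
  lines exactly one of them does.\<close>

lemma orthogonal_reflections_product:
  assumes nz: "a \<noteq> 0" "b \<noteq> 0" "c \<noteq> 0"
    and orth: "hermitian a b = 0" "hermitian b c = 0" "hermitian a c = 0"
  shows "line_reflection a ** line_reflection b = line_reflection c"
proof -
  define P where "P v = (\<chi> i j. v$i * cnj (v$j) / hermitian v v)" for v :: "complex^3"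
  have orth': "hermitian b a = 0" "hermitian c b = 0" "hermitian c a = 0"
    using orth cnj_hermitian complex_cnj_zero_iff by metis+
  define U :: "complex^3^3" where "U = vector [a, b, c]"
  define W :: "complex^3^3" where
    "W = (\<chi> i j. cnj (U$j$i) / hermitian (U$j) (U$j))"
  have "U ** W = mat 1"
    using nz orth orth'
    by (simp add: vec_eq_iff forall_3 matrix_matrix_mult_def mat_def sum_3 W_def U_def
        hermitian_3[of a b] hermitian_3[of b c] hermitian_3[of a c] hermitian_3[of b a]
        hermitian_3[of c b] hermitian_3[of c a]
        flip: add_divide_distrib hermitian_3[of a a] hermitian_3[of b b] hermitian_3[of c c])
  \<comment> \<open>\<open>U ** W = mat 1\<close> says that the rows of \<open>U\<close> are
    orthogonal; the reversed product is the completeness relation: the three projections add up to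
    the identity.\<close>
  then have "W ** U = mat 1"
    using matrix_left_right_inverse by blast
  then have sum: "cnj (a$i) * a$j / hermitian a a + cnj (b$i) * b$j / hermitian b b
      + cnj (c$i) * c$j / hermitian c c = (if i = j then 1 else 0)" for i j
    by (simp add: vec_eq_iff matrix_matrix_mult_def mat_def sum_3 W_def U_def)
  have expand: "x = (hermitian x a / hermitian a a) *s a + (hermitian x b / hermitian b b) *s b
      + (hermitian x c / hermitian c c) *s c" for x
  proof -
    have "x $ j = hermitian x a / hermitian a a * a $ j + hermitian x b / hermitian b b * b $ j
      + hermitian x c / hermitian c c * c $ j" for j
    proof -
      have "x $ j = (\<Sum>i\<in>UNIV. x$i * (if i = j then 1 else 0))"
        by (simp add: if_distrib cong: if_cong)
      also have "\<dots> = (\<Sum>i\<in>UNIV. x$i * (cnj (a$i) * a$j / hermitian a a + cnj (b$i) * b$j / hermitian b b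
        + cnj (c$i) * c$j / hermitian c c))"
        by (simp only: sum)
      also have "\<dots> = hermitian x a / hermitian a a * a $ j + hermitian x b / hermitian b b * b $ j
        + hermitian x c / hermitian c c * c $ j"
        unfolding sum_3 hermitian_3[of x] divide_inverse by (simp add: algebra_simps)
      finally show ?thesis .
    qed
    then show ?thesis
      unfolding vec_eq_iff vector_add_component vector_smult_component by blast
  qed
  have "(line_reflection a ** line_reflection b) *v x = line_reflection c *v x" for x
  proof -
    define y where "y = line_reflection b *v x"
    have ha: "hermitian y a = - hermitian x a"
      using orth' unfolding y_def line_reflection_mult_vec
      by (simp add: hermitian_diff_left)
    have "(line_reflection a ** line_reflection b) *v x
       = - (2 * hermitian x a / hermitian a a) *s a - (2 * hermitian x b / hermitian b b) *s b + x"
      unfolding matrix_vector_mul_assoc[symmetric] y_def[symmetric]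
      unfolding line_reflection_mult_vec[of a] ha unfolding y_def line_reflection_mult_vec
      by (simp add: vec_eq_iff)
    also have "\<dots> = line_reflection c *v x"
      using expand[of x] unfolding line_reflection_mult_vec
      by (simp add: vec_eq_iff)
    finally show ?thesis .
  qed
  then show ?thesis
    by (simp add: matrix_eq)
qed

section \<open>Flat bundles over the complement of a plane set\<close>

text \<open>The whole vertical line over a point off \<open>X\<close> belongs to both parts. Hence
  both are open when \<open>X\<close> is closed, and they overlap exactly in the cylinder over the
  complement of \<open>X\<close>.\<close>

definition upper_part :: "complex set \<Rightarrow> (complex \<times> real) set" where
  "upper_part X = {x. snd x > 0 \<or> fst x \<notin> X}"

definition lower_part :: "complex set \<Rightarrow> (complex \<times> real) set" where
  "lower_part X = {x. snd x < 0 \<or> fst x \<notin> X}"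

lemma upper_Int_lower: "upper_part X \<inter> lower_part X = {x. fst x \<notin> X}"
  by (auto simp: upper_part_def lower_part_def)

lemma upper_Un_lower: "upper_part X \<union> lower_part X = - (X \<times> {0})"
  by (auto simp: upper_part_def lower_part_def)

lemma open_upper_part: "closed X \<Longrightarrow> open (upper_part X)"
proof -
  assume "closed X"
  have "upper_part X = snd -` {0<..} \<union> fst -` (- X)"
    by (auto simp: upper_part_def)
  then show ?thesis
    using \<open>closed X\<close> by (auto intro!: open_Un open_vimage_snd open_vimage_fst)
qed

lemma open_lower_part: "closed X \<Longrightarrow> open (lower_part X)"
proof -
  assume "closed X"
  have "lower_part X = snd -` {..<0} \<union> fst -` (- X)"
    by (auto simp: lower_part_def)
  then show ?thesis
    using \<open>closed X\<close> by (auto intro!: open_Un open_vimage_snd open_vimage_fst)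
qed

text \<open>Points are first raised vertically to height at least 1, which never leaves the set; the
  half-space reached in this way is convex.\<close>

lemma contractible_upper_part: "contractible (upper_part X)"
proof -
  let ?f = "\<lambda>x::complex \<times> real. (fst x, max 1 (snd x))"
  have seg: "closed_segment x (?f x) \<subseteq> upper_part X" if "x \<in> upper_part X" for x
  proof
    fix y assume "y \<in> closed_segment x (?f x)"
    then obtain u where u: "0 \<le> u" "u \<le> 1" "y = (1 - u) *\<^sub>R x + u *\<^sub>R ?f x"
      by (auto simp: closed_segment_def)
    have "fst y = (1 - u) *\<^sub>R fst x + u *\<^sub>R fst x"
      using u(3) by simp
    then have f: "fst y = fst x"
      by (simp flip: scaleR_add_left)
    have "snd y = (1 - u) * snd x + u * max 1 (snd x)"
      using u by simp
    moreover have "\<dots> \<ge> (1 - u) * snd x + u * snd x"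
      using u by (intro add_left_mono mult_left_mono) auto
    ultimately have "snd y \<ge> snd x"
      by (simp add: algebra_simps)
    with f that show "y \<in> upper_part X"
      by (auto simp: upper_part_def)
  qed
  have "homotopic_with_canon (\<lambda>x. True) (upper_part X) (upper_part X) id ?f"
    using seg by (intro homotopic_with_linear continuous_intros) auto
  moreover have "homotopic_with_canon (\<lambda>x. True) (upper_part X) {x. snd x \<ge> 1} ?f (\<lambda>x. (0,1))"
  proof (intro homotopic_with_linear continuous_intros)
    have "{x::complex \<times> real. snd x \<ge> 1} = UNIV \<times> {1..}"
      by auto
    then have "convex {x::complex \<times> real. snd x \<ge> 1}"
      by (simp add: convex_Times)
    then show "closed_segment (?f x) (0,1) \<subseteq> {x. snd x \<ge> 1}" for x
      by (intro closed_segment_subset) auto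
  qed
  then have "homotopic_with_canon (\<lambda>x. True) (upper_part X) (upper_part X) ?f (\<lambda>x. (0,1))"
    by (rule homotopic_with_subset_right) (auto simp: upper_part_def)
  ultimately show ?thesis
    unfolding contractible_def by (blast intro: homotopic_with_trans)
qed

lemma lower_part_eq: "lower_part X = (\<lambda>x. (fst x, - snd x)) ` upper_part X"
proof (intro equalityI subsetI)
  fix x assume "x \<in> lower_part X"
  then have "(fst x, - snd x) \<in> upper_part X" "x = (fst (fst x, - snd x), - snd (fst x, - snd x))"
    by (auto simp: lower_part_def upper_part_def)
  then show "x \<in> (\<lambda>x. (fst x, - snd x)) ` upper_part X"
    by blast
qed (auto simp: lower_part_def upper_part_def)

lemma contractible_lower_part: "contractible (lower_part X)"
proof -
  have "upper_part X homeomorphic lower_part X"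
    unfolding lower_part_eq
    by (rule homeomorphicI[where g="\<lambda>x. (fst x, - snd x)"]) (auto intro!: continuous_intros simp: image_image)
  then show ?thesis
    using contractible_upper_part homeomorphic_contractible_eq by blast
qed

text \<open>A section over \<open>W\<close>, pulled back along \<open>h\<close>, of the flat bundle on the complement of \<open>X \<times> {0}\<close>
  that is trivial over the upper and the lower part, with the locally constant transition function \<open>g\<close>.\<close>

definition flat_section ::
    "('a, 'm) monoid_scheme \<Rightarrow> complex set \<Rightarrow> (complex \<Rightarrow> 'a) \<Rightarrow> ('c::topological_space \<Rightarrow> complex \<times> real)
      \<Rightarrow> 'c set \<Rightarrow> ('c \<Rightarrow> 'a) \<Rightarrow> ('c \<Rightarrow> 'a) \<Rightarrow> bool" where
  "flat_section \<Gamma> X g h W a b \<longleftrightarrow>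
     (\<forall>x\<in>W. h x \<in> upper_part X \<longrightarrow> a x \<in> carrier \<Gamma> \<and> (\<forall>\<^sub>F y in at x within W. a x = a y)) \<and>
     (\<forall>x\<in>W. h x \<in> lower_part X \<longrightarrow> b x \<in> carrier \<Gamma> \<and> (\<forall>\<^sub>F y in at x within W. b x = b y)) \<and>
     (\<forall>x\<in>W. fst (h x) \<notin> X \<longrightarrow> b x = a x \<otimes>\<^bsub>\<Gamma>\<^esub> g (fst (h x)))"

lemma flat_section_subset:
  assumes "flat_section \<Gamma> X g h W a b" "V \<subseteq> W"
  shows "flat_section \<Gamma> X g h V a b"
  using assms unfolding flat_section_def
  by (auto intro: filter_leD[OF at_le[OF assms(2)]])

lemma eventually_at_within_compose:
  assumes "\<forall>\<^sub>F y in at (f x) within W. P y" "P (f x)" "continuous_on V f" "f ` V \<subseteq> W" "x \<in> V"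
  shows "\<forall>\<^sub>F y in at x within V. P (f y)"
proof -
  obtain S where S: "open S" "f x \<in> S" "\<And>y. y \<in> S \<Longrightarrow> y \<noteq> f x \<Longrightarrow> y \<in> W \<Longrightarrow> P y"
    using assms(1) unfolding eventually_at_topological by blast
  have "(f \<longlongrightarrow> f x) (at x within V)"
    using assms(3,5) by (simp add: continuous_on_def)
  then have "\<forall>\<^sub>F y in at x within V. f y \<in> S"
    by (rule topological_tendstoD[OF _ S(1,2)])
  moreover have "\<forall>\<^sub>F y in at x within V. y \<in> V"
    by (simp add: eventually_at_filter)
  ultimately show ?thesis
    by eventually_elim (metis S(3) assms(2,4) image_subset_iff)
qed

lemma flat_section_compose:
  assumes "flat_section \<Gamma> X g h W a b" "continuous_on V f" "f ` V \<subseteq> W"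
  shows "flat_section \<Gamma> X g (h \<circ> f) V (a \<circ> f) (b \<circ> f)"
  unfolding flat_section_def o_def
proof (intro conjI ballI impI)
  note * = assms(1)[unfolded flat_section_def]
  fix x assume x: "x \<in> V"
  then have fx: "f x \<in> W" using assms(3) by auto
  show "a (f x) \<in> carrier \<Gamma>" "\<forall>\<^sub>F y in at x within V. a (f x) = a (f y)" if "h (f x) \<in> upper_part X"
    using * fx that eventually_at_within_compose[OF _ _ assms(2,3) x, of "\<lambda>y. a (f x) = a y"] by auto
  show "b (f x) \<in> carrier \<Gamma>" "\<forall>\<^sub>F y in at x within V. b (f x) = b (f y)" if "h (f x) \<in> lower_part X"
    using * fx that eventually_at_within_compose[OF _ _ assms(2,3) x, of "\<lambda>y. b (f x) = b y"] by auto
  show "b (f x) = a (f x) \<otimes>\<^bsub>\<Gamma>\<^esub> g (fst (h (f x)))" if "fst (h (f x)) \<notin> X"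
    using * fx that by auto
qed

lemma flat_section_cong:
  assumes "flat_section \<Gamma> X g h W a b" "\<And>x. x \<in> W \<Longrightarrow> h x = h' x"
    "\<And>x. x \<in> W \<Longrightarrow> a x = a' x" "\<And>x. x \<in> W \<Longrightarrow> b x = b' x"
  shows "flat_section \<Gamma> X g h' W a' b'"
proof -
  have "(\<forall>\<^sub>F y in at x within W. a x = a y) = (\<forall>\<^sub>F y in at x within W. a' x = a' y)"
       "(\<forall>\<^sub>F y in at x within W. b x = b y) = (\<forall>\<^sub>F y in at x within W. b' x = b' y)" if "x \<in> W" for x
    using assms that by (auto simp: eventually_at_filter elim!: eventually_mono)
  note eqs = this
  show ?thesis
    unfolding flat_section_def
  proof (intro conjI ballI impI)
    fix x assume x: "x \<in> W"
    note * = assms(1)[unfolded flat_section_def] eqs[OF x] assms(2-4)[OF x]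
    show "a' x \<in> carrier \<Gamma>" "\<forall>\<^sub>F y in at x within W. a' x = a' y" if "h' x \<in> upper_part X"
      using * x that by auto
    show "b' x \<in> carrier \<Gamma>" "\<forall>\<^sub>F y in at x within W. b' x = b' y" if "h' x \<in> lower_part X"
      using * x that by auto
    show "b' x = a' x \<otimes>\<^bsub>\<Gamma>\<^esub> g (fst (h' x))" if "fst (h' x) \<notin> X"
      using * x that by auto
  qed
qed

locale flat_bundle = group \<Gamma> for \<Gamma> (structure) +
  fixes X :: "complex set" and g :: "complex \<Rightarrow> 'a"
  assumes X: "closed X"
    and g_carrier: "\<And>z. z \<notin> X \<Longrightarrow> g z \<in> carrier \<Gamma>"
    and g_local: "\<And>z. z \<notin> X \<Longrightarrow> \<forall>\<^sub>F w in at z. g z = g w"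
begin

lemma flat_section_translate:
  assumes "flat_section \<Gamma> X g h W a b" "c \<in> carrier \<Gamma>"
  shows "flat_section \<Gamma> X g h W (\<lambda>x. c \<otimes> a x) (\<lambda>x. c \<otimes> b x)"
proof -
  have 1: "h x \<in> upper_part X" if "fst (h x) \<notin> X" for x
    using that by (simp add: upper_part_def)
  show ?thesis
    using assms g_carrier 1 unfolding flat_section_def
    by (auto simp: m_assoc elim!: eventually_mono)
qed

text \<open>The quotients \<open>a' x \<otimes> inv (a x)\<close> and
  \<open>b' x \<otimes> inv (b x)\<close> agree on the overlap because the transition function acts
  from the right. Together they form one locally constant function on the connected set
  \<open>W\<close>.\<close>

lemma flat_section_unique:
  assumes s: "flat_section \<Gamma> X g h W a b" and s': "flat_section \<Gamma> X g h W a' b'"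
    and W: "connected W" and h: "continuous_on W h" "h ` W \<subseteq> - (X \<times> {0})"
  obtains c where "c \<in> carrier \<Gamma>" "\<And>x. x \<in> W \<Longrightarrow> h x \<in> upper_part X \<Longrightarrow> a' x = c \<otimes> a x"
    "\<And>x. x \<in> W \<Longrightarrow> h x \<in> lower_part X \<Longrightarrow> b' x = c \<otimes> b x"
proof (cases "W = {}")
  case True
  then show ?thesis using that[of \<one>] by auto
next
  case False
  note s = s[unfolded flat_section_def] and s' = s'[unfolded flat_section_def]
  define C where "C x = (if h x \<in> upper_part X then a' x \<otimes> inv (a x) else b' x \<otimes> inv (b x))" for x
  have both: "C x = b' x \<otimes> inv (b x)" if "x \<in> W" "h x \<in> lower_part X" for x
  proof (cases "h x \<in> upper_part X")
    case True
    then have nX: "fst (h x) \<notin> X"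
      using that upper_Int_lower[of X] by blast
    have m: "a x \<in> carrier \<Gamma>" "a' x \<in> carrier \<Gamma>" "g (fst (h x)) \<in> carrier \<Gamma>"
      using s s' that True g_carrier nX by auto
    have "b x = a x \<otimes> g (fst (h x))" "b' x = a' x \<otimes> g (fst (h x))"
      using s s' that nX by auto
    then have "b' x \<otimes> inv (b x) = a' x \<otimes> (g (fst (h x)) \<otimes> (inv (g (fst (h x))) \<otimes> inv (a x)))"
      using m by (simp add: inv_mult_group m_assoc)
    also have "g (fst (h x)) \<otimes> (inv (g (fst (h x))) \<otimes> inv (a x)) = inv (a x)"
      using m by (simp flip: m_assoc)
    finally show ?thesis
      using True by (simp add: C_def)
  qed (simp add: C_def)
  have cases: "h x \<in> upper_part X \<or> h x \<in> lower_part X" if "x \<in> W" for x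
    using h(2) that upper_Un_lower[of X] by blast
  have near: "\<forall>\<^sub>F y in at x within W. y \<in> W \<and> h y \<in> U" if "x \<in> W" "h x \<in> U" "open U" for x U
  proof -
    have "(h \<longlongrightarrow> h x) (at x within W)"
      using h(1) that(1) by (simp add: continuous_on_def)
    then have "\<forall>\<^sub>F y in at x within W. h y \<in> U"
      using that(2,3) topological_tendstoD by blast
    then show ?thesis
      by (simp add: eventually_at_filter)
  qed
  have loc: "\<forall>x\<in>W. \<forall>\<^sub>F y in at x within W. C x = C y"
  proof
    fix x assume x: "x \<in> W"
    from cases[OF x] show "\<forall>\<^sub>F y in at x within W. C x = C y"
    proof
      assume u: "h x \<in> upper_part X"
      have "\<forall>\<^sub>F y in at x within W. a x = a y" "\<forall>\<^sub>F y in at x within W. a' x = a' y"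
        using s s' x u by auto
      with near[OF x u open_upper_part[OF X]] show ?thesis
        by eventually_elim (use u in \<open>auto simp: C_def\<close>)
    next
      assume l: "h x \<in> lower_part X"
      have "\<forall>\<^sub>F y in at x within W. b x = b y" "\<forall>\<^sub>F y in at x within W. b' x = b' y"
        using s s' x l by auto
      with near[OF x l open_lower_part[OF X]] show ?thesis
        by eventually_elim (use l x both in auto)
    qed
  qed
  obtain w where w: "w \<in> W" using False by blast
  have eq: "C x = C w" if "x \<in> W" for x
    using connected_local_const[OF W that w loc] .
  show thesis
  proof (rule that[of "C w"])
    show "C w \<in> carrier \<Gamma>"
      using cases[OF w] both[OF w] s s' w by (auto simp: C_def)
    show "a' x = C w \<otimes> a x" if "x \<in> W" "h x \<in> upper_part X" for x
    proof -
      have "C w = a' x \<otimes> inv (a x)"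
        using eq[OF that(1)] that(2) by (simp add: C_def)
      then show ?thesis
        using s s' that by (simp add: m_assoc)
    qed
    show "b' x = C w \<otimes> b x" if "x \<in> W" "h x \<in> lower_part X" for x
    proof -
      have "C w = b' x \<otimes> inv (b x)"
        using eq[OF that(1)] both[OF that] by simp
      then show ?thesis
        using s s' that by (simp add: m_assoc)
    qed
  qed
qed

text \<open>Over the connected intersection the two sections differ by a constant on the left;
  translating the first one by it makes them agree. Since both pieces are closed, a point outside
  one of them is not a limit point of it.\<close>

lemma flat_section_glue:
  assumes s: "flat_section \<Gamma> X g h V a b" and s': "flat_section \<Gamma> X g h W a' b'"
    and VW: "closed V" "closed W" "connected (V \<inter> W)"
    and h: "continuous_on (V \<union> W) h" "h ` (V \<union> W) \<subseteq> - (X \<times> {0})"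
  obtains a'' b'' where "flat_section \<Gamma> X g h (V \<union> W) a'' b''"
proof -
  have "flat_section \<Gamma> X g h (V \<inter> W) a b" "flat_section \<Gamma> X g h (V \<inter> W) a' b'"
    using s s' flat_section_subset by (metis Int_lower1 Int_lower2)+
  moreover have "continuous_on (V \<inter> W) h" "h ` (V \<inter> W) \<subseteq> - (X \<times> {0})"
    using h continuous_on_subset by blast+
  ultimately obtain c where c: "c \<in> carrier \<Gamma>"
    "\<And>x. x \<in> V \<inter> W \<Longrightarrow> h x \<in> upper_part X \<Longrightarrow> a' x = c \<otimes> a x"
    "\<And>x. x \<in> V \<inter> W \<Longrightarrow> h x \<in> lower_part X \<Longrightarrow> b' x = c \<otimes> b x"
    by (rule flat_section_unique[OF _ _ VW(3)]) (rule that; blast)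
  define A where "A x = (if x \<in> V then c \<otimes> a x else a' x)" for x
  define B where "B x = (if x \<in> V then c \<otimes> b x else b' x)" for x
  have sV: "flat_section \<Gamma> X g h V (\<lambda>x. c \<otimes> a x) (\<lambda>x. c \<otimes> b x)"
    using s c(1) by (rule flat_section_translate)
  note sV = sV[unfolded flat_section_def] and s' = s'[unfolded flat_section_def]
  have glue: "\<forall>\<^sub>F y in at x within V \<union> W. F x = F y"
    if x: "x \<in> V \<union> W" "h x \<in> U" and U: "open U"
      and fV: "x \<in> V \<Longrightarrow> \<forall>\<^sub>F y in at x within V. f x = f y"
      and fW: "x \<in> W \<Longrightarrow> \<forall>\<^sub>F y in at x within W. f' x = f' y"
      and F: "\<And>y. F y = (if y \<in> V then f y else f' y)"
      and agree: "\<And>y. y \<in> V \<inter> W \<Longrightarrow> h y \<in> U \<Longrightarrow> f' y = f y"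
    for x U and F f f' :: "_ \<Rightarrow> 'a"
    unfolding at_within_union eventually_sup
  proof
    have hU: "\<forall>\<^sub>F y in at x within V \<union> W. h y \<in> U"
      using h(1) x U by (metis continuous_on_def topological_tendstoD)
    show "\<forall>\<^sub>F y in at x within V. F x = F y"
    proof (cases "x \<in> V")
      case True
      have "\<forall>\<^sub>F y in at x within V. y \<in> V"
        by (simp add: eventually_at_filter)
      then show ?thesis
        using fV[OF True] by eventually_elim (simp add: F True)
    next
      case False
      then have "at x within V = bot"
        using VW(1) by (metis closed_limpt trivial_limit_within)
      then show ?thesis by simp
    qed
    show "\<forall>\<^sub>F y in at x within W. F x = F y"
    proof (cases "x \<in> W")
      case True
      have "\<forall>\<^sub>F y in at x within W. y \<in> W"
        by (simp add: eventually_at_filter)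
      moreover have "\<forall>\<^sub>F y in at x within W. h y \<in> U"
        using hU by (simp add: at_within_union eventually_sup)
      ultimately show ?thesis
        using fW[OF True] by eventually_elim (use F True agree x in auto)
    next
      case False
      then have "at x within W = bot"
        using VW(2) by (metis closed_limpt trivial_limit_within)
      then show ?thesis by simp
    qed
  qed
  have "flat_section \<Gamma> X g h (V \<union> W) A B"
    unfolding flat_section_def
  proof (intro conjI ballI impI)
    fix x assume x: "x \<in> V \<union> W"
    show "A x \<in> carrier \<Gamma>" if "h x \<in> upper_part X"
      using sV s' x that unfolding A_def by auto
    show "B x \<in> carrier \<Gamma>" if "h x \<in> lower_part X"
      using sV s' x that unfolding B_def by auto
    show "\<forall>\<^sub>F y in at x within V \<union> W. A x = A y" if "h x \<in> upper_part X"
      using glue[of x "upper_part X" "\<lambda>x. c \<otimes> a x" a' A] x that sV s' c open_upper_part[OF X]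
      unfolding A_def by auto
    show "\<forall>\<^sub>F y in at x within V \<union> W. B x = B y" if "h x \<in> lower_part X"
      using glue[of x "lower_part X" "\<lambda>x. c \<otimes> b x" b' B] x that sV s' c open_lower_part[OF X]
      unfolding B_def by auto
    show "B x = A x \<otimes> g (fst (h x))" if "fst (h x) \<notin> X"
      using sV s' x that unfolding A_def B_def by auto
  qed
  then show thesis by (rule that)
qed

text \<open>In the chart that contains the image the section is \<open>\<one>\<close>; the other
  component is then forced to be \<open>g\<close> or its inverse.\<close>

lemma flat_section_trivial:
  assumes h: "continuous_on W h" and W: "h ` W \<subseteq> upper_part X \<or> h ` W \<subseteq> lower_part X"
  obtains a b where "flat_section \<Gamma> X g h W a b"
proof -
  have loc: "\<forall>\<^sub>F y in at x within W. g (fst (h x)) = g (fst (h y))"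
    if "x \<in> W" "fst (h x) \<notin> X" for x
  proof (rule eventually_at_within_compose[where f="\<lambda>x. fst (h x)" and W=UNIV])
    show "\<forall>\<^sub>F y in at (fst (h x)). g (fst (h x)) = g y"
      using g_local that by blast
    show "continuous_on W (\<lambda>x. fst (h x))"
      using h by (intro continuous_intros)
  qed (use that in auto)
  from W show thesis
  proof
    assume "h ` W \<subseteq> upper_part X"
    then have lower: "fst (h x) \<notin> X" if "x \<in> W" "h x \<in> lower_part X" for x
      using that upper_Int_lower[of X] by blast
    then have "flat_section \<Gamma> X g h W (\<lambda>_. \<one>) (\<lambda>x. g (fst (h x)))"
      unfolding flat_section_def using g_carrier lower loc by (intro conjI ballI impI) auto
    then show thesis by (rule that)
  next
    assume "h ` W \<subseteq> lower_part X"
    then have upper: "fst (h x) \<notin> X" if "x \<in> W" "h x \<in> upper_part X" for x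
      using that upper_Int_lower[of X] by blast
    then have "flat_section \<Gamma> X g h W (\<lambda>x. inv (g (fst (h x)))) (\<lambda>x. \<one>)"
      unfolding flat_section_def
    proof (intro conjI ballI impI)
      fix x assume x: "x \<in> W"
      show "\<forall>\<^sub>F y in at x within W. inv (g (fst (h x))) = inv (g (fst (h y)))" if "h x \<in> upper_part X"
        by (rule eventually_mono[OF loc]) (use upper x that in auto)
    qed (use g_carrier upper in auto)
    then show thesis by (rule that)
  qed
qed

text \<open>The square is subdivided until each cell lies in one chart, and the cells are glued
  along connected intersections. \<open>Bolzano\<close> is applied twice: along the second
  coordinate to obtain thin strips of full length, then along the first.\<close>

lemma flat_section_exists:
  fixes h :: "real \<times> real \<Rightarrow> complex \<times> real"
  assumes h: "continuous_on ({0..1} \<times> {0..1}) h" "h ` ({0..1} \<times> {0..1}) \<subseteq> - (X \<times> {0})"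
  obtains a b where "flat_section \<Gamma> X g h ({0..1} \<times> {0..1}) a b"
proof -
  let ?I = "{0..1::real}"
  define ex where "ex W \<longleftrightarrow> (\<exists>a b. flat_section \<Gamma> X g h W a b)" for W
  have ex_mono: "ex V" if "ex W" "V \<subseteq> W" for V W
    using that flat_section_subset unfolding ex_def by blast
  have ex_Un: "ex (V \<union> W)"
    if "ex V" "ex W" "closed V" "closed W" "connected (V \<inter> W)" "V \<union> W \<subseteq> ?I \<times> ?I" for V W
  proof -
    obtain a b a' b' where s: "flat_section \<Gamma> X g h V a b" "flat_section \<Gamma> X g h W a' b'"
      using \<open>ex V\<close> \<open>ex W\<close> unfolding ex_def by blast
    have "continuous_on (V \<union> W) h" "h ` (V \<union> W) \<subseteq> - (X \<times> {0})"
      using h \<open>V \<union> W \<subseteq> ?I \<times> ?I\<close> continuous_on_subset by blast+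
    from flat_section_glue[OF s that(3-5) this] show ?thesis
      unfolding ex_def by blast
  qed
  \<comment> \<open>The intersections with the unit interval are there because
    \<open>Bolzano\<close> also tests intervals that stick out of it.\<close>
  have local: "\<exists>d>0. \<forall>s1 s2 t1 t2. s1 \<le> s \<and> s \<le> s2 \<and> s2 - s1 < d \<and> t1 \<le> t \<and> t \<le> t2 \<and> t2 - t1 < d
      \<longrightarrow> ex (({s1..s2} \<inter> ?I) \<times> ({t1..t2} \<inter> ?I))" if st: "s \<in> ?I" "t \<in> ?I" for s t
  proof -
    have "h (s, t) \<in> upper_part X \<union> lower_part X"
      unfolding upper_Un_lower by (rule subsetD[OF h(2)]) (use st in auto)
    then obtain U where U: "open U" "h (s,t) \<in> U" "U = upper_part X \<or> U = lower_part X"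
      using open_upper_part[OF X] open_lower_part[OF X] by (auto elim!: UnE)
    have "(h \<longlongrightarrow> h (s,t)) (at (s,t) within ?I \<times> ?I)"
      using h(1) st by (simp add: continuous_on_def)
    then have "\<forall>\<^sub>F y in at (s,t) within ?I \<times> ?I. h y \<in> U"
      by (rule topological_tendstoD[OF _ U(1,2)])
    then obtain e where e: "e > 0" "\<And>y. y \<in> ?I \<times> ?I \<Longrightarrow> dist y (s,t) < e \<Longrightarrow> h y \<in> U"
      unfolding eventually_at using U(2) by (metis dist_eq_0_iff)
    show ?thesis
    proof (intro exI[of _ "e/2"] conjI allI impI)
      show "e/2 > 0" using e by simp
      fix s1 s2 t1 t2
      assume *: "s1 \<le> s \<and> s \<le> s2 \<and> s2 - s1 < e/2 \<and> t1 \<le> t \<and> t \<le> t2 \<and> t2 - t1 < e/2"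
      have sub: "h ` (({s1..s2} \<inter> ?I) \<times> ({t1..t2} \<inter> ?I)) \<subseteq> U"
      proof (rule image_subsetI)
        fix y assume "y \<in> ({s1..s2} \<inter> ?I) \<times> ({t1..t2} \<inter> ?I)"
        then obtain s' t' where y: "y = (s', t')"
          and st': "s' \<in> {s1..s2}" "s' \<in> ?I" "t' \<in> {t1..t2}" "t' \<in> ?I"
          by (cases y) auto
        have "dist (s',t') (s,t) \<le> dist s' s + dist t' t"
          unfolding dist_Pair_Pair by (rule sqrt_sum_squares_le_sum) auto
        also have "\<dots> < e"
          using * st' by (auto simp: dist_real_def)
        finally show "h y \<in> U"
          using e(2)[of "(s',t')"] st' y by auto
      qed
      have cont: "continuous_on (({s1..s2} \<inter> ?I) \<times> ({t1..t2} \<inter> ?I)) h"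
        using h(1) by (rule continuous_on_subset) auto
      have "h ` (({s1..s2} \<inter> ?I) \<times> ({t1..t2} \<inter> ?I)) \<subseteq> upper_part X \<or>
            h ` (({s1..s2} \<inter> ?I) \<times> ({t1..t2} \<inter> ?I)) \<subseteq> lower_part X"
        using sub U(3) by fast
      from flat_section_trivial[OF cont this] obtain a b
        where "flat_section \<Gamma> X g h (({s1..s2} \<inter> ?I) \<times> ({t1..t2} \<inter> ?I)) a b" .
      then show "ex (({s1..s2} \<inter> ?I) \<times> ({t1..t2} \<inter> ?I))"
        unfolding ex_def by fast
    qed
  qed
  have interval_Int: "({t1..t2} \<inter> ?I) \<union> ({t2..t3} \<inter> ?I) = {t1..t3} \<inter> ?I"
    "connected (({t1..t2} \<inter> ?I) \<inter> ({t2..t3} \<inter> ?I))" if "t1 \<le> t2" "t2 \<le> t3" for t1 t2 t3 :: real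
    using that by (auto intro!: convex_connected convex_Int convex_real_interval)
  have conn: "connected ({s1..s2} \<inter> ?I)" for s1 s2 :: real
    by (auto intro!: convex_connected convex_Int convex_real_interval)
  have strip: "\<exists>d>0. \<forall>s1 s2. s1 \<le> s \<and> s \<le> s2 \<and> s2 - s1 < d \<longrightarrow> ex (({s1..s2} \<inter> ?I) \<times> ({0..1} \<inter> ?I))"
    if s: "s \<in> ?I" for s
  proof -
    \<comment> \<open>One width \<open>d\<close> has to serve a whole strip, so the property to be
      added up asks for some positive width; joining two intervals takes the minimum.\<close>
    define P where "P t1 t2 \<longleftrightarrow> (\<exists>d>0. \<forall>s1 s2. s1 \<le> s \<and> s \<le> s2 \<and> s2 - s1 < d
        \<longrightarrow> ex (({s1..s2} \<inter> ?I) \<times> ({t1..t2} \<inter> ?I)))" for t1 t2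
    have "P 0 1"
    proof (rule Bolzano)
      show "(0::real) \<le> 1" by simp
      fix t1 t2 t3 :: real assume P: "P t1 t2" "P t2 t3" and t: "t1 \<le> t2" "t2 \<le> t3"
      obtain d d' where d: "d > 0" "d' > 0"
        "\<And>s1 s2. s1 \<le> s \<and> s \<le> s2 \<and> s2 - s1 < d \<Longrightarrow> ex (({s1..s2} \<inter> ?I) \<times> ({t1..t2} \<inter> ?I))"
        "\<And>s1 s2. s1 \<le> s \<and> s \<le> s2 \<and> s2 - s1 < d' \<Longrightarrow> ex (({s1..s2} \<inter> ?I) \<times> ({t2..t3} \<inter> ?I))"
        using P unfolding P_def by (elim exE conjE) blast
      show "P t1 t3"
        unfolding P_def
      proof (intro exI[of _ "min d d'"] conjI allI impI)
        show "min d d' > 0" using d by simp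
        fix s1 s2 assume *: "s1 \<le> s \<and> s \<le> s2 \<and> s2 - s1 < min d d'"
        have "ex (({s1..s2} \<inter> ?I) \<times> ({t1..t2} \<inter> ?I) \<union> ({s1..s2} \<inter> ?I) \<times> ({t2..t3} \<inter> ?I))"
        proof (rule ex_Un)
          show "connected (({s1..s2} \<inter> ?I) \<times> ({t1..t2} \<inter> ?I) \<inter> ({s1..s2} \<inter> ?I) \<times> ({t2..t3} \<inter> ?I))"
            using interval_Int(2)[OF t] conn by (simp add: Times_Int_Times connected_Times)
          show "ex (({s1..s2} \<inter> ?I) \<times> ({t1..t2} \<inter> ?I))"
            using * by (intro d(3)) simp
          show "ex (({s1..s2} \<inter> ?I) \<times> ({t2..t3} \<inter> ?I))"
            using * by (intro d(4)) simp
          show "({s1..s2} \<inter> ?I) \<times> ({t1..t2} \<inter> ?I) \<union> ({s1..s2} \<inter> ?I) \<times> ({t2..t3} \<inter> ?I) \<subseteq> ?I \<times> ?I"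
            by (intro Un_least Sigma_mono Int_lower2)
        qed (intro closed_Times closed_Int closed_atLeastAtMost)+
        then show "ex (({s1..s2} \<inter> ?I) \<times> ({t1..t3} \<inter> ?I))"
          using interval_Int(1)[OF t] by (simp add: Sigma_Un_distrib2[symmetric])
      qed
    next
      fix t :: real assume "0 \<le> t" "t \<le> 1"
      then have "t \<in> ?I" by simp
      from local[OF s this] obtain d where d: "d > 0"
        "\<And>s1 s2 t1 t2. s1 \<le> s \<and> s \<le> s2 \<and> s2 - s1 < d \<and> t1 \<le> t \<and> t \<le> t2 \<and> t2 - t1 < d
        \<Longrightarrow> ex (({s1..s2} \<inter> ?I) \<times> ({t1..t2} \<inter> ?I))"
        by (elim exE conjE) blast
      show "\<exists>d>0. \<forall>a b. a \<le> t \<and> t \<le> b \<and> b - a < d \<longrightarrow> P a b"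
      proof (intro exI[of _ d] conjI allI impI)
        fix t1 t2 assume t12: "t1 \<le> t \<and> t \<le> t2 \<and> t2 - t1 < d"
        show "P t1 t2"
          unfolding P_def
        proof (intro exI[of _ d] conjI allI impI)
          fix s1 s2 assume "s1 \<le> s \<and> s \<le> s2 \<and> s2 - s1 < d"
          with t12 show "ex (({s1..s2} \<inter> ?I) \<times> ({t1..t2} \<inter> ?I))"
            by (intro d(2)) simp
        qed (rule d)
      qed (rule d)
    qed
    then show ?thesis unfolding P_def .
  qed
  define Q where "Q s1 s2 \<longleftrightarrow> ex (({s1..s2} \<inter> ?I) \<times> ({0..1} \<inter> ?I))" for s1 s2
  have "Q 0 1"
  proof (rule Bolzano)
    show "(0::real) \<le> 1" by simp
    fix t1 t2 t3 :: real assume P: "Q t1 t2" "Q t2 t3" and t: "t1 \<le> t2" "t2 \<le> t3"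
    have "ex (({t1..t2} \<inter> ?I) \<times> ({0..1} \<inter> ?I) \<union> ({t2..t3} \<inter> ?I) \<times> ({0..1} \<inter> ?I))"
    proof (rule ex_Un)
      show "connected (({t1..t2} \<inter> ?I) \<times> ({0..1} \<inter> ?I) \<inter> ({t2..t3} \<inter> ?I) \<times> ({0..1} \<inter> ?I))"
        using interval_Int(2)[OF t] conn by (simp add: Times_Int_Times connected_Times)
      show "({t1..t2} \<inter> ?I) \<times> ({0..1} \<inter> ?I) \<union> ({t2..t3} \<inter> ?I) \<times> ({0..1} \<inter> ?I) \<subseteq> ?I \<times> ?I"
        by (intro Un_least Sigma_mono Int_lower2)
    qed (fact P[unfolded Q_def] closed_Times[OF closed_Int[OF closed_atLeastAtMost closed_atLeastAtMost] closed_Int[OF closed_atLeastAtMost closed_atLeastAtMost]])+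
    then show "Q t1 t3"
      using interval_Int(1)[OF t] by (simp add: Q_def Sigma_Un_distrib1[symmetric])
  next
    show "\<exists>d>0. \<forall>a b. a \<le> s \<and> s \<le> b \<and> b - a < d \<longrightarrow> Q a b" if "0 \<le> s" "s \<le> 1" for s
      unfolding Q_def by (rule strip) (use that in simp)
  qed
  then show thesis
    using that unfolding Q_def ex_def Int_absorb by fast
qed

end

section \<open>Holonomy along paths\<close>

definition holonomy ::
    "('a, 'm) monoid_scheme \<Rightarrow> complex set \<Rightarrow> (complex \<Rightarrow> 'a) \<Rightarrow> (real \<Rightarrow> complex \<times> real) \<Rightarrow> 'a" where
  "holonomy \<Gamma> X g p = (THE c. \<exists>a b. flat_section \<Gamma> X g p {0..1} a b \<and> c = inv\<^bsub>\<Gamma>\<^esub> (a 0) \<otimes>\<^bsub>\<Gamma>\<^esub> a 1)"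

lemma flat_section_const_upper:
  assumes "flat_section \<Gamma> X g h W a b" "V \<subseteq> W" "connected V" "h ` V \<subseteq> upper_part X" "x \<in> V" "y \<in> V"
  shows "a x = a y"
proof (rule connected_local_const[OF assms(3,5,6)], intro ballI)
  fix z assume z: "z \<in> V"
  then have "h z \<in> upper_part X" using assms(4) by blast
  then show "\<forall>\<^sub>F w in at z within V. a z = a w"
    using flat_section_subset[OF assms(1,2)] z unfolding flat_section_def by blast
qed

lemma flat_section_const_lower:
  assumes "flat_section \<Gamma> X g h W a b" "V \<subseteq> W" "connected V" "h ` V \<subseteq> lower_part X" "x \<in> V" "y \<in> V"
  shows "b x = b y"
proof (rule connected_local_const[OF assms(3,5,6)], intro ballI)
  fix z assume z: "z \<in> V"
  then have "h z \<in> lower_part X" using assms(4) by blast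
  then show "\<forall>\<^sub>F w in at z within V. b z = b w"
    using flat_section_subset[OF assms(1,2)] z unfolding flat_section_def by blast
qed

context flat_bundle
begin

lemma flat_section_path_exists:
  assumes "path p" "path_image p \<subseteq> - (X \<times> {0})"
  obtains a b where "flat_section \<Gamma> X g p {0..1} a b"
proof -
  let ?h = "p \<circ> snd :: real \<times> real \<Rightarrow> complex \<times> real"
  have "continuous_on ({0..1} \<times> {0..1}) ?h"
    using assms(1) unfolding path_def
    by (intro continuous_on_compose continuous_on_snd continuous_on_id) (auto elim: continuous_on_subset)
  moreover have "?h ` ({0..1} \<times> {0..1}) \<subseteq> - (X \<times> {0})"
    using assms(2) unfolding path_image_def by fastforce
  ultimately obtain a b where ab: "flat_section \<Gamma> X g ?h ({0..1} \<times> {0..1}) a b"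
    by (rule flat_section_exists)
  have "flat_section \<Gamma> X g (?h \<circ> (\<lambda>t. (0, t))) {0..1} (a \<circ> (\<lambda>t. (0, t))) (b \<circ> (\<lambda>t. (0, t)))"
    by (rule flat_section_compose[OF ab]) (auto intro!: continuous_intros)
  then have "flat_section \<Gamma> X g p {0..1} (a \<circ> (\<lambda>t. (0, t))) (b \<circ> (\<lambda>t. (0, t)))"
    by (simp add: o_def)
  then show thesis by (rule that)
qed

text \<open>A change of section multiplies \<open>a\<close> on the left by a constant, which cancels
  in \<open>inv (a 0) \<otimes> a 1\<close>. The ends lie above the plane, where \<open>a\<close> is
  controlled, so the description in \<open>holonomy\<close> has a unique solution.\<close>

lemma holonomy_eq:
  assumes s: "flat_section \<Gamma> X g p {0..1} a b"
    and p: "path p" "path_image p \<subseteq> - (X \<times> {0})" "snd (p 0) > 0" "snd (p 1) > 0"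
  shows "holonomy \<Gamma> X g p = inv (a 0) \<otimes> a 1"
  unfolding holonomy_def
proof (rule the_equality)
  show "\<exists>a' b'. flat_section \<Gamma> X g p {0..1} a' b' \<and> inv (a 0) \<otimes> a 1 = inv (a' 0) \<otimes> a' 1"
    using s by blast
next
  fix c assume "\<exists>a' b'. flat_section \<Gamma> X g p {0..1} a' b' \<and> c = inv (a' 0) \<otimes> a' 1"
  then obtain a' b' where s': "flat_section \<Gamma> X g p {0..1} a' b'" and c: "c = inv (a' 0) \<otimes> a' 1"
    by blast
  have "continuous_on {0..1} p" "p ` {0..1} \<subseteq> - (X \<times> {0})"
    using p by (auto simp: path_def path_image_def)
  then obtain d where d: "d \<in> carrier \<Gamma>"
    "\<And>x. x \<in> {0..1} \<Longrightarrow> p x \<in> upper_part X \<Longrightarrow> a' x = d \<otimes> a x"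
    by (rule flat_section_unique[OF s s' connected_Icc]) (rule that; blast)
  have up: "p 0 \<in> upper_part X" "p 1 \<in> upper_part X"
    using p by (auto simp: upper_part_def)
  then have "a 0 \<in> carrier \<Gamma>" "a 1 \<in> carrier \<Gamma>"
    using s unfolding flat_section_def by auto
  moreover have "a' 0 = d \<otimes> a 0" "a' 1 = d \<otimes> a 1"
    using d(2) up by auto
  ultimately show "c = inv (a 0) \<otimes> a 1"
    using d(1) c by (simp add: inv_mult_group m_assoc) (simp flip: m_assoc)
qed

lemma holonomy_closed:
  assumes p: "path p" "path_image p \<subseteq> - (X \<times> {0})" "snd (p 0) > 0" "snd (p 1) > 0"
  shows "holonomy \<Gamma> X g p \<in> carrier \<Gamma>"
proof -
  obtain a b where s: "flat_section \<Gamma> X g p {0..1} a b"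
    using flat_section_path_exists p by blast
  have "p 0 \<in> upper_part X" "p 1 \<in> upper_part X"
    using p by (auto simp: upper_part_def)
  then show ?thesis
    using holonomy_eq[OF s p] s unfolding flat_section_def by auto
qed

lemma holonomy_join:
  assumes p: "path p" "path_image p \<subseteq> - (X \<times> {0})" "snd (p 0) > 0" "snd (p 1) > 0"
    and q: "path q" "path_image q \<subseteq> - (X \<times> {0})" "snd (q 0) > 0" "snd (q 1) > 0"
    and pq: "pathfinish p = pathstart q"
  shows "holonomy \<Gamma> X g (p +++ q) = holonomy \<Gamma> X g p \<otimes> holonomy \<Gamma> X g q"
proof -
  have r: "path (p +++ q)" "path_image (p +++ q) \<subseteq> - (X \<times> {0})"
    using p q pq by (auto simp: path_image_join)
  have v: "(p +++ q) 0 = p 0" "(p +++ q) 1 = q 1" "(p +++ q) (1/2) = q 0" "(p +++ q) (1/2) = p 1"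
    using pq by (auto simp: joinpaths_def pathfinish_def pathstart_def)
  obtain a b where s: "flat_section \<Gamma> X g (p +++ q) {0..1} a b"
    using flat_section_path_exists[OF r] .
  let ?f1 = "\<lambda>t::real. t/2" and ?f2 = "\<lambda>t::real. (t+1)/2"
  have "flat_section \<Gamma> X g ((p +++ q) \<circ> ?f1) {0..1} (a \<circ> ?f1) (b \<circ> ?f1)"
    by (rule flat_section_compose[OF s]) (auto intro!: continuous_intros)
  then have "flat_section \<Gamma> X g p {0..1} (a \<circ> ?f1) (b \<circ> ?f1)"
    by (rule flat_section_cong) (auto simp: joinpaths_def)
  from holonomy_eq[OF this p] have hp: "holonomy \<Gamma> X g p = inv (a 0) \<otimes> a (1/2)"
    by simp
  have "flat_section \<Gamma> X g ((p +++ q) \<circ> ?f2) {0..1} (a \<circ> ?f2) (b \<circ> ?f2)"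
    by (rule flat_section_compose[OF s]) (auto intro!: continuous_intros)
  then have "flat_section \<Gamma> X g q {0..1} (a \<circ> ?f2) (b \<circ> ?f2)"
    by (rule flat_section_cong) (use pq in \<open>auto simp: joinpaths_def pathfinish_def pathstart_def add_divide_distrib\<close>)
  from holonomy_eq[OF this q] have hq: "holonomy \<Gamma> X g q = inv (a (1/2)) \<otimes> a 1"
    by simp
  have "holonomy \<Gamma> X g (p +++ q) = inv (a 0) \<otimes> a 1"
    using holonomy_eq[OF s r] v p q by simp
  moreover have "(p +++ q) 0 \<in> upper_part X" "(p +++ q) 1 \<in> upper_part X" "(p +++ q) (1/2) \<in> upper_part X"
    using v p q by (simp_all add: upper_part_def)
  then have "a 0 \<in> carrier \<Gamma>" "a 1 \<in> carrier \<Gamma>" "a (1/2) \<in> carrier \<Gamma>"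
    using s unfolding flat_section_def by auto
  ultimately show ?thesis
    by (simp add: hp hq m_assoc) (simp flip: m_assoc)
qed

text \<open>One section over the homotopy square restricts to both paths. The two sides of the
  square on which the end points rest are mapped to single points of the upper part, so
  \<open>a\<close> does not change along them.\<close>

lemma holonomy_homotopic:
  assumes "homotopic_paths (- (X \<times> {0})) p q" and ends: "snd (p 0) > 0" "snd (p 1) > 0"
  shows "holonomy \<Gamma> X g p = holonomy \<Gamma> X g q"
proof -
  have pq: "path p" "path q" "path_image p \<subseteq> - (X \<times> {0})" "path_image q \<subseteq> - (X \<times> {0})"
    "q 0 = p 0" "q 1 = p 1"
    using homotopic_paths_imp_path[OF assms(1)] homotopic_paths_imp_subset[OF assms(1)]
      homotopic_paths_imp_pathstart[OF assms(1)] homotopic_paths_imp_pathfinish[OF assms(1)]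
    by (auto simp: pathstart_def pathfinish_def)
  obtain h :: "real \<times> real \<Rightarrow> complex \<times> real" where h: "continuous_on ({0..1} \<times> {0..1}) h" "h \<in> ({0..1} \<times> {0..1}) \<rightarrow> - (X \<times> {0})"
     "\<forall>t\<in>{0..1}. h (0, t) = p t" "\<forall>t\<in>{0..1}. h (1, t) = q t"
     "\<forall>s\<in>{0..1}. h (s, 0) = p 0 \<and> h (s, 1) = p 1"
    using assms(1) unfolding homotopic_paths pathstart_def pathfinish_def o_def by blast
  from h(2) have "h ` ({0..1} \<times> {0..1}) \<subseteq> - (X \<times> {0})"
    by (rule funcset_image)
  with h(1) obtain a b where s: "flat_section \<Gamma> X g h ({0..1} \<times> {0..1}) a b"
    by (rule flat_section_exists)
  have restrict: "flat_section \<Gamma> X g r {0..1} (\<lambda>t. a (s, t)) (\<lambda>t. b (s, t))"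
    if "s \<in> {0..1}" "\<And>t. t \<in> {0..1} \<Longrightarrow> h (s, t) = r t" for s r
  proof -
    have "flat_section \<Gamma> X g (h \<circ> (\<lambda>t. (s, t))) {0..1} (a \<circ> (\<lambda>t. (s, t))) (b \<circ> (\<lambda>t. (s, t)))"
      by (rule flat_section_compose[OF s]) (use that in \<open>auto intro!: continuous_intros\<close>)
    then show ?thesis
      by (rule flat_section_cong) (use that in auto)
  qed
  have "holonomy \<Gamma> X g p = inv (a (0, 0)) \<otimes> a (0, 1)"
    using holonomy_eq[OF restrict[of 0 p]] h(3) pq ends by simp
  moreover have "holonomy \<Gamma> X g q = inv (a (1, 0)) \<otimes> a (1, 1)"
    using holonomy_eq[OF restrict[of 1 q]] h(4) pq ends by simp
  moreover have "a (0, t) = a (1, t)" if "t = 0 \<or> t = 1" for t :: real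
  proof (rule flat_section_const_upper[OF s, of "{0..1} \<times> {t}"])
    show "connected ({0..1::real} \<times> {t})"
      by (simp add: connected_Times)
    show "h ` ({0..1} \<times> {t}) \<subseteq> upper_part X"
      using that h(5) ends by (auto simp: upper_part_def)
  qed (use that in auto)
  ultimately show ?thesis by simp
qed

text \<open>\<open>a\<close> is constant up to \<open>s\<close> and from \<open>t\<close> on,
  \<open>b\<close> is constant in between, and the two crossings give
  \<open>a s \<otimes> g (fst (p s)) = a t \<otimes> g (fst (p t))\<close>.\<close>

lemma holonomy_crossing:
  assumes p: "path p" "path_image p \<subseteq> - (X \<times> {0})"
    and st: "0 < s" "s < t" "t < 1"
    and up: "\<And>u. u \<in> {0..<s} \<union> {t<..1} \<Longrightarrow> snd (p u) > 0"
    and low: "\<And>u. u \<in> {s<..<t} \<Longrightarrow> snd (p u) < 0"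
    and cross: "fst (p s) \<notin> X" "fst (p t) \<notin> X"
  shows "holonomy \<Gamma> X g p = g (fst (p s)) \<otimes> inv (g (fst (p t)))"
proof -
  obtain a b where sec: "flat_section \<Gamma> X g p {0..1} a b"
    using flat_section_path_exists[OF p] .
  have ps: "p s \<in> upper_part X \<inter> lower_part X" and pt: "p t \<in> upper_part X \<inter> lower_part X"
    using cross by (auto simp: upper_Int_lower)
  have U: "p ` {0..s} \<subseteq> upper_part X" "p ` {t..1} \<subseteq> upper_part X"
    using ps pt up by (auto simp: upper_part_def less_eq_real_def)
  have L: "p ` {s..t} \<subseteq> lower_part X"
  proof (rule image_subsetI)
    fix u assume "u \<in> {s..t}"
    then consider "u = s" | "u = t" | "u \<in> {s<..<t}" by fastforce
    then show "p u \<in> lower_part X"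
      using ps pt low by cases (auto simp: lower_part_def)
  qed
  have 1: "a 0 = a s"
    by (rule flat_section_const_upper[OF sec _ _ U(1)]) (use st in auto)
  have 2: "a t = a 1"
    by (rule flat_section_const_upper[OF sec _ _ U(2)]) (use st in auto)
  have 3: "b s = b t"
    by (rule flat_section_const_lower[OF sec _ _ L]) (use st in auto)
  have 4: "b s = a s \<otimes> g (fst (p s))" "b t = a t \<otimes> g (fst (p t))"
    using sec st cross unfolding flat_section_def by auto
  have c: "a s \<in> carrier \<Gamma>" "a t \<in> carrier \<Gamma>"
    using sec st ps pt unfolding flat_section_def by auto
  have gc: "g (fst (p s)) \<in> carrier \<Gamma>" "g (fst (p t)) \<in> carrier \<Gamma>"
    using cross g_carrier by auto
  have "a t = a s \<otimes> g (fst (p s)) \<otimes> inv (g (fst (p t)))"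
    using 3 4 c gc inv_solve_right by (metis m_closed)
  moreover have "holonomy \<Gamma> X g p = inv (a s) \<otimes> a t"
    using holonomy_eq[OF sec p] up st 1 2 by simp
  ultimately show ?thesis
    using c gc by (simp add: m_assoc) (simp flip: m_assoc)
qed

end

section \<open>Homomorphisms as holonomies\<close>

lemma homotopic_paths_cancel_left:
  fixes p :: "real \<Rightarrow> 'a::real_normed_vector"
  assumes "path p" "path_image p \<subseteq> S" "path q" "path_image q \<subseteq> S" "pathstart q = pathstart p"
  shows "homotopic_paths S (p +++ (reversepath p +++ q)) q"
proof -
  have "homotopic_paths S (p +++ (reversepath p +++ q)) ((p +++ reversepath p) +++ q)"
    using assms by (intro homotopic_paths_assoc) auto
  also have "homotopic_paths S \<dots> (linepath (pathstart p) (pathstart p) +++ q)"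
    using assms by (intro homotopic_paths_join homotopic_paths_rinv) auto
  also have "homotopic_paths S \<dots> q"
    using assms homotopic_paths_lid[of q S] by simp
  finally show ?thesis .
qed

lemma homotopic_paths_cancel_middle:
  fixes p :: "real \<Rightarrow> 'a::real_normed_vector"
  assumes u: "path u" "path_image u \<subseteq> S" and p: "path p" "path_image p \<subseteq> S" and q: "path q" "path_image q \<subseteq> S"
    and "pathfinish u = pathfinish p" "pathstart q = pathfinish p"
  shows "homotopic_paths S ((u +++ reversepath p) +++ (p +++ q)) (u +++ q)"
proof -
  have "homotopic_paths S ((u +++ reversepath p) +++ (p +++ q)) (u +++ (reversepath p +++ (p +++ q)))"
    using assms by (intro homotopic_paths_sym[OF homotopic_paths_assoc]) (auto simp: path_image_join)
  also have "homotopic_paths S \<dots> (u +++ q)"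
    using homotopic_paths_cancel_left[of "reversepath p" S q] assms
    by (intro homotopic_paths_join) auto
  finally show ?thesis .
qed

lemma homotopic_paths_cancel_common_end:
  fixes p :: "real \<Rightarrow> 'a::real_normed_vector"
  assumes p: "path p" "path_image p \<subseteq> S" and q: "path q" "path_image q \<subseteq> S" and r: "path r" "path_image r \<subseteq> S"
    and "pathfinish p = pathstart r" "pathfinish q = pathstart r"
  shows "homotopic_paths S ((p +++ r) +++ reversepath (q +++ r)) (p +++ reversepath q)"
proof -
  have "homotopic_paths S ((p +++ r) +++ (reversepath r +++ reversepath q)) (p +++ reversepath q)"
    using homotopic_paths_cancel_middle[of p S "reversepath r" "reversepath q"] assms by simp
  then show ?thesis
    using assms by (simp add: reversepath_joinpaths)
qed

text \<open>A coherent choice of paths from the base point: a path inside \<open>U\<close> carries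
  the tether of its start to the tether of its end. In terms of coverings this is a lift of
  \<open>U\<close> to the universal covering.\<close>

definition tethers :: "'a::real_normed_vector set \<Rightarrow> 'a \<Rightarrow> 'a set \<Rightarrow> ('a \<Rightarrow> real \<Rightarrow> 'a) \<Rightarrow> bool" where
  "tethers S b U \<alpha> \<longleftrightarrow>
     U \<subseteq> S \<and>
     (\<forall>x\<in>U. path (\<alpha> x) \<and> path_image (\<alpha> x) \<subseteq> S \<and> pathstart (\<alpha> x) = b \<and> pathfinish (\<alpha> x) = x) \<and>
     (\<forall>r. path r \<longrightarrow> path_image r \<subseteq> U \<longrightarrow> homotopic_paths S (\<alpha> (pathstart r) +++ r) (\<alpha> (pathfinish r)))"

lemma tethersD:
  assumes "tethers S b U \<alpha>" "x \<in> U"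
  shows "path (\<alpha> x)" "path_image (\<alpha> x) \<subseteq> S" "pathstart (\<alpha> x) = b" "pathfinish (\<alpha> x) = x"
  using assms by (auto simp: tethers_def)

lemma tethers_homotopic:
  assumes "tethers S b U \<alpha>" "path r" "path_image r \<subseteq> U"
  shows "homotopic_paths S (\<alpha> (pathstart r) +++ r) (\<alpha> (pathfinish r))"
  using assms by (auto simp: tethers_def)

text \<open>Each point is reached by the fixed path \<open>d\<close> into \<open>U\<close>, followed
  by any path inside \<open>U\<close>; simple connectedness makes the latter choice irrelevant. The
  second conclusion normalises the tether at the end of \<open>d\<close>.\<close>

lemma tethers_exist:
  assumes U: "simply_connected U" "U \<subseteq> S" and d: "path d" "path_image d \<subseteq> S" "pathstart d = b" "pathfinish d \<in> U"
  obtains \<alpha> where "tethers S b U \<alpha>" "homotopic_paths S (\<alpha> (pathfinish d)) d"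
proof -
  have pc: "path_connected U"
    using U(1) by (simp add: simply_connected_imp_path_connected)
  have "\<exists>q. path q \<and> path_image q \<subseteq> U \<and> pathstart q = pathfinish d \<and> pathfinish q = x" if "x \<in> U" for x
    using pc d(4) that unfolding path_connected_def by blast
  then obtain q where q: "\<And>x. x \<in> U \<Longrightarrow> path (q x) \<and> path_image (q x) \<subseteq> U \<and> pathstart (q x) = pathfinish d
      \<and> pathfinish (q x) = x"
    by metis
  have "tethers S b U (\<lambda>x. d +++ q x)"
    unfolding tethers_def
  proof (intro conjI ballI allI impI)
    show "U \<subseteq> S" by (rule U(2))
    fix r assume r: "path r" "path_image r \<subseteq> U"
    let ?x = "pathstart r" and ?y = "pathfinish r"
    have xy: "?x \<in> U" "?y \<in> U"
      using r by auto
    have "homotopic_paths S ((d +++ q ?x) +++ r) (d +++ (q ?x +++ r))"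
      using r d U(2) q[OF xy(1)] by (intro homotopic_paths_sym[OF homotopic_paths_assoc]) auto
    also have "homotopic_paths S \<dots> (d +++ q ?y)"
    proof (intro homotopic_paths_join)
      have "homotopic_paths U (q ?x +++ r) (q ?y)"
        using U(1) r q[OF xy(1)] q[OF xy(2)] unfolding simply_connected_eq_homotopic_paths
        by (simp add: path_image_join)
      then show "homotopic_paths S (q ?x +++ r) (q ?y)"
        using U(2) by (rule homotopic_paths_subset)
    qed (use d q[OF xy(1)] in auto)
    finally show "homotopic_paths S ((d +++ q ?x) +++ r) (d +++ q ?y)" .
  qed (use d U q in \<open>auto simp: path_image_join\<close>)
  moreover have "homotopic_paths S (d +++ q (pathfinish d)) d"
  proof -
    have "homotopic_paths U (q (pathfinish d)) (linepath (pathfinish d) (pathfinish d))"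
      using U(1) q[OF d(4)] d(4) unfolding simply_connected_eq_homotopic_paths by simp
    then have "homotopic_paths S (d +++ q (pathfinish d)) (d +++ linepath (pathfinish d) (pathfinish d))"
      using d q[OF d(4)] homotopic_paths_subset[OF _ U(2)] by (intro homotopic_paths_join) auto
    also have "homotopic_paths S \<dots> d"
      using d by (intro homotopic_paths_rid)
    finally show ?thesis .
  qed
  ultimately show thesis by (rule that)
qed

text \<open>Extending a path by \<open>r\<close> inside \<open>U\<close> does not change the class
  of the loop obtained by returning along the tether of the end point.\<close>

lemma homotopic_tethers_move:
  assumes t: "tethers S b U \<alpha>" and r: "path r" "path_image r \<subseteq> U"
    and u: "homotopic_paths S (u +++ r) u'" "pathfinish u = pathstart r"
  shows "homotopic_paths S (u' +++ reversepath (\<alpha> (pathfinish r))) (u +++ reversepath (\<alpha> (pathstart r)))"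
proof -
  have xy: "pathstart r \<in> U" "pathfinish r \<in> U"
    using r by auto
  note x = tethersD[OF t xy(1)] and y = tethersD[OF t xy(2)]
  have "path (u +++ r)" "path_image (u +++ r) \<subseteq> S"
    using homotopic_paths_imp_path[OF u(1)] homotopic_paths_imp_subset[OF u(1)] by auto
  then have pu: "path u" "path_image u \<subseteq> S" "path_image r \<subseteq> S"
    using u(2) by (auto simp: path_image_join)
  have "homotopic_paths S (u' +++ reversepath (\<alpha> (pathfinish r)))
          ((u +++ r) +++ reversepath (\<alpha> (pathstart r) +++ r))"
  proof (intro homotopic_paths_join)
    show "homotopic_paths S u' (u +++ r)"
      using u by (simp add: homotopic_paths_sym)
    show "homotopic_paths S (reversepath (\<alpha> (pathfinish r))) (reversepath (\<alpha> (pathstart r) +++ r))"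
      using tethers_homotopic[OF t r] by (simp add: homotopic_paths_reversepath homotopic_paths_sym)
    show "pathfinish u' = pathstart (reversepath (\<alpha> (pathfinish r)))"
      using homotopic_paths_imp_pathfinish[OF u(1)] y by simp
  qed
  also have "homotopic_paths S \<dots> (u +++ reversepath (\<alpha> (pathstart r)))"
    using pu u(2) r x by (intro homotopic_paths_cancel_common_end) auto
  finally show ?thesis .
qed

lemma subpath_tether_locally_constant:
  fixes f :: "(real \<Rightarrow> 'a::real_normed_vector) \<Rightarrow> 'c"
  assumes t: "tethers S b U \<alpha>" and U: "open U"
    and p: "path p" "path_image p \<subseteq> S" and s: "s \<in> {0..1}" "p s \<in> U"
    and f: "\<And>q q'. homotopic_paths S q q' \<Longrightarrow> f q = f q'"
  shows "\<forall>\<^sub>F s' in at s within {0..1}.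
           f (subpath 0 s p +++ reversepath (\<alpha> (p s))) = f (subpath 0 s' p +++ reversepath (\<alpha> (p s')))"
proof -
  have "continuous_on {0..1} p"
    using p by (simp add: path_def)
  then have "\<forall>\<^sub>F s' in at s within {0..1}. p s' \<in> U"
    using s U by (metis continuous_on_def topological_tendstoD)
  then obtain d where d: "d > 0" "\<And>s'. s' \<in> {0..1} \<Longrightarrow> dist s' s < d \<Longrightarrow> p s' \<in> U"
    unfolding eventually_at using s by (metis dist_eq_0_iff)
  have "f (subpath 0 s p +++ reversepath (\<alpha> (p s))) = f (subpath 0 s' p +++ reversepath (\<alpha> (p s')))"
    if s': "s' \<in> {0..1}" "dist s' s < d" for s'
  proof -
    let ?r = "subpath s s' p"
    have "path_image ?r \<subseteq> U"
    proof
      fix x assume "x \<in> path_image ?r"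
      then obtain w where w: "w \<in> closed_segment s s'" "x = p w"
        by (auto simp: path_image_subpath_gen)
      then have "w \<in> {0..1}"
        using s s' closed_segment_subset[of s "{0..1}" s'] by auto
      moreover have "dist w s < d"
        using w(1) s'(2) dist_in_closed_segment[OF w(1)] by (simp add: dist_commute)
      ultimately show "x \<in> U"
        using d(2) w(2) by auto
    qed
    moreover have "homotopic_paths S (subpath 0 s p +++ ?r) (subpath 0 s' p)"
      using p s s' by (intro homotopic_join_subpaths) auto
    ultimately show ?thesis
      using homotopic_tethers_move[OF t, of ?r "subpath 0 s p"] p s s' f[OF homotopic_paths_sym] by simp
  qed
  then show ?thesis
    unfolding eventually_at using d(1) by blast
qed

lemma loop_class_hom:
  assumes "\<rho> \<in> hom (fundamental_group S b) \<Gamma>" "p \<in> loops_at S b" "q \<in> loops_at S b"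
  shows "\<rho> (loop_class S (p +++ q)) = \<rho> (loop_class S p) \<otimes>\<^bsub>\<Gamma>\<^esub> \<rho> (loop_class S q)"
proof -
  have "loop_class S p \<in> carrier (fundamental_group S b)" "loop_class S q \<in> carrier (fundamental_group S b)"
    using assms by (auto simp: fundamental_group_def)
  from hom_mult[OF assms(1) this] show ?thesis
    by (simp add: fundamental_group_mult assms)
qed

text \<open>The value of \<open>g\<close> at \<open>z\<close> is the image of the loop that goes to
  \<open>z\<close> through the upper part and returns through the lower one. For a loop
  \<open>p\<close>, cutting it off at \<open>s\<close> and returning along the tethers of the upper
  or the lower part gives the two components of a flat section, whose holonomy is the image of
  \<open>p\<close>.\<close>

theorem hom_eq_holonomy:
  fixes \<Gamma> (structure)
  assumes \<Gamma>: "group \<Gamma>" and X: "closed X" "X \<noteq> UNIV" and b: "snd b > 0"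
    and \<rho>: "\<rho> \<in> hom (fundamental_group (- (X \<times> {0})) b) \<Gamma>"
  obtains g where "flat_bundle \<Gamma> X g"
    "\<And>p. p \<in> loops_at (- (X \<times> {0})) b \<Longrightarrow> \<rho> (loop_class (- (X \<times> {0})) p) = holonomy \<Gamma> X g p"
proof -
  interpret group \<Gamma> by (rule \<Gamma>)
  let ?S = "- (X \<times> {0})" and ?U = "upper_part X" and ?L = "lower_part X"
  define R where "R p = \<rho> (loop_class ?S p)" for p
  have bU: "b \<in> ?U"
    using b by (simp add: upper_part_def)
  then have bS: "b \<in> ?S"
    using upper_Un_lower by blast
  have US: "?U \<subseteq> ?S" and LS: "?L \<subseteq> ?S"
    using upper_Un_lower by blast+
  have grp: "group (fundamental_group ?S b)"
    by (rule group_fundamental_group[OF bS])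
  have R_closed: "R p \<in> carrier \<Gamma>" if "p \<in> loops_at ?S b" for p
    using hom_in_carrier[OF \<rho>] that by (auto simp: R_def fundamental_group_def)
  have R_join: "R (p +++ q) = R p \<otimes> R q" if "p \<in> loops_at ?S b" "q \<in> loops_at ?S b" for p q
    unfolding R_def by (rule loop_class_hom[OF \<rho> that])
  have R_homotopic: "R p = R q" if "homotopic_paths ?S p q" for p q
    unfolding R_def using loop_class_eqI[OF that] by simp
  have R_const: "R (linepath b b) = \<one>"
    using hom_one[OF \<rho> grp \<Gamma>] by (simp add: R_def fundamental_group_def linepath_refl)
  have scU: "simply_connected ?U" and scL: "simply_connected ?L"
    by (simp_all add: contractible_imp_simply_connected contractible_upper_part contractible_lower_part)
  obtain \<alpha> where \<alpha>: "tethers ?S b ?U \<alpha>" "homotopic_paths ?S (\<alpha> b) (linepath b b)"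
    using tethers_exist[OF scU US, of "linepath b b" b] bU bS by auto
  note \<alpha>_trivial = \<alpha>(2) and \<alpha> = \<alpha>(1)
  \<comment> \<open>The tethers of the lower part need one path into it to start from; the upper
    tether of a plane point off \<open>X\<close> is such a path.\<close>
  obtain z0 where z0: "z0 \<notin> X"
    using X(2) by blast
  then have z0U: "(z0, 0) \<in> ?U" and z0L: "(z0, 0) \<in> ?L"
    by (auto simp: upper_part_def lower_part_def)
  obtain \<beta> where \<beta>: "tethers ?S b ?L \<beta>"
    using tethers_exist[OF scL LS, of "\<alpha> (z0, 0)" b] tethersD[OF \<alpha> z0U] z0L by auto
  define G where "G x = R (\<alpha> x +++ reversepath (\<beta> x))" for x
  define g where "g z = G (z, 0)" for z
  have UL: "x \<in> ?U \<and> x \<in> ?L" if "fst x \<notin> X" for x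
    using that by (auto simp: upper_part_def lower_part_def)
  have loop\<alpha>: "q +++ reversepath (\<alpha> x) \<in> loops_at ?S b"
    if "x \<in> ?U" "path q" "path_image q \<subseteq> ?S" "pathstart q = b" "pathfinish q = x" for q x
    using tethersD[OF \<alpha> that(1)] that by (auto simp: loops_at_def path_image_join)
  have loop\<beta>: "q +++ reversepath (\<beta> x) \<in> loops_at ?S b"
    if "x \<in> ?L" "path q" "path_image q \<subseteq> ?S" "pathstart q = b" "pathfinish q = x" for q x
    using tethersD[OF \<beta> that(1)] that by (auto simp: loops_at_def path_image_join)
  \<comment> \<open>Over the cylinder both tethers move along the same segment. So \<open>G\<close>
    depends neither on the height nor on the position within a small disc off
    \<open>X\<close>.\<close>
  have G_move: "G x = G y" if "closed_segment x y \<subseteq> {x. fst x \<notin> X}" for x y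
  proof -
    have seg: "path_image (linepath x y) \<subseteq> ?U" "path_image (linepath x y) \<subseteq> ?L"
      using that UL by auto
    have "homotopic_paths ?S (\<alpha> y +++ reversepath (\<beta> y)) (\<alpha> x +++ reversepath (\<beta> x))"
      using homotopic_tethers_move[OF \<beta> _ seg(2), of "\<alpha> x" "\<alpha> y"] tethers_homotopic[OF \<alpha> _ seg(1)]
        tethersD[OF \<alpha>, of x] seg(1) by auto
    then show ?thesis
      unfolding G_def by (metis R_homotopic)
  qed
  have G_g: "G x = g (fst x)" if "fst x \<notin> X" for x
    unfolding g_def
  proof (rule G_move, rule subsetI)
    fix y assume "y \<in> closed_segment x (fst x, 0)"
    then have "fst y \<in> closed_segment (fst x) (fst x)"
      using closed_segment_PairD[of "fst y" "snd y" "fst x" "snd x" "fst x" 0] by simp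
    then show "y \<in> {x. fst x \<notin> X}"
      using that by simp
  qed
  interpret fb: flat_bundle \<Gamma> X g
  proof (unfold_locales)
    show "closed X" by (rule X)
    fix z assume z: "z \<notin> X"
    then have zUL: "(z, 0) \<in> ?U" "(z, 0) \<in> ?L"
      using UL by auto
    show "g z \<in> carrier \<Gamma>"
      unfolding g_def G_def
      by (intro R_closed loop\<beta>[OF zUL(2)]) (use tethersD[OF \<alpha> zUL(1)] in auto)
    obtain e where e: "e > 0" "ball z e \<subseteq> - X"
      using X(1) z by (meson ComplI open_Compl open_contains_ball)
    have "g z = g w" if "w \<in> ball z e" for w
      unfolding g_def
    proof (rule G_move, rule subsetI)
      fix y assume "y \<in> closed_segment (z, 0::real) (w, 0)"
      then have "fst y \<in> closed_segment z w"
        using closed_segment_PairD[of "fst y" "snd y" z 0 w 0] by simp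
      moreover have "closed_segment z w \<subseteq> ball z e"
        using that e by (intro closed_segment_subset) auto
      ultimately show "y \<in> {x. fst x \<notin> X}"
        using e by blast
    qed
    then show "\<forall>\<^sub>F w in at z. g z = g w"
      using e(1) unfolding eventually_at by (auto simp: dist_commute)
  qed
  have "R p = holonomy \<Gamma> X g p" if p: "p \<in> loops_at ?S b" for p
  proof -
    have pp: "path p" "path_image p \<subseteq> ?S" "p 0 = b" "p 1 = b"
      using p by (auto simp: loops_at_def pathstart_def pathfinish_def)
    define A where "A s = R (subpath 0 s p +++ reversepath (\<alpha> (p s)))" for s
    define B where "B s = R (subpath 0 s p +++ reversepath (\<beta> (p s)))" for s
    have sub: "path (subpath 0 s p)" "path_image (subpath 0 s p) \<subseteq> ?S" if "s \<in> {0..1}" for s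
      using that pp path_image_subpath_subset[of 0 s p] by auto
    have "flat_section \<Gamma> X g p {0..1} A B"
      unfolding flat_section_def
    proof (intro conjI ballI impI)
      fix s :: real assume s: "s \<in> {0..1}"
      show "A s \<in> carrier \<Gamma>" if "p s \<in> ?U"
        unfolding A_def by (intro R_closed loop\<alpha>[OF that]) (use sub[OF s] pp in auto)
      show "B s \<in> carrier \<Gamma>" if "p s \<in> ?L"
        unfolding B_def by (intro R_closed loop\<beta>[OF that]) (use sub[OF s] pp in auto)
      show "\<forall>\<^sub>F s' in at s within {0..1}. A s = A s'" if "p s \<in> ?U"
        unfolding A_def
        by (rule subpath_tether_locally_constant[OF \<alpha> open_upper_part[OF X(1)] pp(1,2) s that R_homotopic])
      show "\<forall>\<^sub>F s' in at s within {0..1}. B s = B s'" if "p s \<in> ?L"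
        unfolding B_def
        by (rule subpath_tether_locally_constant[OF \<beta> open_lower_part[OF X(1)] pp(1,2) s that R_homotopic])
      show "B s = A s \<otimes> g (fst (p s))" if nX: "fst (p s) \<notin> X"
      proof -
        have x: "p s \<in> ?U" "p s \<in> ?L" using UL nX by auto
        note ta = tethersD[OF \<alpha> x(1)] and tb = tethersD[OF \<beta> x(2)]
        have "A s \<otimes> g (fst (p s)) = R ((subpath 0 s p +++ reversepath (\<alpha> (p s))) +++ (\<alpha> (p s) +++ reversepath (\<beta> (p s))))"
          unfolding A_def G_g[OF nX, symmetric] G_def
          by (intro R_join[symmetric] loop\<alpha>[OF x(1)] loop\<beta>[OF x(2)]) (use ta sub[OF s] pp in auto)
        also have "\<dots> = B s"
          unfolding B_def
          by (intro R_homotopic homotopic_paths_cancel_middle) (use ta tb sub[OF s] in auto)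
        finally show ?thesis by simp
      qed
    qed
    from fb.holonomy_eq[OF this pp(1,2)] have hol: "holonomy \<Gamma> X g p = inv (A 0) \<otimes> A 1"
      using pp b by simp
    note tb = tethersD[OF \<alpha> bU]
    have lb: "\<alpha> b \<in> loops_at ?S b" "reversepath (\<alpha> b) \<in> loops_at ?S b" "linepath b b \<in> loops_at ?S b"
      using tb bS by (auto simp: loops_at_def)
    define r where "r = R (reversepath (\<alpha> b))"
    \<comment> \<open>At parameter 0 only the tether of \<open>b\<close> remains; it is
      null-homotopic by the choice of \<open>\<alpha>\<close>, so the holonomy is the value of
      \<open>A\<close> at parameter 1.\<close>
    have r: "r = \<one>"
      using R_homotopic[OF homotopic_paths_reversepath_D[OF \<alpha>_trivial]] R_const by (simp add: r_def)
    have A1: "A 1 = R p \<otimes> r"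
      using R_join[OF p lb(2)] by (simp add: A_def r_def pp)
    have "subpath 0 0 p = linepath b b"
      by (simp add: fun_eq_iff subpath_def pp linepath_refl)
    then have A0: "A 0 = r"
      using R_join[OF lb(3) lb(2)] R_const r by (simp add: A_def r_def pp)
    show ?thesis
      using hol A1 A0 r R_closed[OF p] by simp
  qed
  then show thesis
    using that[OF fb.flat_bundle_axioms] unfolding R_def by blast
qed

text \<open>The value that \<open>c\<close> takes off \<open>X\<close> near a point of
  \<open>W\<close> is assigned to that point, which extends the function across \<open>X\<close>.
  Overlapping neighbourhoods share a point off \<open>X\<close> because \<open>X\<close> has empty
  interior, so the extension is locally constant.\<close>

lemma locally_constant_across:
  fixes c :: "'a::topological_space \<Rightarrow> 'v"
  assumes W: "open W" "connected W" and X: "interior X = {}"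
    and loc: "\<And>x. x \<in> W \<Longrightarrow> \<exists>N. open N \<and> x \<in> N \<and> (\<forall>y\<in>N - X. \<forall>y'\<in>N - X. c y = c y')"
    and yz: "y \<in> W - X" "z \<in> W - X"
  shows "c y = c z"
proof -
  have "\<exists>N. open N \<and> x \<in> N \<and> N \<subseteq> W \<and> (\<forall>y\<in>N - X. \<forall>y'\<in>N - X. c y = c y')" if x: "x \<in> W" for x
  proof -
    obtain N where "open N" "x \<in> N" "\<forall>y\<in>N - X. \<forall>y'\<in>N - X. c y = c y'"
      using loc[OF x] by blast
    then show ?thesis
      using W(1) x by (intro exI[of _ "N \<inter> W"]) auto
  qed
  then obtain N where N: "\<And>x. x \<in> W \<Longrightarrow> open (N x) \<and> x \<in> N x \<and> N x \<subseteq> W"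
    and const: "\<And>x y y'. x \<in> W \<Longrightarrow> y \<in> N x - X \<Longrightarrow> y' \<in> N x - X \<Longrightarrow> c y = c y'"
    by metis
  have meets: "V - X \<noteq> {}" if "open V" "V \<noteq> {}" for V
    using X that interior_maximal[of V X] by blast
  define C where "C x = c (SOME y. y \<in> N x - X)" for x
  have C: "C x = c y" if "x \<in> W" "y \<in> N x - X" for x y
    unfolding C_def using const[OF that(1) that(2)] that by (metis someI_ex)
  have "C y = C z"
  proof (rule connected_local_const[OF W(2)])
    show "\<forall>a\<in>W. \<forall>\<^sub>F b in at a within W. C a = C b"
    proof
      fix a assume a: "a \<in> W"
      have "C a = C b" if b: "b \<in> W" "b \<in> N a" for b
      proof -
        have "open (N a \<inter> N b)" "N a \<inter> N b \<noteq> {}"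
          using N[OF a] N[OF b(1)] b by auto
        then obtain w where "w \<in> N a \<inter> N b - X"
          using meets by blast
        then show ?thesis
          using C[OF a, of w] C[OF b(1), of w] by simp
      qed
      then show "\<forall>\<^sub>F b in at a within W. C a = C b"
        unfolding eventually_at_topological using N[OF a] by blast
    qed
  qed (use yz in auto)
  then show ?thesis
    using C[of y y] C[of z z] N yz by auto
qed

section \<open>Separation of plane compacta by continuous logarithms\<close>

text \<open>Dividing \<open>z - q\<close> by an n-th root of \<open>exp (v z)\<close> leaves roots
  of unity, hence a constant on the connected circle. So on the circle \<open>z - q\<close> agrees
  with a function without zeros on the plane, and normalising that function would retract the disc
  onto its boundary.\<close>

lemma no_logarithm_on_circle:
  fixes q :: complex
  assumes "R > 0" "continuous_on UNIV v" "\<And>z. dist z q = R \<Longrightarrow> (z - q) ^ n = exp (v z)"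
  shows "n = 0"
proof (rule ccontr)
  assume n: "n \<noteq> 0"
  define k where "k z = exp (- v z / of_nat n) * (z - q)" for z
  have "k z ^ n = 1" if "z \<in> sphere q R" for z
  proof -
    have "k z ^ n = exp (- v z) * exp (v z)"
      using assms(3)[of z] that n by (simp add: k_def power_mult_distrib dist_commute flip: exp_of_nat_mult)
    then show ?thesis
      by (simp flip: exp_add)
  qed
  then have "k ` sphere q R \<subseteq> {w. w ^ n = 1}"
    by auto
  then have fin: "finite (k ` sphere q R)"
    by (rule finite_subset) (use n in \<open>intro finite_roots_unity, simp\<close>)
  have cont: "continuous_on S k" for S
    unfolding k_def using n by (intro continuous_intros continuous_on_subset[OF assms(2)]) auto
  have "connected (k ` sphere q R)"
    by (intro connected_continuous_image cont connected_sphere) auto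
  then obtain w where w: "k ` sphere q R \<subseteq> {w}"
    using connected_finite_iff_sing[of "k ` sphere q R"] fin by (metis empty_subsetI order_refl)
  define E where "E z = w * exp (v z / of_nat n)" for z
  have "q + of_real R \<in> sphere q R"
    using assms(1) by (simp add: dist_norm)
  then have "w = k (q + of_real R)"
    using w by blast
  then have w0: "w \<noteq> 0"
    using assms(1) by (simp add: k_def)
  have E: "E z = z - q" if "z \<in> sphere q R" for z
  proof -
    have "w = exp (- v z / of_nat n) * (z - q)"
    proof -
      have "k z = w" using w that by blast
      then show ?thesis by (simp add: k_def)
    qed
    then have "E z = (exp (- v z / of_nat n) * exp (v z / of_nat n)) * (z - q)"
      by (simp add: E_def mult_ac)
    then show ?thesis
      by (simp flip: exp_add)
  qed
  define r where "r z = q + of_real R * (E z / of_real (norm (E z)))" for z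
  have "retraction (cball q R) (frontier (cball q R)) r"
    unfolding retraction_def
  proof (intro conjI ballI)
    show "continuous_on (cball q R) r"
      unfolding r_def E_def using w0 n
      by (intro continuous_intros continuous_on_subset[OF assms(2)]) auto
    show "r \<in> cball q R \<rightarrow> frontier (cball q R)"
      using assms(1) w0 by (auto simp: r_def E_def dist_norm norm_mult norm_divide)
    show "r z = z" if "z \<in> frontier (cball q R)" for z
      using that E[of z] assms(1) by (auto simp: r_def dist_norm norm_minus_commute)
  qed auto
  then show False
    using no_retraction_cball[OF assms(1), of q] by (auto simp: retract_of_def)
qed

lemma closure_complement_component:
  fixes K :: "'a::euclidean_space set"
  assumes "closed K"
  shows "closure (connected_component_set (- K) q) \<subseteq> connected_component_set (- K) q \<union> K"
proof (cases "q \<in> K")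
  case True
  then have "connected_component_set (- K) q = {}"
    using connected_component_eq_empty[of "- K" q] by blast
  then show ?thesis by (simp only: closure_empty empty_subsetI)
next
  case False
  then have "connected_component_set (- K) q \<in> components (- K)"
    by (auto simp: components_def)
  then have "frontier (connected_component_set (- K) q) \<subseteq> K"
    using assms frontier_of_components_closed_complement by blast
  then show ?thesis
    using closure_Un_frontier by blast
qed

text \<open>Otherwise the extension \<open>exp u' / \<phi>\<close> into the component of \<open>q\<close> glues with \<open>(z - q)\<^sup>n\<close> outside it to a
  function without zeros on the whole plane, which has a logarithm.\<close>

lemma no_logarithm_nat:
  fixes q :: complex
  assumes K: "compact K" "q \<notin> K" and bd: "bounded (connected_component_set (- K) q)"
    and \<phi>: "continuous_on (closure (connected_component_set (- K) q)) \<phi>"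
      "\<And>z. z \<in> closure (connected_component_set (- K) q) \<Longrightarrow> \<phi> z \<noteq> 0"
    and u: "continuous_on K u" "\<And>z. z \<in> K \<Longrightarrow> (z - q) ^ n * \<phi> z = exp (u z)"
  shows "n = 0"
proof -
  let ?O = "connected_component_set (- K) q"
  have clK: "closed K" using K(1) by (rule compact_imp_closed)
  have opO: "open ?O" using clK by (simp add: open_connected_component open_Compl)
  have qO: "q \<in> ?O" using K(2) by simp
  obtain u' where u': "continuous_on UNIV u'" "\<And>z. z \<in> K \<Longrightarrow> u' z = u z"
    using Tietze_unbounded[OF u(1), of UNIV] clK by auto
  define h where "h z = (if z \<in> ?O then exp (u' z) / \<phi> z else (z - q) ^ n)" for z
  have "continuous_on (closure ?O \<union> - ?O) h"
    unfolding h_def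
  proof (rule continuous_on_cases)
    show "continuous_on (closure ?O) (\<lambda>z. exp (u' z) / \<phi> z)"
      by (intro continuous_on_divide continuous_on_exp continuous_on_subset[OF u'(1)] \<phi>(1) subset_UNIV ballI \<phi>(2))
    show "\<forall>z. z \<in> closure ?O \<and> z \<notin> ?O \<or> z \<in> - ?O \<and> z \<in> ?O \<longrightarrow> exp (u' z) / \<phi> z = (z - q) ^ n"
    proof (intro allI impI)
      fix z assume z: "z \<in> closure ?O \<and> z \<notin> ?O \<or> z \<in> - ?O \<and> z \<in> ?O"
      then have "z \<in> K" "z \<in> closure ?O"
        using closure_complement_component[OF clK, of q] by auto
      then show "exp (u' z) / \<phi> z = (z - q) ^ n"
        using u(2)[of z] u'(2)[of z] \<phi>(2)[of z] by (simp add: field_simps)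
    qed
  qed (use opO in \<open>auto intro!: continuous_intros\<close>)
  moreover have "closure ?O \<union> - ?O = UNIV"
    using closure_subset by blast
  ultimately have conth: "continuous_on UNIV h"
    by simp
  have "h z \<noteq> 0" for z
    using \<phi>(2)[of z] qO closure_subset[of ?O] by (auto simp: h_def)
  then obtain v where v: "continuous_on UNIV v" "\<And>z. h z = exp (v z)"
    using continuous_logarithm_on_contractible[OF conth contractible_UNIV] by (metis UNIV_I)
  obtain R where R: "R > 0" "?O \<subseteq> ball q R"
    using bounded_subset_ballD[OF bd] by blast
  show "n = 0"
  proof (rule no_logarithm_on_circle[OF R(1) v(1)])
    fix z assume "dist z q = R"
    then have "z \<notin> ?O"
      using R(2) by (auto simp: dist_commute)
    then show "(z - q) ^ n = exp (v z)"
      using v(2)[of z] by (simp add: h_def)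
  qed
qed

lemma no_logarithm_int:
  fixes q :: complex and n :: int
  assumes K: "compact K" "q \<notin> K" and bd: "bounded (connected_component_set (- K) q)"
    and \<phi>: "continuous_on (closure (connected_component_set (- K) q)) \<phi>"
      "\<And>z. z \<in> closure (connected_component_set (- K) q) \<Longrightarrow> \<phi> z \<noteq> 0"
    and u: "continuous_on K u" "\<And>z. z \<in> K \<Longrightarrow> (z - q) powi n * \<phi> z = exp (u z)"
  shows "n = 0"
proof (cases "n \<ge> 0")
  case True
  have "nat n = 0"
  proof (rule no_logarithm_nat[OF K bd \<phi> u(1)])
    show "(z - q) ^ nat n * \<phi> z = exp (u z)" if "z \<in> K" for z
      using u(2)[OF that] True by (simp add: power_int_def)
  qed
  with True show ?thesis by simp
next
  case False
  have "nat (- n) = 0"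
  proof (rule no_logarithm_nat[OF K bd, of "\<lambda>z. inverse (\<phi> z)" "\<lambda>z. - u z"])
    show "(z - q) ^ nat (- n) * inverse (\<phi> z) = exp (- u z)" if "z \<in> K" for z
    proof -
      have "z - q \<noteq> 0"
        using that K(2) by auto
      moreover have "exp (u z) = inverse ((z - q) ^ nat (- n)) * \<phi> z"
        using u(2)[OF that] False by (simp add: power_int_def power_inverse)
      ultimately show ?thesis
        by (simp add: exp_minus)
    qed
  qed (use \<phi> u in \<open>auto intro!: continuous_intros\<close>)
  with False show ?thesis by simp
qed

text \<open>Moving \<open>p\<close> to \<open>q\<close> along a path off \<open>K\<close> deforms
  \<open>(z - p) / (z - q)\<close> into the constant 1 through functions without zeros on
  \<open>K\<close>. With its converse \<open>connected_component_if_logarithm\<close> this is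
  Eilenberg's criterion for the separation of two points.\<close>

lemma logarithm_if_connected_component:
  fixes p q :: complex
  assumes "closed K" "connected_component (- K) p q"
  obtains l where "continuous_on K l" "\<And>z. z \<in> K \<Longrightarrow> z - p = exp (l z) * (z - q)"
proof -
  have "path_component (- K) p q"
    using assms by (simp add: open_Compl open_path_connected_component)
  then obtain r where r: "path r" "path_image r \<subseteq> - K" "pathstart r = p" "pathfinish r = q"
    by (auto simp: path_component_def)
  have qK: "q \<notin> K"
    using assms connected_component_in by blast
  define h where "h x = (snd x - r (fst x)) / (snd x - q)" for x
  have 1: "continuous_on ({0..1} \<times> K) h"
    unfolding h_def using r(1) qK
    by (intro continuous_intros continuous_on_compose2[where g=r and f=fst]) (auto simp: path_def)
  have 2: "h \<in> ({0..1} \<times> K) \<rightarrow> - {0}"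
    unfolding h_def using r(2) qK by (auto simp: path_image_def)
  have "homotopic_with_canon (\<lambda>h. True) K (- {0}) (\<lambda>z. (z - p) / (z - q)) (\<lambda>z. (z - q) / (z - q))"
    unfolding homotopic_with_def using 1 2 r(3,4)
    by (intro exI[of _ h]) (auto simp: h_def pathstart_def pathfinish_def)
  then have "homotopic_with_canon (\<lambda>h. True) K (- {0}) (\<lambda>z. (z - p) / (z - q)) (\<lambda>z. 1)"
    by (rule homotopic_with_eq) (use qK in auto)
  then obtain l where l: "continuous_on K l" "\<forall>z\<in>K. (z - p) / (z - q) = exp (l z)"
    using inessential_eq_continuous_logarithm[of K "\<lambda>z. (z - p) / (z - q)"] by blast
  have "z - p = exp (l z) * (z - q)" if "z \<in> K" for z
  proof -
    have "(z - p) / (z - q) = exp (l z)" "z - q \<noteq> 0"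
      using l(2) that qK by auto
    then show ?thesis by (simp add: divide_eq_eq)
  qed
  with l(1) show thesis by (rule that)
qed

lemma bounded_component_cases:
  fixes p q :: complex
  assumes "compact K" "p \<notin> K" "q \<notin> K" "\<not> connected_component (- K) p q"
  shows "bounded (connected_component_set (- K) p) \<or> bounded (connected_component_set (- K) q)"
proof (rule ccontr)
  assume *: "\<not> ?thesis"
  have "connected_component_set (- K) p = connected_component_set (- K) q"
    by (rule cobounded_unique_unbounded_components[of "- K"])
      (use * assms compact_imp_bounded in \<open>auto simp: components_def\<close>)
  then have "connected_component (- K) p q"
    using assms(3) by (metis ComplI connected_component_refl mem_Collect_eq)
  with assms(4) show False by blast
qed

lemma not_in_closure_other_component:
  fixes p q :: complex
  assumes "closed K" "q \<notin> K" "\<not> connected_component (- K) p q"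
  shows "q \<notin> closure (connected_component_set (- K) p)"
  using closure_complement_component[OF assms(1), of p] assms(2,3) by auto

text \<open>If the points were separated, one of their components would be bounded and the other
  point would lie off its closure. The factor of that other point has no zero there, so the exponent
  1 contradicts \<open>no_logarithm_nat\<close>.\<close>

lemma connected_component_if_logarithm:
  fixes p q :: complex
  assumes K: "compact K" "p \<notin> K" "q \<notin> K"
    and l: "continuous_on K l" "\<And>z. z \<in> K \<Longrightarrow> z - p = exp (l z) * (z - q)"
  shows "connected_component (- K) p q"
proof (rule ccontr)
  assume *: "\<not> connected_component (- K) p q"
  then have nc': "\<not> connected_component (- K) q p"
    by (metis connected_component_sym)
  have clK: "closed K" using K(1) by (rule compact_imp_closed)
  from bounded_component_cases[OF K *] show False
  proof
    assume b: "bounded (connected_component_set (- K) p)"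
    have "(1::nat) = 0"
    proof (rule no_logarithm_nat[OF K(1,2) b, of "\<lambda>z. inverse (z - q)" l])
      show "(z - p) ^ 1 * inverse (z - q) = exp (l z)" if "z \<in> K" for z
      proof -
        have "z - q \<noteq> 0" using that K(3) by auto
        then show ?thesis using l(2)[OF that] by simp
      qed
    qed (use l(1) not_in_closure_other_component[OF clK K(3) *] in \<open>auto intro!: continuous_intros\<close>)
    then show False by simp
  next
    assume b: "bounded (connected_component_set (- K) q)"
    have "(1::nat) = 0"
    proof (rule no_logarithm_nat[OF K(1,3) b, of "\<lambda>z. inverse (z - p)" "\<lambda>z. - l z"])
      show "(z - q) ^ 1 * inverse (z - p) = exp (- l z)" if "z \<in> K" for z
      proof -
        have "z - q \<noteq> 0" using that K(3) by auto
        then show ?thesis using l(2)[OF that] by (simp add: exp_minus)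
      qed
    qed (use l(1) not_in_closure_other_component[OF clK K(2) nc'] in \<open>auto intro!: continuous_intros\<close>)
    then show False by simp
  qed
qed

lemma continuous_on_glue:
  fixes f g :: "'a::topological_space \<Rightarrow> 'b::topological_space"
  assumes "closed S" "closed T" "continuous_on S f" "continuous_on T g"
    and "\<And>x. x \<in> S \<inter> T \<Longrightarrow> f x = g x"
  obtains h where "continuous_on (S \<union> T) h" "\<And>x. x \<in> S \<Longrightarrow> h x = f x" "\<And>x. x \<in> T \<Longrightarrow> h x = g x"
proof
  show "continuous_on (S \<union> T) (\<lambda>x. if x \<in> S then f x else g x)"
    using assms by (intro continuous_on_cases) auto
qed (use assms(5) in auto)

text \<open>For \<open>i = 2, 3\<close>, the logarithms of \<open>(z - q\<^sub>i) / (z - q\<^sub>1)\<close> on \<open>S\<close> and on \<open>T\<close> differ at \<open>x1\<close> and \<open>x2\<close> by multiples of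
  \<open>2 \<pi> \<i>\<close>. Two such integer jumps are linearly dependent, so some nontrivial product of powers of the two
  quotients has a logarithm on \<open>S \<union> T\<close>.\<close>

lemma two_sides_bounded:
  fixes q1 q2 q3 x1 x2 :: complex
  assumes T: "compact T" and S: "compact S" and ST: "S \<inter> T = {x1, x2}"
    and cT: "connected_component (- T) q2 q1" "connected_component (- T) q3 q1"
    and cS: "connected_component (- S) q2 q1" "connected_component (- S) q3 q1"
    and b2: "bounded (connected_component_set (- (S \<union> T)) q2)"
    and nc: "\<not> connected_component (- (S \<union> T)) q2 q1" "\<not> connected_component (- (S \<union> T)) q2 q3"
  shows "connected_component (- (S \<union> T)) q3 q1"
proof -
  have notin: "q1 \<notin> S" "q1 \<notin> T" "q2 \<notin> S" "q2 \<notin> T" "q3 \<notin> S" "q3 \<notin> T"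
    using cT cS connected_component_in by blast+
  have cl: "closed S" "closed T" using S T compact_imp_closed by auto
  have K: "compact (S \<union> T)" using S T by auto
  obtain L2 where L2: "continuous_on T L2" "\<And>z. z \<in> T \<Longrightarrow> z - q2 = exp (L2 z) * (z - q1)"
    using logarithm_if_connected_component[OF cl(2) cT(1)] by blast
  obtain L3 where L3: "continuous_on T L3" "\<And>z. z \<in> T \<Longrightarrow> z - q3 = exp (L3 z) * (z - q1)"
    using logarithm_if_connected_component[OF cl(2) cT(2)] by blast
  obtain M2 where M2: "continuous_on S M2" "\<And>z. z \<in> S \<Longrightarrow> z - q2 = exp (M2 z) * (z - q1)"
    using logarithm_if_connected_component[OF cl(1) cS(1)] by blast
  obtain M3 where M3: "continuous_on S M3" "\<And>z. z \<in> S \<Longrightarrow> z - q3 = exp (M3 z) * (z - q1)"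
    using logarithm_if_connected_component[OF cl(1) cS(2)] by blast
  define c where "c = 2 * of_real pi * \<i>"
  have c0: "exp (of_int k * c) = 1" for k :: int
  proof -
    have "of_int k * c = \<i> * (of_int k * (of_real pi * 2))" by (simp add: c_def)
    then show ?thesis using exp_integer_2pi[of "of_int k"] by (simp add: c_def mult_ac)
  qed
  have jump: "\<exists>k::int. M x = L x + of_int k * c"
    if "x \<in> S" "x \<in> T" "\<And>z. z \<in> T \<Longrightarrow> z - q = exp (L z) * (z - q1)" "\<And>z. z \<in> S \<Longrightarrow> z - q = exp (M z) * (z - q1)"
    for x q L M
  proof -
    have "exp (M x) = exp (L x)"
      using that(3)[of x] that(4)[of x] that(1,2) notin(1) by auto
    then show ?thesis
      unfolding exp_eq c_def by (auto simp: mult_ac)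
  qed
  have x: "x1 \<in> S" "x1 \<in> T" "x2 \<in> S" "x2 \<in> T" using ST by auto
  obtain d2 e2 d3 e3 :: int where de:
    "M2 x1 = L2 x1 + of_int d2 * c" "M2 x2 = L2 x2 + of_int e2 * c"
    "M3 x1 = L3 x1 + of_int d3 * c" "M3 x2 = L3 x2 + of_int e3 * c"
    using jump[OF x(1,2) L2(2) M2(2)] jump[OF x(3,4) L2(2) M2(2)]
      jump[OF x(1,2) L3(2) M3(2)] jump[OF x(3,4) L3(2) M3(2)] by metis
  \<comment> \<open>Subtracting \<open>d2\<close> and \<open>d3\<close> makes the logarithms on
    \<open>S\<close> and \<open>T\<close> agree at \<open>x1\<close>. The jumps left at
    \<open>x2\<close> are \<open>e2 - d2\<close> and \<open>e3 - d3\<close>, and these coefficients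
    make their combination vanish.\<close>
  define m n where "m = e3 - d3" and "n = - (e2 - d2)"
  obtain G where G: "continuous_on (S \<union> T) G"
    "\<And>z. z \<in> S \<Longrightarrow> G z = of_int m * (M2 z - of_int d2 * c) + of_int n * (M3 z - of_int d3 * c)"
    "\<And>z. z \<in> T \<Longrightarrow> G z = of_int m * L2 z + of_int n * L3 z"
  proof (rule continuous_on_glue[OF cl])
    show "of_int m * (M2 z - of_int d2 * c) + of_int n * (M3 z - of_int d3 * c) = of_int m * L2 z + of_int n * L3 z"
      if "z \<in> S \<inter> T" for z
      using that unfolding ST by (auto simp: de m_def n_def algebra_simps)
  qed (use L2 L3 M2 M3 in \<open>auto intro!: continuous_intros\<close>)
  have expG: "exp (G z) = ((z - q2) / (z - q1)) powi m * ((z - q3) / (z - q1)) powi n" if "z \<in> S \<union> T" for z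
  proof -
    have nz: "z - q1 \<noteq> 0" using that notin by auto
    have pw: "exp (of_int k * w) = exp w powi k" for k and w :: complex
      by (simp add: exp_power_int)
    from that show ?thesis
    proof
      assume z: "z \<in> S"
      have "exp (M2 z - of_int d2 * c) = (z - q2) / (z - q1)" "exp (M3 z - of_int d3 * c) = (z - q3) / (z - q1)"
        using M2(2)[OF z] M3(2)[OF z] nz by (simp_all add: exp_diff c0)
      then show ?thesis
        unfolding G(2)[OF z] exp_add pw by simp
    next
      assume z: "z \<in> T"
      have "exp (L2 z) = (z - q2) / (z - q1)" "exp (L3 z) = (z - q3) / (z - q1)"
        using L2(2)[OF z] L3(2)[OF z] nz by simp_all
      then show ?thesis
        unfolding G(3)[OF z] exp_add pw by simp
    qed
  qed
  \<comment> \<open>The points \<open>q1\<close> and \<open>q3\<close> lie off the closure of the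
    bounded component of \<open>q2\<close>, so their factors have no zeros or poles there and the
    exponent of \<open>z - q2\<close> must vanish.\<close>
  have "m = 0"
  proof (rule no_logarithm_int[OF K _ b2, of "\<lambda>z. (1 / (z - q1)) powi m * ((z - q3) / (z - q1)) powi n" G])
    have far: "q1 \<notin> closure (connected_component_set (- (S \<union> T)) q2)"
       "q3 \<notin> closure (connected_component_set (- (S \<union> T)) q2)"
      using not_in_closure_other_component[of "S \<union> T"] nc K notin compact_imp_closed by auto
    show "continuous_on (closure (connected_component_set (- (S \<union> T)) q2))
       (\<lambda>z. (1 / (z - q1)) powi m * ((z - q3) / (z - q1)) powi n)"
      using far by (intro continuous_intros) auto
    show "(1 / (z - q1)) powi m * ((z - q3) / (z - q1)) powi n \<noteq> 0"
      if "z \<in> closure (connected_component_set (- (S \<union> T)) q2)" for z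
      using far that by (auto simp: power_int_0_left_if split: if_splits)
    show "(z - q2) powi m * ((1 / (z - q1)) powi m * ((z - q3) / (z - q1)) powi n) = exp (G z)"
      if "z \<in> S \<union> T" for z
      unfolding expG[OF that] by (simp add: power_int_divide_distrib power_int_1_left)
  qed (use notin G in auto)
  then have de3: "e3 = d3" by (simp add: m_def)
  \<comment> \<open>With \<open>m = 0\<close> the quotient for \<open>q3\<close> has no jump at
    \<open>x2\<close> either, hence a logarithm on all of \<open>S \<union> T\<close>.\<close>
  obtain H where H: "continuous_on (S \<union> T) H"
    "\<And>z. z \<in> S \<Longrightarrow> H z = M3 z - of_int d3 * c" "\<And>z. z \<in> T \<Longrightarrow> H z = L3 z"
  proof (rule continuous_on_glue[OF cl])
    show "M3 z - of_int d3 * c = L3 z" if "z \<in> S \<inter> T" for z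
      using that unfolding ST by (auto simp: de de3)
  qed (use L3 M3 in \<open>auto intro!: continuous_intros\<close>)
  show ?thesis
  proof (rule connected_component_if_logarithm[OF K _ _ H(1)])
    show "z - q3 = exp (H z) * (z - q1)" if "z \<in> S \<union> T" for z
      using that H L3(2) M3(2) by (auto simp: exp_diff c0)
  qed (use notin in auto)
qed

text \<open>Two common points of \<open>S\<close> and \<open>T\<close> allow only one additional
  separation, as in the Mayer-Vietoris sequence. If the three points were pairwise separated,
  \<open>q1\<close> or \<open>q2\<close> would lie in a bounded component, and
  \<open>two_sides_bounded\<close> applies after renaming.\<close>

lemma at_most_two_sides:
  fixes q1 q2 q3 x1 x2 :: complex
  assumes T: "compact T" and S: "compact S" and ST: "S \<inter> T = {x1, x2}"
    and cT: "connected_component (- T) q1 q2" "connected_component (- T) q2 q3"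
    and cS: "connected_component (- S) q1 q2" "connected_component (- S) q2 q3"
  shows "connected_component (- (S \<union> T)) q1 q2 \<or> connected_component (- (S \<union> T)) q2 q3 \<or>
         connected_component (- (S \<union> T)) q1 q3"
proof (rule ccontr)
  assume *: "\<not> ?thesis"
  let ?c = "connected_component (- (S \<union> T))"
  have nc: "\<not> ?c q1 q2" "\<not> ?c q2 q3" "\<not> ?c q1 q3" "\<not> ?c q2 q1" "\<not> ?c q3 q2" "\<not> ?c q3 q1"
    using * connected_component_sym by metis+
  have T': "connected_component (- T) a b" and S': "connected_component (- S) a b"
    if "a \<in> {q1,q2,q3}" "b \<in> {q1,q2,q3}" for a b
    using that cT cS by (auto dest: connected_component_in intro: connected_component_sym connected_component_trans)
  have nb: "\<not> bounded (connected_component_set (- (S \<union> T)) a)"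
    if "a \<in> {q1,q2,q3}" "a1 \<in> {q1,q2,q3}" "a2 \<in> {q1,q2,q3}" "\<not> ?c a a1" "\<not> ?c a a2" "\<not> ?c a2 a1" for a a1 a2
    using two_sides_bounded[OF T S ST T' T' S' S' _ that(4,5)] that by blast
  have "q1 \<notin> S \<union> T" "q2 \<notin> S \<union> T"
    using cT cS connected_component_in by blast+
  then have "bounded (connected_component_set (- (S \<union> T)) q1) \<or> bounded (connected_component_set (- (S \<union> T)) q2)"
    using bounded_component_cases[of "S \<union> T" q1 q2] nc T S by auto
  then show False
    using nb[of q1 q2 q3] nb[of q2 q1 q3] nc by auto
qed

text \<open>Omitting one leg at a time gives three logarithms. Normalised at \<open>v\<close>, the
  two that are defined on a leg agree on it. On \<open>T\<close> they may still differ by multiples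
  of \<open>2 \<pi> \<i>\<close>, and the point is to find one logarithm on \<open>T\<close> with
  the right values at all three feet.\<close>

lemma tripod_not_separating:
  fixes p q v x1 x2 x3 :: complex
  assumes T: "compact T"
    and S: "compact S1" "compact S2" "compact S3" "connected S1" "connected S2" "connected S3"
    and SS: "S1 \<inter> S2 = {v}" "S1 \<inter> S3 = {v}" "S2 \<inter> S3 = {v}"
    and ST: "S1 \<inter> T = {x1}" "S2 \<inter> T = {x2}" "S3 \<inter> T = {x3}"
    and c3: "connected_component (- (T \<union> S1 \<union> S2)) p q"
    and c2: "connected_component (- (T \<union> S1 \<union> S3)) p q"
    and c1: "connected_component (- (T \<union> S2 \<union> S3)) p q"
  shows "connected_component (- (T \<union> S1 \<union> S2 \<union> S3)) p q"
proof -
  have notin: "p \<notin> T \<union> S1 \<union> S2 \<union> S3" "q \<notin> T \<union> S1 \<union> S2 \<union> S3"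
    using c1 c2 connected_component_in by blast+
  have cl: "closed T" "closed S1" "closed S2" "closed S3"
    using T S compact_imp_closed by auto
  have shift: "\<exists>l'. continuous_on K l' \<and> l' v = w \<and> (\<forall>z\<in>K. z - p = exp (l' z) * (z - q))"
    if "continuous_on K l" "\<And>z. z \<in> K \<Longrightarrow> z - p = exp (l z) * (z - q)" "v \<in> K" "q \<notin> K" "v - p = exp w * (v - q)" for K l w
  proof (intro exI[of _ "\<lambda>z. l z + (w - l v)"] conjI ballI)
    have "exp (w - l v) = 1"
      using that(2)[OF that(3)] that(3,4,5) by (auto simp: exp_diff)
    then show "z - p = exp (l z + (w - l v)) * (z - q)" if "z \<in> K" for z
      using \<open>\<And>z. z \<in> K \<Longrightarrow> z - p = exp (l z) * (z - q)\<close>[OF that] by (simp add: exp_add)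
  qed (use that in \<open>auto intro!: continuous_intros\<close>)
  have v: "v \<in> S1" "v \<in> S2" "v \<in> S3" using SS by auto
  obtain N3 where N3: "continuous_on (T \<union> S1 \<union> S2) N3" "\<And>z. z \<in> T \<union> S1 \<union> S2 \<Longrightarrow> z - p = exp (N3 z) * (z - q)"
    using logarithm_if_connected_component[OF _ c3] cl by auto
  have wv: "v - p = exp (N3 v) * (v - q)" using N3(2) v by auto
  obtain N2 where N2: "continuous_on (T \<union> S1 \<union> S3) N2" "N2 v = N3 v"
    "\<And>z. z \<in> T \<union> S1 \<union> S3 \<Longrightarrow> z - p = exp (N2 z) * (z - q)"
  proof -
    obtain l where "continuous_on (T \<union> S1 \<union> S3) l" "\<And>z. z \<in> T \<union> S1 \<union> S3 \<Longrightarrow> z - p = exp (l z) * (z - q)"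
      using logarithm_if_connected_component[OF _ c2] cl by auto
    from shift[OF this _ _ wv] show thesis using that notin v by blast
  qed
  obtain N1 where N1: "continuous_on (T \<union> S2 \<union> S3) N1" "N1 v = N3 v"
    "\<And>z. z \<in> T \<union> S2 \<union> S3 \<Longrightarrow> z - p = exp (N1 z) * (z - q)"
  proof -
    obtain l where "continuous_on (T \<union> S2 \<union> S3) l" "\<And>z. z \<in> T \<union> S2 \<union> S3 \<Longrightarrow> z - p = exp (l z) * (z - q)"
      using logarithm_if_connected_component[OF _ c1] cl by auto
    from shift[OF this _ _ wv] show thesis using that notin v by blast
  qed
  have discrete: "f z = g z"
    if "exp (f z) * (z - q) = exp (g z) * (z - q)" "z \<noteq> q" "dist (f z) (g z) < 1" for f g :: "complex \<Rightarrow> complex" and z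
  proof -
    have "exp (f z) = exp (g z)" using that by simp
    then show ?thesis
    proof (rule exp_complex_eqI[rotated])
      show "\<bar>Im (f z) - Im (g z)\<bar> < 2 * pi"
        using that(3) abs_Im_le_cmod[of "f z - g z"] pi_gt3 by (simp add: dist_norm)
    qed
  qed
  have agree: "f x = g x"
    if "connected S" "continuous_on S f" "continuous_on S g" "v \<in> S" "x \<in> S" "f v = g v" "q \<notin> S"
      "\<And>z. z \<in> S \<Longrightarrow> z - p = exp (f z) * (z - q)" "\<And>z. z \<in> S \<Longrightarrow> z - p = exp (g z) * (z - q)" for S f g x
  proof -
    have "(f v = g v) = (f x = g x)"
    proof (rule connected_local_const[OF that(1,4,5)], intro ballI)
      fix y assume y: "y \<in> S"
      show "\<forall>\<^sub>F y' in at y within S. (f y = g y) = (f y' = g y')"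
      proof -
        have "((\<lambda>y. f y - g y) \<longlongrightarrow> f y - g y) (at y within S)"
          using that(2,3) y by (auto simp: continuous_on_def intro!: tendsto_diff)
        then have ev: "\<forall>\<^sub>F y' in at y within S. dist (f y' - g y') (f y - g y) < 1"
          by (rule tendstoD) simp
        have "\<forall>\<^sub>F y' in at y within S. y' \<in> S"
          by (simp add: eventually_at_filter)
        with ev show ?thesis
        proof eventually_elim
          case (elim y')
          define k where "k = f y - g y"
          have k: "exp k = 1"
            using that(8,9)[OF y] that(7) y by (auto simp: k_def exp_diff)
          have "y' - p = exp (g y' + k) * (y' - q)"
            using that(9)[of y'] elim k by (simp add: exp_add)
          then have "f y' = g y' + k"
            using discrete[of f y' "\<lambda>y'. g y' + k"] elim that(7,8) by (auto simp: dist_norm k_def algebra_simps)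
          then show ?case by (auto simp: k_def)
        qed
      qed
    qed
    with that(6) show ?thesis by simp
  qed
  have x: "x1 \<in> S1" "x1 \<in> T" "x2 \<in> S2" "x2 \<in> T" "x3 \<in> S3" "x3 \<in> T" using ST by auto
  have A1: "N3 z = N2 z" if "z \<in> S1" for z
    by (rule agree[of S1 N3 N2, OF S(4) _ _ v(1) that N2(2)[symmetric]])
      (use notin in \<open>auto intro!: N3(2) N2(3) intro: continuous_on_subset[OF N3(1)] continuous_on_subset[OF N2(1)]\<close>)
  have A2: "N3 z = N1 z" if "z \<in> S2" for z
    by (rule agree[of S2 N3 N1, OF S(5) _ _ v(2) that N1(2)[symmetric]])
      (use notin in \<open>auto intro!: N3(2) N1(3) intro: continuous_on_subset[OF N3(1)] continuous_on_subset[OF N1(1)]\<close>)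
  have A3: "N2 z = N1 z" if "z \<in> S3" for z
    by (rule agree[of S3 N2 N1, OF S(6) _ _ v(3) that])
      (use notin N1(2) N2(2) in \<open>auto intro!: N2(3) N1(3) intro: continuous_on_subset[OF N2(1)] continuous_on_subset[OF N1(1)]\<close>)
  have contT: "continuous_on T N1" "continuous_on T N2" "continuous_on T N3"
    using N1 N2 N3 by (auto intro: continuous_on_subset)
  have TK: "\<And>z. z \<in> T \<Longrightarrow> z - p = exp (N1 z) * (z - q)" "\<And>z. z \<in> T \<Longrightarrow> z - p = exp (N2 z) * (z - q)"
     "\<And>z. z \<in> T \<Longrightarrow> z - p = exp (N3 z) * (z - q)" "q \<notin> T"
    using notin by (auto intro!: N1(3) N2(3) N3(2))
  \<comment> \<open>\<open>N2\<close> has the right values at \<open>x1\<close> and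
    \<open>x3\<close>, and \<open>N3\<close> at \<open>x1\<close> and \<open>x2\<close>. If neither
    is also right at the remaining foot, \<open>T\<close> has to be split.\<close>
  obtain \<Lambda> where \<Lambda>: "continuous_on T \<Lambda>" "\<And>z. z \<in> T \<Longrightarrow> z - p = exp (\<Lambda> z) * (z - q)"
    "\<Lambda> x1 = N3 x1" "\<Lambda> x2 = N3 x2" "\<Lambda> x3 = N2 x3"
  proof (cases "N3 x2 = N2 x2 \<or> N3 x3 = N1 x3")
    case True
    then show thesis
    proof
      assume "N3 x2 = N2 x2"
      then show thesis
        by (intro that[of N2] contT(2) TK(2)) (simp_all add: A1 x)
    next
      assume "N3 x3 = N1 x3"
      then show thesis
        by (intro that[of N3] contT(3) TK(3)) (simp_all add: A3 x)
    qed
  next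
    case False
    define d where "d = N3 x2 - N2 x2"
    have d0: "d \<noteq> 0" using False by (simp add: d_def)
    have d1: "exp d = 1"
      using TK(2,3)[OF x(4)] TK(4) x(4) by (auto simp: d_def exp_diff)
    \<comment> \<open>Logarithms of one function differ by a discrete set of values, so
      \<open>P\<close> is open and closed in \<open>T\<close>. It contains \<open>x2\<close>, but
      not \<open>x1\<close>, where \<open>N3 = N2\<close>, and not \<open>x3\<close>, where
      \<open>N3 \<noteq> N1\<close>. Taking \<open>N3\<close> on \<open>P\<close> and
      \<open>N2\<close> elsewhere is therefore continuous and right at all feet.\<close>
    define P where "P = {z \<in> T. N3 z - N2 z = d \<and> N3 z = N1 z}"
    have "P = T \<inter> (\<lambda>z. N3 z - N2 z) -` {d} \<inter> (T \<inter> (\<lambda>z. N3 z - N1 z) -` {0})"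
      by (auto simp: P_def)
    then have clP: "closed P"
      using contT cl
      by (simp only:) (intro closed_Int[OF continuous_closed_preimage continuous_closed_preimage] continuous_on_diff closed_singleton)
    have near: "N3 z - N2 z = d" if "z \<in> T" "dist (N3 z - N2 z) d < 1" for z
    proof -
      have "exp (N3 z) * (z - q) = exp (N2 z + d) * (z - q)"
        using TK(2,3)[OF that(1)] d1 by (simp add: exp_add)
      then show ?thesis
        using discrete[of N3 z "\<lambda>z. N2 z + d"] that TK(4) by (auto simp: dist_norm algebra_simps)
    qed
    have near': "N3 z = N1 z" if "z \<in> T" "dist (N3 z) (N1 z) < 1" for z
      using discrete[of N3 z N1] TK(1,3)[OF that(1)] that TK(4) by auto
    have "T - P = (T \<inter> (\<lambda>z. dist (N3 z - N2 z) d) -` {1..}) \<union> (T \<inter> (\<lambda>z. dist (N3 z) (N1 z)) -` {1..})"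
      using near near' by (force simp: P_def not_less[symmetric])
    moreover have "closed \<dots>"
      using contT cl by (intro closed_Un continuous_closed_preimage continuous_intros) auto
    ultimately have clQ: "closed (T - P)" by simp
    have cont: "continuous_on P N3" "continuous_on (T - P) N2"
      using contT by (auto intro: continuous_on_subset simp: P_def)
    obtain \<Lambda> where \<Lambda>: "continuous_on (P \<union> (T - P)) \<Lambda>" "\<And>z. z \<in> P \<Longrightarrow> \<Lambda> z = N3 z" "\<And>z. z \<in> T - P \<Longrightarrow> \<Lambda> z = N2 z"
      using continuous_on_glue[OF clP clQ cont] by auto
    have "x1 \<in> T - P" "x2 \<in> P" "x3 \<in> T - P"
      using x A1 A2 d0 False by (auto simp: P_def d_def)
    moreover have "P \<union> (T - P) = T" by (auto simp: P_def)
    ultimately show thesis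
      using \<Lambda> A1[OF x(1)] TK(2,3) by (intro that[of \<Lambda>]) (auto split: if_splits, metis DiffI)
  qed
  obtain h where h: "continuous_on ((S1 \<union> S2) \<union> S3) h" "\<And>z. z \<in> S1 \<union> S2 \<Longrightarrow> h z = N3 z" "\<And>z. z \<in> S3 \<Longrightarrow> h z = N2 z"
  proof (rule continuous_on_glue[of "S1 \<union> S2" S3 N3 N2])
    show "N3 z = N2 z" if "z \<in> (S1 \<union> S2) \<inter> S3" for z
    proof -
      have "z = v" using that SS by auto
      then show ?thesis using N2(2) by simp
    qed
  qed (use cl N2 N3 in \<open>auto intro: continuous_on_subset\<close>)
  obtain H where H: "continuous_on (T \<union> ((S1 \<union> S2) \<union> S3)) H" "\<And>z. z \<in> T \<Longrightarrow> H z = \<Lambda> z" "\<And>z. z \<in> (S1 \<union> S2) \<union> S3 \<Longrightarrow> H z = h z"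
  proof (rule continuous_on_glue[of T "(S1 \<union> S2) \<union> S3" \<Lambda> h])
    show "\<Lambda> z = h z" if "z \<in> T \<inter> ((S1 \<union> S2) \<union> S3)" for z
    proof -
      have "z = x1 \<or> z = x2 \<or> z = x3" using that ST by auto
      then show ?thesis using \<Lambda> h x by auto
    qed
  qed (use cl \<Lambda> h in auto)
  have eq: "T \<union> ((S1 \<union> S2) \<union> S3) = T \<union> S1 \<union> S2 \<union> S3" by auto
  show ?thesis
  proof (rule connected_component_if_logarithm[of _ _ _ H])
    show "continuous_on (T \<union> S1 \<union> S2 \<union> S3) H" using H(1) eq by simp
    show "z - p = exp (H z) * (z - q)" if z: "z \<in> T \<union> S1 \<union> S2 \<union> S3" for z
    proof -
      consider "z \<in> T" | "z \<in> S1 \<union> S2" | "z \<in> S3" using z by blast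
      then show ?thesis
        using H h \<Lambda> N3 N2 by cases auto
    qed
  qed (use notin T S in auto)
qed

section \<open>Edges and faces of plane graphs\<close>

text \<open>The inverse would map a nonempty open subset of the plane continuously and injectively
  into the line, against invariance of dimension.\<close>

lemma interior_injective_image:
  fixes g :: "real \<Rightarrow> complex"
  assumes "compact K" "continuous_on K g" "inj_on g K"
  shows "interior (g ` K) = {}"
proof (rule ccontr)
  assume ne: "interior (g ` K) \<noteq> {}"
  let ?h = "the_inv_into K g"
  have "continuous_on (g ` K) ?h"
    using assms by (intro continuous_on_inv) (auto simp: the_inv_into_f_f)
  then have "continuous_on (interior (g ` K)) ?h"
    using interior_subset by (rule continuous_on_subset)
  moreover have "inj_on ?h (interior (g ` K))"
    using inj_on_the_inv_into[OF assms(3)] interior_subset by (rule inj_on_subset)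
  ultimately have "DIM(complex) \<le> DIM(real)"
    using ne by (intro invariance_of_dimension[of "interior (g ` K)" ?h]) auto
  then show False by simp
qed

locale plane_graph =
  fixes G :: "'e graph_data"
  assumes plane: "finite_plane_graph G"
begin

lemma finite_verts: "finite (verts G)" and finite_edges: "finite (edges G)"
  using plane by (auto simp: finite_plane_graph_def)

lemma simple_path_curve: "e \<in> edges G \<Longrightarrow> simple_path (curve G e)"
  using plane by (auto simp: finite_plane_graph_def)

lemma continuous_on_curve: "e \<in> edges G \<Longrightarrow> S \<subseteq> {0..1} \<Longrightarrow> continuous_on S (curve G e)"
  using simple_path_curve simple_path_imp_path unfolding path_def by (metis continuous_on_subset)

lemma compact_curve_image: "e \<in> edges G \<Longrightarrow> compact S \<Longrightarrow> S \<subseteq> {0..1} \<Longrightarrow> compact (curve G e ` S)"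
  using continuous_on_curve compact_continuous_image by blast

lemma connected_curve_image: "e \<in> edges G \<Longrightarrow> connected S \<Longrightarrow> S \<subseteq> {0..1} \<Longrightarrow> connected (curve G e ` S)"
  using continuous_on_curve connected_continuous_image by blast

lemma curve_eqD:
  "e \<in> edges G \<Longrightarrow> s \<in> {0<..<1} \<Longrightarrow> t \<in> {0..1} \<Longrightarrow> curve G e s = curve G e t \<Longrightarrow> s = t"
  using simple_path_curve[of e] unfolding simple_path_def loop_free_def by fastforce

lemma curve_not_vertex: "e \<in> edges G \<Longrightarrow> s \<in> {0<..<1} \<Longrightarrow> curve G e s \<notin> verts G"
  using plane by (force simp: finite_plane_graph_def)

lemma distinct_curves_meet:
  assumes "e \<in> edges G" "e' \<in> edges G" "e \<noteq> e'" "s \<in> {0..1}" "t \<in> {0..1}" "curve G e s = curve G e' t"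
  shows "curve G e s \<in> verts G"
proof -
  have "path_image (curve G e) \<inter> path_image (curve G e') \<subseteq> verts G"
    using plane assms(1-3) by (auto simp: finite_plane_graph_def)
  moreover have "curve G e s \<in> path_image (curve G e)" "curve G e s \<in> path_image (curve G e')"
    using assms(4-6) unfolding path_image_def by (blast, metis imageI)
  ultimately show ?thesis
    by blast
qed

lemma graph_setE:
  assumes "x \<in> graph_set G"
  obtains "x \<in> verts G" | e t where "e \<in> edges G" "t \<in> {0..1}" "x = curve G e t"
  using assms by (auto simp: graph_set_def path_image_def)

lemma curve_in_graph_set: "e \<in> edges G \<Longrightarrow> t \<in> {0..1} \<Longrightarrow> curve G e t \<in> graph_set G"
  unfolding graph_set_def path_image_def by blast

lemma compact_graph_set: "compact (graph_set G)"
  unfolding graph_set_def path_image_def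
  by (rule compact_Un[OF finite_imp_compact[OF finite_verts] compact_UN[OF finite_edges]])
    (rule compact_curve_image, auto)

lemma closed_graph_set: "closed (graph_set G)"
  by (simp add: compact_graph_set compact_imp_closed)

lemma interior_curve: assumes e: "e \<in> edges G" shows "interior (path_image (curve G e)) = {}"
proof -
  \<comment> \<open>A closed curve takes the same value at 0 and 1; each half is injective.\<close>
  have inj: "inj_on (curve G e) {0..1/2}" "inj_on (curve G e) {1/2..1}"
    using simple_path_curve[OF e] unfolding simple_path_def loop_free_def inj_on_def by fastforce+
  have "path_image (curve G e) = curve G e ` ({0..1/2} \<union> {1/2..1})"
    unfolding path_image_def by (rule arg_cong[where f="\<lambda>S. curve G e ` S"]) auto
  then have "path_image (curve G e) = curve G e ` {0..1/2} \<union> curve G e ` {1/2..1}"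
    by (simp only: image_Un)
  moreover have "interior (curve G e ` {0..1/2}) = {}" "interior (curve G e ` {1/2..1}) = {}"
    by (intro interior_injective_image continuous_on_curve[OF e] inj compact_Icc; simp)+
  moreover have "closed (curve G e ` {0..1/2})"
    by (intro compact_imp_closed compact_curve_image[OF e]) auto
  ultimately show ?thesis
    by (simp add: interior_closed_Un_empty_interior)
qed

lemma interior_graph_set: "interior (graph_set G) = {}"
proof -
  have "interior (\<Union>e\<in>E. path_image (curve G e)) = {}" if "finite E" "E \<subseteq> edges G" for E
    using that
  proof (induction E rule: finite_induct)
    case (insert e E)
    have "closed (path_image (curve G e))"
      using insert by (simp add: closed_path_image simple_path_curve simple_path_imp_path)
    then show ?case
      using insert interior_curve[of e] by (simp add: interior_closed_Un_empty_interior)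
  qed simp
  then have "interior (\<Union>e\<in>edges G. path_image (curve G e)) = {}"
    using finite_edges by blast
  moreover have "interior (verts G) = {}"
    using finite_verts by (rule empty_interior_finite)
  ultimately show ?thesis
    unfolding graph_set_def
    using finite_verts by (simp add: interior_closed_Un_empty_interior finite_imp_closed)
qed

text \<open>An inner point of an edge is no vertex, lies on no other edge and is attained only once,
  so removing an open subarc leaves a finite union of closed pieces.\<close>

lemma closed_graph_set_diff:
  assumes e: "e \<in> edges G" and ab: "0 \<le> a" "a < b" "b \<le> 1"
  shows "closed (graph_set G - curve G e ` {a<..<b})"
proof -
  have "graph_set G - curve G e ` {a<..<b} =
      verts G \<union> (\<Union>e'\<in>edges G - {e}. path_image (curve G e')) \<union> curve G e ` {0..a} \<union> curve G e ` {b..1}"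
    (is "?L = ?R")
  proof
    show "?L \<subseteq> ?R"
    proof
      fix x assume x: "x \<in> ?L"
      then have "x \<in> graph_set G" by simp
      then show "x \<in> ?R"
      proof (cases rule: graph_setE)
        case (2 e' t)
        show ?thesis
        proof (cases "e' = e")
          case True
          then have "t \<notin> {a<..<b}" using x 2 by auto
          then have "t \<in> {0..a} \<union> {b..1}" using 2(2) by auto
          then show ?thesis using 2 True by blast
        next
          case False
          then show ?thesis using 2 unfolding path_image_def by blast
        qed
      qed auto
    qed
    show "?R \<subseteq> ?L"
    proof
      fix x assume x: "x \<in> ?R"
      have "curve G e ` {0..a} \<subseteq> path_image (curve G e)" "curve G e ` {b..1} \<subseteq> path_image (curve G e)"
        unfolding path_image_def using ab by (intro image_mono, simp)+
      with x have "x \<in> graph_set G"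
        using e unfolding graph_set_def by blast
      moreover have "x \<noteq> curve G e s" if s: "s \<in> {a<..<b}" for s
      proof
        assume eq: "x = curve G e s"
        have s': "s \<in> {0<..<1}" using s ab by auto
        from x consider "x \<in> verts G" | e' t where "e' \<in> edges G" "e' \<noteq> e" "t \<in> {0..1}" "x = curve G e' t"
          | t where "t \<in> {0..a} \<union> {b..1}" "x = curve G e t"
          unfolding path_image_def by blast
        then show False
        proof cases
          case 1 then show ?thesis using curve_not_vertex[OF e s'] eq by simp
        next
          case 2 then show ?thesis
            using distinct_curves_meet[of e e' s t] curve_not_vertex[OF e s'] e s' eq by auto
        next
          case 3
          then have "t \<in> {0..1}" using ab by auto
          then have "s = t" using curve_eqD[OF e s', of t] eq 3 by simp
          then show ?thesis using 3 s by auto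
        qed
      qed
      ultimately show "x \<in> ?L" by blast
    qed
  qed
  also have "closed \<dots>"
  proof -
    have "closed (\<Union>e'\<in>edges G - {e}. path_image (curve G e'))"
      by (rule closed_UN) (auto simp: finite_edges closed_path_image simple_path_curve simple_path_imp_path)
    moreover have "closed (curve G e ` {0..a})" "closed (curve G e ` {b..1})"
      using ab by (auto intro!: compact_imp_closed compact_curve_image[OF e] simp del: finite_imageI)
    ultimately show ?thesis
      by (intro closed_Un finite_imp_closed[OF finite_verts])
  qed
  finally show ?thesis .
qed

section \<open>Faces and the subarcs that they touch\<close>

definition face :: "complex \<Rightarrow> complex set" where
  "face z = connected_component_set (- graph_set G) z"

lemma face_in_faces: "z \<notin> graph_set G \<Longrightarrow> face z \<in> faces G"
  by (auto simp: faces_def face_def components_def)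

lemma in_face: "z \<notin> graph_set G \<Longrightarrow> z \<in> face z"
  by (simp add: face_def)

lemma face_eqI: "F \<in> faces G \<Longrightarrow> z \<in> F \<Longrightarrow> face z = F"
  unfolding faces_def face_def components_def using connected_component_eq[of z "- graph_set G"] by blast

lemma open_face: "F \<in> faces G \<Longrightarrow> open F"
  unfolding faces_def by (rule open_components[OF open_Compl[OF closed_graph_set]])

lemma connected_face: "F \<in> faces G \<Longrightarrow> connected F"
  using in_components_connected by (auto simp: faces_def)

lemma face_disjoint: "F \<in> faces G \<Longrightarrow> F \<inter> graph_set G = {}"
  using in_components_subset by (force simp: faces_def)

lemma face_nonempty: "F \<in> faces G \<Longrightarrow> F \<noteq> {}"
  using in_components_nonempty by (auto simp: faces_def)

lemma frontier_face: "F \<in> faces G \<Longrightarrow> frontier F \<subseteq> graph_set G"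
  using frontier_of_components_closed_complement closed_graph_set by (auto simp: faces_def)

lemma face_connected_componentD: "connected_component (- graph_set G) y z \<Longrightarrow> face y = face z"
  unfolding face_def using connected_component_eq[of z "- graph_set G" y] by simp

text \<open>The relation \<open>adjacent_faces\<close> localised to a subarc. The closure can stand
  for the frontier because a face contains no point of the graph.\<close>

definition arc_faces :: "'e \<Rightarrow> real \<Rightarrow> real \<Rightarrow> complex set set" where
  "arc_faces e a b = {F \<in> faces G. closure F \<inter> curve G e ` {a<..<b} \<noteq> {}}"

lemma arc_faces_subset_faces: "F \<in> arc_faces e a b \<Longrightarrow> F \<in> faces G"
  by (simp add: arc_faces_def)

lemma arc_faces_mono: "a' \<le> a \<Longrightarrow> b \<le> b' \<Longrightarrow> arc_faces e a b \<subseteq> arc_faces e a' b'"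
  by (fastforce simp: arc_faces_def)

lemma adjacent_faces_eq:
  assumes "e \<in> edges G" shows "adjacent_faces G e = arc_faces e 0 1"
proof -
  have "frontier F \<inter> curve G e ` {0<..<1} = closure F \<inter> curve G e ` {0<..<1}" if F: "F \<in> faces G" for F
  proof -
    have "curve G e ` {0<..<1} \<inter> F = {}"
      using face_disjoint[OF F] curve_in_graph_set[OF assms] by fastforce
    then show ?thesis
      using interior_open[OF open_face[OF F]] by (auto simp: frontier_def)
  qed
  then show ?thesis
    by (auto simp: adjacent_faces_def arc_faces_def)
qed

text \<open>In a ball that meets the graph only in the subarc, the segment from \<open>z\<close> to
  the centre leaves the face of \<open>z\<close> at a frontier point, which must lie on the
  subarc.\<close>

lemma arc_neighbourhood:
  assumes e: "e \<in> edges G" and ab: "0 \<le> a" "b \<le> 1" and t: "t \<in> {a<..<b}"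
  shows "\<exists>r>0. \<forall>z\<in>ball (curve G e t) r - graph_set G. face z \<in> arc_faces e a b"
proof -
  let ?x = "curve G e t"
  have xX: "?x \<in> graph_set G"
    using t ab by (intro curve_in_graph_set e) auto
  have "open (- (graph_set G - curve G e ` {a<..<b}))"
    by (intro open_Compl closed_graph_set_diff[OF e]) (use ab t in auto)
  moreover have "?x \<in> - (graph_set G - curve G e ` {a<..<b})"
    using t by auto
  ultimately obtain r where r: "r > 0" "ball ?x r \<subseteq> - (graph_set G - curve G e ` {a<..<b})"
    using open_contains_ball by metis
  then have sub: "ball ?x r \<inter> graph_set G \<subseteq> curve G e ` {a<..<b}"
    by auto
  show ?thesis
  proof (intro exI[of _ r] conjI ballI r(1))
    fix z assume z: "z \<in> ball ?x r - graph_set G"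
    then have F: "face z \<in> faces G" by (simp add: face_in_faces)
    have "closed_segment z ?x \<inter> frontier (face z) \<noteq> {}"
      by (rule connected_Int_frontier) (use z xX face_disjoint[OF F] in_face[of z] in auto)
    then obtain y where y: "y \<in> closed_segment z ?x" "y \<in> frontier (face z)"
      by blast
    have "closed_segment z ?x \<subseteq> ball ?x r"
      using z r(1) by (intro closed_segment_subset) auto
    then have "y \<in> curve G e ` {a<..<b}"
      using y sub frontier_face[OF F] by blast
    then show "face z \<in> arc_faces e a b"
      using F y(2) by (auto simp: arc_faces_def frontier_def)
  qed
qed

lemma arc_faces_nonempty:
  assumes e: "e \<in> edges G" and ab: "0 \<le> a" "a < b" "b \<le> 1"
  shows "arc_faces e a b \<noteq> {}"
proof -
  have "(a + b) / 2 \<in> {a<..<b}" using ab by auto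
  then obtain r where r: "r > 0"
    "\<forall>z\<in>ball (curve G e ((a + b) / 2)) r - graph_set G. face z \<in> arc_faces e a b"
    using arc_neighbourhood[OF e ab(1,3)] by blast
  have "\<not> ball (curve G e ((a + b) / 2)) r \<subseteq> graph_set G"
  proof
    assume "ball (curve G e ((a + b) / 2)) r \<subseteq> graph_set G"
    then have "ball (curve G e ((a + b) / 2)) r \<subseteq> interior (graph_set G)"
      by (rule interior_maximal[OF _ open_ball])
    then show False
      using interior_graph_set r(1) by auto
  qed
  with r(2) show ?thesis by blast
qed

text \<open>A connected set that meets the closure of a face forms a connected set with it, so
  \<open>C\<close> serves as a passage between the two faces that avoids \<open>K\<close>.\<close>

lemma faces_connected_through:
  assumes C: "connected C" "C \<inter> K = {}" and K: "K \<subseteq> graph_set G"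
    and F: "F \<in> faces G" "closure F \<inter> C \<noteq> {}" "z \<in> F"
    and F': "F' \<in> faces G" "closure F' \<inter> C \<noteq> {}" "z' \<in> F'"
  shows "connected_component (- K) z z'"
proof -
  have *: "connected (F \<union> C)" if "F \<in> faces G" "closure F \<inter> C \<noteq> {}" for F
  proof -
    obtain p where p: "p \<in> closure F" "p \<in> C" using \<open>closure F \<inter> C \<noteq> {}\<close> by blast
    have "connected (insert p F)"
      by (rule connected_intermediate_closure[OF connected_face[OF \<open>F \<in> faces G\<close>]])
        (use p closure_subset in auto)
    then have "connected (insert p F \<union> C)"
      using C(1) p by (intro connected_Un) auto
    moreover have "insert p F \<union> C = F \<union> C" using p by auto
    ultimately show ?thesis by simp
  qed
  have "C \<noteq> {}" using F by blast
  then have "connected ((F \<union> C) \<union> (F' \<union> C))"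
    by (intro connected_Un *[OF F(1,2)] *[OF F'(1,2)]) blast
  moreover have "(F \<union> C) \<union> (F' \<union> C) \<subseteq> - K"
    using C(2) K face_disjoint F(1) F'(1) by blast
  ultimately show ?thesis
    unfolding connected_component_def using F(3) F'(3) by blast
qed

text \<open>The tool for following a region across the graph: if the faces along each subarc met by
  \<open>W\<close> share a value of \<open>c\<close>, moving inside \<open>W\<close> cannot change
  it. The hypothesis keeps vertices out of \<open>W\<close>, since only inner points of edges lie on
  such subarcs.\<close>

lemma face_function_constant:
  fixes c :: "complex set \<Rightarrow> 'v"
  assumes W: "open W" "connected W"
    and arcs: "\<And>x. x \<in> W \<inter> graph_set G \<Longrightarrow> \<exists>e a b. e \<in> edges G \<and> 0 \<le> a \<and> b \<le> 1 \<and> x \<in> curve G e ` {a<..<b} \<and>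
        (\<forall>F\<in>arc_faces e a b. \<forall>F'\<in>arc_faces e a b. c F = c F')"
    and yz: "y \<in> W - graph_set G" "z \<in> W - graph_set G"
  shows "c (face y) = c (face z)"
proof (rule locally_constant_across[OF W interior_graph_set _ yz, of "\<lambda>z. c (face z)"])
  fix x assume x: "x \<in> W"
  show "\<exists>N. open N \<and> x \<in> N \<and> (\<forall>y\<in>N - graph_set G. \<forall>y'\<in>N - graph_set G. c (face y) = c (face y'))"
  proof (cases "x \<in> graph_set G")
    case True
    with x have "x \<in> W \<inter> graph_set G" by simp
    from arcs[OF this] obtain e a b where eab: "e \<in> edges G" "0 \<le> a" "b \<le> 1" "x \<in> curve G e ` {a<..<b}"
      "\<forall>F\<in>arc_faces e a b. \<forall>F'\<in>arc_faces e a b. c F = c F'"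
      by (elim exE conjE) (rule that)
    from eab(4) obtain t where t: "t \<in> {a<..<b}" "x = curve G e t"
      by (rule imageE) (rule that)
    obtain r where "r > 0" "\<forall>z\<in>ball (curve G e t) r - graph_set G. face z \<in> arc_faces e a b"
      using arc_neighbourhood[OF eab(1-3) t(1)] by blast
    then show ?thesis
      using eab(5) t(2) by (intro exI[of _ "ball x r"]) auto
  next
    case False
    have eq: "face y = face x" if "y \<in> face x" for y
      using face_eqI[OF face_in_faces[OF False] that] .
    show ?thesis
    proof (intro exI[of _ "face x"] conjI ballI)
      show "open (face x)" "x \<in> face x"
        by (simp_all add: open_face face_in_faces in_face False)
      show "c (face y) = c (face y')" if "y \<in> face x - graph_set G" "y' \<in> face x - graph_set G" for y y'
        using eq[of y] eq[of y'] that by simp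
    qed
  qed
qed

lemma connected_compl_subarc:
  assumes "e \<in> edges G" "0 \<le> s" "s < t" "t \<le> 1" "t - s < 1"
  shows "connected (- curve G e ` {s..t})"
proof -
  have "arc (subpath s t (curve G e))"
    using assms by (intro arc_simple_path_subpath_interior simple_path_curve) auto
  then have "connected (- path_image (subpath s t (curve G e)))"
    by (intro connected_arc_complement) auto
  then show ?thesis
    using assms by (simp add: path_image_subpath)
qed

text \<open>Deleting an open arc that runs from around \<open>t\<close> into the given subarc joins
  \<open>F\<close> to a face \<open>A\<close> at the subarc. All of this arc but a piece inside the
  subarc is then put back; what is put back meets the rest of the graph in one point, so by
  Janiszewski's theorem \<open>A\<close> and \<open>F\<close> stay joined. The passage crosses only
  the subarc, where the property of touching it cannot change.\<close>

lemma arc_faces_eq_aux: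
  assumes e: "e \<in> edges G" and ab: "0 \<le> a" "a < b" "b \<le> 1" and F: "F \<in> arc_faces e 0 1"
  shows "F \<in> arc_faces e a b"
proof (rule ccontr)
  assume nF: "F \<notin> arc_faces e a b"
  let ?X = "graph_set G" and ?\<gamma> = "curve G e"
  have FF: "F \<in> faces G" using F by (rule arc_faces_subset_faces)
  obtain t where t: "t \<in> {0<..<1}" "?\<gamma> t \<in> closure F"
    using F unfolding arc_faces_def by blast
  then have "t \<notin> {a<..<b}"
    using nF FF by (auto simp: arc_faces_def)
  define m where "m = (a + b) / 2"
  \<comment> \<open>The \<open>j\<close> interval is the deleted arc, the \<open>s\<close> interval
    the part put back, cut at the midpoint \<open>m\<close>, and the \<open>r\<close> interval the
    gap left open inside the subarc. Beyond \<open>t\<close> the first two end at the same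
    \<open>x\<close>, halfway to the end of the edge, so that \<open>s1\<close> is positive and the
    arc put back is proper.\<close>
  obtain j1 j2 s1 s2 r1 r2 x where
    j: "0 \<le> j1" "j1 < j2" "j2 \<le> 1" "t \<in> {j1<..<j2}" and s: "0 < s1" "s1 < s2" "s2 \<le> 1"
    and r: "a \<le> r1" "r1 < r2" "r2 \<le> b" "{j1<..<j2} - {s1..s2} = {r1<..<r2}"
    and x: "{s1..s2} - {j1<..<j2} = {x}"
  proof (cases "t \<ge> b")
    case True
    show thesis
    proof (rule that[of a "(t+1)/2" m "(t+1)/2" a m "(t+1)/2"])
    qed (use True t ab in \<open>auto simp: m_def\<close>)
  next
    case False
    then have ta: "t \<le> a" using \<open>t \<notin> {a<..<b}\<close> by auto
    show thesis
    proof (rule that[of "t/2" b "t/2" m m b "t/2"])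
    qed (use ta t ab in \<open>auto simp: m_def\<close>)
  qed
  define T where "T = ?X - ?\<gamma> ` {j1<..<j2}"
  define S where "S = ?\<gamma> ` {s1..s2}"
  have clT: "closed T"
    unfolding T_def using e j by (intro closed_graph_set_diff) auto
  have cS: "compact S"
    unfolding S_def using s by (intro compact_curve_image[OF e]) auto
  have SX: "S \<subseteq> ?X"
    unfolding S_def using s e by (auto intro!: curve_in_graph_set)
  have ST: "S \<inter> T = {?\<gamma> x}"
  proof
    show "S \<inter> T \<subseteq> {?\<gamma> x}"
      using x by (auto simp: S_def T_def)
    have x': "x \<in> {s1..s2}" "x \<notin> {j1<..<j2}" using x by auto
    then have "?\<gamma> x \<in> S" by (simp add: S_def)
    moreover have "?\<gamma> x \<notin> ?\<gamma> ` {j1<..<j2}"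
    proof
      assume "?\<gamma> x \<in> ?\<gamma> ` {j1<..<j2}"
      then obtain s' where s': "s' \<in> {j1<..<j2}" "?\<gamma> s' = ?\<gamma> x" by auto
      then have "s' = x"
        using curve_eqD[OF e, of s' x] j x' s by auto
      then show False using s' x' by simp
    qed
    ultimately show "{?\<gamma> x} \<subseteq> S \<inter> T"
      using SX by (auto simp: T_def)
  qed
  obtain A where A: "A \<in> arc_faces e r1 r2"
    using arc_faces_nonempty[OF e, of r1 r2] r ab by auto
  then have AF: "A \<in> faces G" and Aab: "A \<in> arc_faces e a b"
    using arc_faces_subset_faces arc_faces_mono[OF r(1,3)] by blast+
  obtain qA qF where q: "qA \<in> A" "qF \<in> F"
    using face_nonempty AF FF by blast
  have "connected_component (- T) qA qF"
  proof (rule faces_connected_through[OF _ _ _ AF _ q(1) FF _ q(2)])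
    show "connected (?\<gamma> ` {j1<..<j2})"
      using j by (intro connected_curve_image[OF e]) auto
    have "{r1<..<r2} \<subseteq> {j1<..<j2}" using r(4) by blast
    then show "closure A \<inter> ?\<gamma> ` {j1<..<j2} \<noteq> {}"
      using A unfolding arc_faces_def by blast
    show "closure F \<inter> ?\<gamma> ` {j1<..<j2} \<noteq> {}"
      using t j(4) by blast
  qed (auto simp: T_def)
  moreover have "connected_component (- S) qA qF"
  proof -
    have "connected (- S)"
      unfolding S_def using connected_compl_subarc[OF e] s by auto
    moreover have "qA \<in> - S" "qF \<in> - S"
      using q SX face_disjoint[OF AF] face_disjoint[OF FF] by auto
    ultimately show ?thesis
      unfolding connected_component_def by blast
  qed
  ultimately have cc: "connected_component (- (S \<union> T)) qA qF"
    using Janiszewski[OF cS clT] ST by simp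
  let ?W = "connected_component_set (- (S \<union> T)) qA"
  have "(face qA \<in> arc_faces e a b) = (face qF \<in> arc_faces e a b)"
  proof (rule face_function_constant[of ?W "\<lambda>F. F \<in> arc_faces e a b"])
    show "open ?W"
      by (intro open_connected_component open_Compl closed_Un clT compact_imp_closed[OF cS])
    show "connected ?W" by simp
    have "qA \<in> - (S \<union> T)" using cc connected_component_in by blast
    then show "qA \<in> ?W - ?X" "qF \<in> ?W - ?X"
      using cc q face_disjoint[OF AF] face_disjoint[OF FF] by auto
    fix y assume y: "y \<in> ?W \<inter> ?X"
    then have "y \<notin> S \<union> T" using connected_component_in by fastforce
    then have "y \<in> ?\<gamma> ` ({j1<..<j2} - {s1..s2})"
      using y by (auto simp: S_def T_def)
    then have "y \<in> ?\<gamma> ` {r1<..<r2}" using r(4) by simp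
    then have "y \<in> ?\<gamma> ` {a<..<b}" using r by auto
    then show "\<exists>e' a' b'. e' \<in> edges G \<and> 0 \<le> a' \<and> b' \<le> 1 \<and> y \<in> curve G e' ` {a'<..<b'} \<and>
        (\<forall>F\<in>arc_faces e' a' b'. \<forall>F'\<in>arc_faces e' a' b'. (F \<in> arc_faces e a b) = (F' \<in> arc_faces e a b))"
      using e ab by (intro exI[of _ e] exI[of _ a] exI[of _ b]) auto
  qed
  then show False
    using face_eqI[OF AF q(1)] face_eqI[OF FF q(2)] Aab nF by simp
qed

text \<open>This replaces following one side of an edge: a face seen at one inner point is seen all
  along the edge, up to its ends.\<close>

lemma arc_faces_eq:
  assumes "e \<in> edges G" "0 \<le> a" "a < b" "b \<le> 1"
  shows "arc_faces e a b = adjacent_faces G e"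
  using arc_faces_eq_aux[OF assms] arc_faces_mono[of 0 a b 1 e] assms adjacent_faces_eq by auto

lemma adjacent_faces_subset_faces: "adjacent_faces G e \<subseteq> faces G"
  by (auto simp: adjacent_faces_def)

text \<open>The graph is the union of the middle arc \<open>S\<close> of the edge and the rest
  \<open>T\<close>, which meet in two points. Faces at the edge are joined off \<open>T\<close>
  across the open middle arc, and \<open>S\<close> alone separates nothing, so
  \<open>at_most_two_sides\<close> rules out a third face.\<close>

lemma adjacent_faces_pair:
  assumes e: "e \<in> edges G"
  obtains F F' where "adjacent_faces G e = {F, F'}"
proof -
  let ?X = "graph_set G" and ?\<gamma> = "curve G e"
  have three: "F1 = F2 \<or> F2 = F3 \<or> F1 = F3"
    if F: "F1 \<in> adjacent_faces G e" "F2 \<in> adjacent_faces G e" "F3 \<in> adjacent_faces G e" for F1 F2 F3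
  proof -
    \<comment> \<open>The middle half stays away from both ends of the curve, so it is a proper arc
      for loop edges and circle components as well.\<close>
    define S where "S = ?\<gamma> ` {1/4..3/4}"
    define T where "T = ?X - ?\<gamma> ` {1/4<..<3/4}"
    have eqX: "S \<union> T = ?X"
    proof -
      have "?\<gamma> ` {1/4<..<3/4} \<subseteq> ?\<gamma> ` {1/4..3/4}" by (intro image_mono) auto
      moreover have "?\<gamma> ` {1/4..3/4} \<subseteq> ?X" using curve_in_graph_set[OF e] by auto
      ultimately show ?thesis unfolding S_def T_def by blast
    qed
    have FF: "F1 \<in> faces G" "F2 \<in> faces G" "F3 \<in> faces G"
      using F adjacent_faces_subset_faces by auto
    have fa: "F1 \<in> arc_faces e (1/4) (3/4)" "F2 \<in> arc_faces e (1/4) (3/4)" "F3 \<in> arc_faces e (1/4) (3/4)"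
      using F arc_faces_eq[OF e, of "1/4" "3/4"] by auto
    obtain q1 q2 q3 where q: "q1 \<in> F1" "q2 \<in> F2" "q3 \<in> F3"
      using face_nonempty[OF FF(1)] face_nonempty[OF FF(2)] face_nonempty[OF FF(3)] by blast
    have clT: "closed T"
      unfolding T_def by (rule closed_graph_set_diff[OF e]) auto
    have cT: "compact T"
      using compact_Int_closed[OF compact_graph_set clT] by (simp add: T_def Int_absorb1)
    have cS: "compact S"
      unfolding S_def by (intro compact_curve_image[OF e]) auto
    have ST: "S \<inter> T = {?\<gamma> (1/4), ?\<gamma> (3/4)}"
    proof
      have "{1/4..3/4} = insert (1/4) (insert (3/4) {1/4<..<3/4::real})" by auto
      then show "S \<inter> T \<subseteq> {?\<gamma> (1/4), ?\<gamma> (3/4)}"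
        unfolding S_def T_def by auto
      have "?\<gamma> s \<notin> ?\<gamma> ` {1/4<..<3/4}" if "s = 1/4 \<or> s = 3/4" for s
      proof
        assume "?\<gamma> s \<in> ?\<gamma> ` {1/4<..<3/4}"
        then obtain s' where s': "s' \<in> {1/4<..<3/4}" "?\<gamma> s' = ?\<gamma> s" by auto
        then have "s' = s" using curve_eqD[OF e, of s' s] that by auto
        then show False using s' that by auto
      qed
      then show "{?\<gamma> (1/4), ?\<gamma> (3/4)} \<subseteq> S \<inter> T"
        using curve_in_graph_set[OF e] by (auto simp: S_def T_def)
    qed
    have c1: "connected_component (- T) z z'"
      if "F \<in> faces G" "F' \<in> faces G" "F \<in> arc_faces e (1/4) (3/4)" "F' \<in> arc_faces e (1/4) (3/4)"
         "z \<in> F" "z' \<in> F'" for F F' z z'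
    proof (rule faces_connected_through[OF _ _ _ that(1) _ that(5) that(2) _ that(6)])
      show "connected (?\<gamma> ` {1/4<..<3/4})"
        by (intro connected_curve_image[OF e]) auto
    qed (use that in \<open>auto simp: T_def arc_faces_def\<close>)
    have conS: "connected (- S)"
      unfolding S_def by (rule connected_compl_subarc[OF e]) auto
    have c2: "connected_component (- S) z z'"
      if "F \<in> faces G" "F' \<in> faces G" "z \<in> F" "z' \<in> F'" for F F' z z'
    proof -
      have "z \<in> - S" "z' \<in> - S"
        using that face_disjoint[OF that(1)] face_disjoint[OF that(2)] eqX by auto
      then show ?thesis
        using conS unfolding connected_component_def by blast
    qed
    have "connected_component (- (S \<union> T)) q1 q2 \<or> connected_component (- (S \<union> T)) q2 q3 \<or>
         connected_component (- (S \<union> T)) q1 q3"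
      using FF fa q by (intro at_most_two_sides[OF cT cS ST] c1[of F1 F2] c1[of F2 F3] c2[of F1 F2] c2[of F2 F3])
    then show ?thesis
      unfolding eqX using face_connected_componentD[of q1 q2] face_connected_componentD[of q2 q3]
        face_connected_componentD[of q1 q3] face_eqI[OF FF(1) q(1)] face_eqI[OF FF(2) q(2)] face_eqI[OF FF(3) q(3)]
      by auto
  qed
  have "adjacent_faces G e \<noteq> {}"
    using arc_faces_nonempty[OF e, of 0 1] adjacent_faces_eq[OF e] by simp
  then obtain F where F: "F \<in> adjacent_faces G e" by blast
  show thesis
  proof (cases "adjacent_faces G e = {F}")
    case True
    then show thesis using that[of F F] by simp
  next
    case False
    then obtain F' where "F' \<in> adjacent_faces G e" "F' \<noteq> F" using F by blast
    then have "adjacent_faces G e = {F, F'}"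
      using three[OF F] \<open>F' \<in> adjacent_faces G e\<close> F by blast
    then show thesis by (rule that)
  qed
qed

text \<open>This is connectedness of the dual graph: a finite set does not disconnect the plane, and
  off that set the graph is met only at inner points of edges.\<close>

lemma face_function_constant_all:
  fixes c :: "complex set \<Rightarrow> 'v"
  assumes "\<And>e F F'. e \<in> edges G \<Longrightarrow> F \<in> adjacent_faces G e \<Longrightarrow> F' \<in> adjacent_faces G e \<Longrightarrow> c F = c F'"
    and F: "F \<in> faces G" "F' \<in> faces G"
  shows "c F = c F'"
proof -
  \<comment> \<open>The curve ends are listed besides the vertices because the starting point of a
    circle component is neither a vertex nor an inner point.\<close>
  let ?P = "verts G \<union> (\<Union>e\<in>edges G. {curve G e 0, curve G e 1})"
  have fin: "finite ?P" using finite_verts finite_edges by auto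
  obtain y z where yz: "y \<in> F" "z \<in> F'" using face_nonempty[OF F(1)] face_nonempty[OF F(2)] by blast
  have "c (face y) = c (face z)"
  proof (rule face_function_constant[of "- ?P" c])
    show "open (- ?P)" using fin by (simp only: open_Compl finite_imp_closed)
    show "connected (- ?P)"
      using fin by (intro path_connected_imp_connected path_connected_complement_countable countable_finite) auto
    have PX: "?P \<subseteq> graph_set G"
      using curve_in_graph_set[of _ 0] curve_in_graph_set[of _ 1] by (auto simp: graph_set_def[of G])
    then show "y \<in> - ?P - graph_set G" "z \<in> - ?P - graph_set G"
      using face_disjoint[OF F(1)] face_disjoint[OF F(2)] yz by blast+
    fix x assume x: "x \<in> - ?P \<inter> graph_set G"
    then have "x \<in> graph_set G" by simp
    then obtain e t where et: "e \<in> edges G" "t \<in> {0..1}" "x = curve G e t"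
      using x by (cases rule: graph_setE) auto
    then have "t \<noteq> 0" "t \<noteq> 1" using x by auto
    then have "x \<in> curve G e ` {0<..<1}" using et by auto
    then show "\<exists>e a b. e \<in> edges G \<and> 0 \<le> a \<and> b \<le> 1 \<and> x \<in> curve G e ` {a<..<b} \<and>
        (\<forall>F\<in>arc_faces e a b. \<forall>F'\<in>arc_faces e a b. c F = c F')"
      using assms(1)[OF et(1)] et(1) unfolding adjacent_faces_eq[OF et(1)]
      by (intro exI[of _ e] exI[of _ 0] exI[of _ 1] conjI ballI) (assumption | simp)+
  qed
  then show ?thesis using face_eqI F yz by auto
qed

end

section \<open>The faces around a trivalent vertex\<close>

text \<open>The combinatorics at a vertex, where the three sets consist of the faces at its three
  edges. The hypotheses are what \<open>vertex_faces_meet\<close>,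
  \<open>vertex_faces_parity\<close> and \<open>vertex_not_three_equal_pairs\<close> provide; they
  leave only the pattern of three sectors, possibly with coincidences.\<close>

lemma triangle_pattern:
  assumes P: "P1 = {a1, b1}" "P2 = {a2, b2}" "P3 = {a3, b3}"
    and conn: "P1 \<inter> (P2 \<union> P3) \<noteq> {}" "P2 \<inter> (P1 \<union> P3) \<noteq> {}" "P3 \<inter> (P1 \<union> P2) \<noteq> {}"
    and par1: "\<And>A B. A \<in> P1 \<Longrightarrow> B \<in> P1 \<Longrightarrow> A \<noteq> B \<Longrightarrow> A \<in> P2 \<and> P2 \<noteq> {A} \<or> A \<in> P3 \<and> P3 \<noteq> {A}"
    and par2: "\<And>A B. A \<in> P2 \<Longrightarrow> B \<in> P2 \<Longrightarrow> A \<noteq> B \<Longrightarrow> A \<in> P1 \<and> P1 \<noteq> {A} \<or> A \<in> P3 \<and> P3 \<noteq> {A}"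
    and par3: "\<And>A B. A \<in> P3 \<Longrightarrow> B \<in> P3 \<Longrightarrow> A \<noteq> B \<Longrightarrow> A \<in> P1 \<and> P1 \<noteq> {A} \<or> A \<in> P2 \<and> P2 \<noteq> {A}"
    and no3: "\<And>A B. P1 = {A, B} \<Longrightarrow> P2 = {A, B} \<Longrightarrow> P3 = {A, B} \<Longrightarrow> A = B"
  obtains F1 F2 F3 where "P1 = {F2, F3}" "P2 = {F3, F1}" "P3 = {F1, F2}"
proof -
  have pe: "{x, y} = {y, x}" for x y by auto
  have p1: "a1 = b1 \<or> ((a1 = a2 \<or> a1 = b2) \<and> a2 \<noteq> b2 \<or> (a1 = a3 \<or> a1 = b3) \<and> a3 \<noteq> b3) \<and>
      ((b1 = a2 \<or> b1 = b2) \<and> a2 \<noteq> b2 \<or> (b1 = a3 \<or> b1 = b3) \<and> a3 \<noteq> b3)"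
    using par1[of a1 b1] par1[of b1 a1] unfolding P by auto
  have p2: "a2 = b2 \<or> ((a2 = a1 \<or> a2 = b1) \<and> a1 \<noteq> b1 \<or> (a2 = a3 \<or> a2 = b3) \<and> a3 \<noteq> b3) \<and>
      ((b2 = a1 \<or> b2 = b1) \<and> a1 \<noteq> b1 \<or> (b2 = a3 \<or> b2 = b3) \<and> a3 \<noteq> b3)"
    using par2[of a2 b2] par2[of b2 a2] unfolding P by auto
  have p3: "a3 = b3 \<or> ((a3 = a1 \<or> a3 = b1) \<and> a1 \<noteq> b1 \<or> (a3 = a2 \<or> a3 = b2) \<and> a2 \<noteq> b2) \<and>
      ((b3 = a1 \<or> b3 = b1) \<and> a1 \<noteq> b1 \<or> (b3 = a2 \<or> b3 = b2) \<and> a2 \<noteq> b2)"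
    using par3[of a3 b3] par3[of b3 a3] unfolding P by auto
  have c: "a1 = a2 \<or> a1 = b2 \<or> b1 = a2 \<or> b1 = b2 \<or> a1 = a3 \<or> a1 = b3 \<or> b1 = a3 \<or> b1 = b3"
    "a1 = a2 \<or> a1 = b2 \<or> b1 = a2 \<or> b1 = b2 \<or> a2 = a3 \<or> a2 = b3 \<or> b2 = a3 \<or> b2 = b3"
    "a3 = a2 \<or> a3 = b2 \<or> b3 = a2 \<or> b3 = b2 \<or> a1 = a3 \<or> a1 = b3 \<or> b1 = a3 \<or> b1 = b3"
    using conn unfolding P by auto
  have n: "a1 = b1 \<or> \<not> ((a2 = a1 \<and> b2 = b1 \<or> a2 = b1 \<and> b2 = a1) \<and> (a3 = a1 \<and> b3 = b1 \<or> a3 = b1 \<and> b3 = a1))"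
    using no3[of a1 b1] unfolding P doubleton_eq_iff by blast
  have "\<exists>F1 F2 F3. {a1, b1} = {F2, F3} \<and> {a2, b2} = {F3, F1} \<and> {a3, b3} = {F1, F2}"
  proof -
    have "\<exists>F1\<in>{a1,b1,a2,b2,a3,b3}. \<exists>F2\<in>{a1,b1}. \<exists>F3\<in>{a1,b1}. {a1, b1} = {F2, F3} \<and> {a2, b2} = {F3, F1} \<and> {a3, b3} = {F1, F2}"
      using p1 p2 p3 c n unfolding doubleton_eq_iff by (simp only: bex_simps insert_iff) (smt (verit, best))
    then show ?thesis by blast
  qed
  then show thesis
    using that unfolding P by blast
qed

section \<open>The arms of the edges at a vertex\<close>

context plane_graph
begin

text \<open>An arm is the third of an edge next to one of its ends. Thirds keep the two arms of a
  loop edge apart except at the vertex.\<close>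

definition arm_low :: "real \<Rightarrow> real" where "arm_low i = (if i = 0 then 0 else 2/3)"
definition arm_high :: "real \<Rightarrow> real" where "arm_high i = (if i = 0 then 1/3 else 1)"

definition arm :: "'e \<times> real \<Rightarrow> complex set" where
  "arm h = curve G (fst h) ` {arm_low (snd h)..arm_high (snd h)}"

definition open_arm :: "'e \<times> real \<Rightarrow> complex set" where
  "open_arm h = curve G (fst h) ` {arm_low (snd h)<..<arm_high (snd h)}"

definition arm_tip :: "'e \<times> real \<Rightarrow> complex" where
  "arm_tip h = curve G (fst h) (if snd h = 0 then 1/3 else 2/3)"

text \<open>The tips at 1/3 and 2/3 are kept, so the remaining parameters form a closed set and an
  arm meets the rest of the graph exactly in its tip.\<close>

definition outer_part :: "complex \<Rightarrow> 'e \<Rightarrow> real set" where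
  "outer_part v e = {t \<in> {0..1}. ((e, 0) \<in> ends_at G v \<longrightarrow> 1/3 \<le> t) \<and> ((e, 1) \<in> ends_at G v \<longrightarrow> t \<le> 2/3)}"

definition outside_arms :: "complex \<Rightarrow> complex set" where
  "outside_arms v = (verts G - {v}) \<union> (\<Union>e\<in>edges G. curve G e ` outer_part v e)"

lemma ends_atD:
  assumes "h \<in> ends_at G v"
  shows "fst h \<in> edges G" "snd h = 0 \<or> snd h = 1" "curve G (fst h) (snd h) = v"
  using assms by (auto simp: ends_at_def)

lemma arm_bounds:
  assumes "h \<in> ends_at G v"
  shows "0 \<le> arm_low (snd h)" "arm_low (snd h) < arm_high (snd h)" "arm_high (snd h) \<le> 1"
    "arm_high (snd h) - arm_low (snd h) < 1"
  using ends_atD(2)[OF assms] by (auto simp: arm_low_def arm_high_def)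

lemma arm_eq:
  assumes h: "h \<in> ends_at G v"
  shows "arm h = insert v (insert (arm_tip h) (open_arm h))"
proof -
  have "{0..1/3} = insert 0 (insert (1/3) {0<..<1/3::real})" "{2/3..1} = insert 1 (insert (2/3) {2/3<..<1::real})"
    by auto
  then have "{arm_low (snd h)..arm_high (snd h)} =
      insert (snd h) (insert (if snd h = 0 then 1/3 else 2/3) {arm_low (snd h)<..<arm_high (snd h)})"
    using ends_atD(2)[OF h] unfolding arm_low_def arm_high_def by force
  then show ?thesis
    using ends_atD(3)[OF h] unfolding arm_def open_arm_def arm_tip_def by (simp only: image_insert)
qed

lemma armE:
  assumes h: "h \<in> ends_at G v" and x: "x \<in> arm h" "x \<noteq> v"
  obtains s where "s \<in> {0<..<1}" "s \<in> {arm_low (snd h)..arm_high (snd h)}" "x = curve G (fst h) s"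
proof -
  obtain s where s: "s \<in> {arm_low (snd h)..arm_high (snd h)}" "x = curve G (fst h) s"
    using x(1) unfolding arm_def by blast
  then have "s \<noteq> snd h" using x(2) ends_atD(3)[OF h] by auto
  then have "s \<in> {0<..<1}"
    using s(1) ends_atD(2)[OF h] by (auto simp: arm_low_def arm_high_def split: if_splits)
  with s show thesis using that by blast
qed

lemma compact_outside_arms: "compact (outside_arms v)"
proof -
  have "compact (curve G e ` outer_part v e)" if e: "e \<in> edges G" for e
  proof (rule compact_curve_image[OF e])
    have "outer_part v e = {0..1} \<inter> (if (e, 0) \<in> ends_at G v then {1/3..} else UNIV)
        \<inter> (if (e, 1) \<in> ends_at G v then {..2/3} else UNIV)"
      by (auto simp: outer_part_def)
    then show "compact (outer_part v e)"
      by (simp add: compact_Int_closed)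
  qed (auto simp: outer_part_def)
  then have "compact (\<Union>e\<in>edges G. curve G e ` outer_part v e)"
    by (rule compact_UN[OF finite_edges])
  moreover have "compact (verts G - {v})"
    using finite_verts by (simp add: finite_imp_compact)
  ultimately show ?thesis
    unfolding outside_arms_def by (rule compact_Un[rotated])
qed

lemma outside_arms_subset: "outside_arms v \<subseteq> graph_set G"
  using curve_in_graph_set by (auto simp: outside_arms_def outer_part_def graph_set_def[of G])

lemma vertex_notin_outside_arms:
  assumes "v \<in> verts G" shows "v \<notin> outside_arms v"
proof
  assume "v \<in> outside_arms v"
  then obtain e t where e: "e \<in> edges G" "t \<in> outer_part v e" "v = curve G e t"
    by (auto simp: outside_arms_def)
  then have "t \<in> {0..1}" by (simp add: outer_part_def)
  moreover have "t \<notin> {0<..<1}" using curve_not_vertex[OF e(1)] assms e(3) by auto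
  ultimately have "t = 0 \<or> t = 1" by auto
  then show False
    using e by (auto simp: outer_part_def ends_at_def)
qed

lemma graph_set_arms:
  assumes "ends_at G v \<noteq> {}"
  shows "graph_set G = outside_arms v \<union> (\<Union>h\<in>ends_at G v. arm h)"
proof
  have "arm h \<subseteq> graph_set G" if h: "h \<in> ends_at G v" for h
    using curve_in_graph_set[OF ends_atD(1)[OF h]] arm_bounds[OF h] by (auto simp: arm_def)
  then show "outside_arms v \<union> (\<Union>h\<in>ends_at G v. arm h) \<subseteq> graph_set G"
    using outside_arms_subset by blast
  show "graph_set G \<subseteq> outside_arms v \<union> (\<Union>h\<in>ends_at G v. arm h)"
  proof
    fix x assume "x \<in> graph_set G"
    then show "x \<in> outside_arms v \<union> (\<Union>h\<in>ends_at G v. arm h)"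
    proof (cases rule: graph_setE)
      case 1
      show ?thesis
      proof (cases "x = v")
        case True
        then show ?thesis using assms arm_eq by blast
      next
        case False
        then show ?thesis using 1 by (auto simp: outside_arms_def)
      qed
    next
      case (2 e t)
      show ?thesis
      proof (cases "t \<in> outer_part v e")
        case True
        then show ?thesis using 2 unfolding outside_arms_def by blast
      next
        case False
        then have "(e, 0) \<in> ends_at G v \<and> t \<in> {0..1/3} \<or> (e, 1) \<in> ends_at G v \<and> t \<in> {2/3..1}"
          using 2(2) by (auto simp: outer_part_def)
        then have "\<exists>i. (e, i) \<in> ends_at G v \<and> t \<in> {arm_low i..arm_high i}"
        proof
          assume "(e, 0) \<in> ends_at G v \<and> t \<in> {0..1/3}"
          then show ?thesis by (intro exI[of _ 0]) (simp add: arm_low_def arm_high_def)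
        next
          assume "(e, 1) \<in> ends_at G v \<and> t \<in> {2/3..1}"
          then show ?thesis by (intro exI[of _ 1]) (simp add: arm_low_def arm_high_def)
        qed
        then obtain i where i: "(e, i) \<in> ends_at G v" "t \<in> {arm_low i..arm_high i}" by blast
        then have "x \<in> arm (e, i)" using 2(3) by (auto simp: arm_def)
        then show ?thesis using i(1) by blast
      qed
    qed
  qed
qed

lemma arm_Int_outside:
  assumes v: "v \<in> verts G" and h: "h \<in> ends_at G v"
  shows "arm h \<inter> outside_arms v = {arm_tip h}" "open_arm h \<inter> outside_arms v = {}"
proof -
  note e = ends_atD(1)[OF h]
  show op: "open_arm h \<inter> outside_arms v = {}"
  proof (rule ccontr)
    assume "open_arm h \<inter> outside_arms v \<noteq> {}"
    then obtain s where s: "s \<in> {arm_low (snd h)<..<arm_high (snd h)}" "curve G (fst h) s \<in> outside_arms v"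
      unfolding open_arm_def by blast
    then have s': "s \<in> {0<..<1}" using arm_bounds[OF h] by auto
    have "curve G (fst h) s \<notin> verts G" using curve_not_vertex[OF e s'] .
    then obtain e' t where t: "e' \<in> edges G" "t \<in> outer_part v e'" "curve G (fst h) s = curve G e' t"
      using s(2) by (auto simp: outside_arms_def)
    then have t01: "t \<in> {0..1}" by (simp add: outer_part_def)
    have "e' = fst h"
      using distinct_curves_meet[OF e t(1) _ _ t01 t(3)] s' curve_not_vertex[OF e s'] by auto
    then have "s = t" using curve_eqD[OF e s' t01] t(3) by simp
    then show False
      using t(2) s(1) h ends_atD(2)[OF h] \<open>e' = fst h\<close>
      by (cases h) (auto simp: outer_part_def arm_low_def arm_high_def)
  qed
  have "arm_tip h \<in> outside_arms v"
  proof -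
    have "(if snd h = 0 then 1/3 else 2/3) \<in> outer_part v (fst h)"
      by (auto simp: outer_part_def)
    then show ?thesis using e unfolding outside_arms_def arm_tip_def by blast
  qed
  then show "arm h \<inter> outside_arms v = {arm_tip h}"
    using op vertex_notin_outside_arms[OF v] unfolding arm_eq[OF h] by blast
qed

lemma arm_Int_arm:
  assumes v: "v \<in> verts G" and h: "h \<in> ends_at G v" and h': "h' \<in> ends_at G v" and ne: "h \<noteq> h'"
  shows "arm h \<inter> arm h' = {v}"
proof
  show "{v} \<subseteq> arm h \<inter> arm h'"
    using arm_eq[OF h] arm_eq[OF h'] by simp
  show "arm h \<inter> arm h' \<subseteq> {v}"
  proof (rule subsetI, rule ccontr)
    fix x assume x: "x \<in> arm h \<inter> arm h'" "x \<notin> {v}"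
    obtain s where s: "s \<in> {0<..<1}" "s \<in> {arm_low (snd h)..arm_high (snd h)}" "x = curve G (fst h) s"
      using armE[OF h, of x] x by auto
    obtain s' where s': "s' \<in> {0<..<1}" "s' \<in> {arm_low (snd h')..arm_high (snd h')}" "x = curve G (fst h') s'"
      using armE[OF h', of x] x by auto
    have e: "fst h = fst h'"
      using distinct_curves_meet[OF ends_atD(1)[OF h] ends_atD(1)[OF h'], of s s'] s s'
        curve_not_vertex[OF ends_atD(1)[OF h] s(1)] by auto
    then have "s = s'" using curve_eqD[OF ends_atD(1)[OF h] s(1), of s'] s' s(3) by simp
    moreover have "snd h \<noteq> snd h'" using ne e by (auto simp: prod_eq_iff)
    ultimately show False
      using s(2) s'(2) ends_atD(2)[OF h] ends_atD(2)[OF h'] by (auto simp: arm_low_def arm_high_def)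
  qed
qed

lemma arc_faces_arm:
  assumes "h \<in> ends_at G v"
  shows "arc_faces (fst h) (arm_low (snd h)) (arm_high (snd h)) = adjacent_faces G (fst h)"
  by (rule arc_faces_eq[OF ends_atD(1)[OF assms] arm_bounds(1-3)[OF assms]])

lemma adjacent_face_meets_open_arm:
  assumes "h \<in> ends_at G v" "F \<in> adjacent_faces G (fst h)"
  shows "closure F \<inter> open_arm h \<noteq> {}"
  using assms(2) unfolding arc_faces_arm[OF assms(1), symmetric] by (simp add: arc_faces_def open_arm_def)

lemma arm_compact_connected:
  assumes h: "h \<in> ends_at G v"
  shows "compact (arm h)" "connected (arm h)" "connected (open_arm h)" "connected (- arm h)"
proof -
  have "{arm_low (snd h)..arm_high (snd h)} \<subseteq> {0..1}" "{arm_low (snd h)<..<arm_high (snd h)} \<subseteq> {0..1}"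
    using arm_bounds[OF h] by auto
  then show "compact (arm h)" "connected (arm h)" "connected (open_arm h)"
    unfolding arm_def open_arm_def
    by (auto intro: compact_curve_image[OF ends_atD(1)[OF h]] connected_curve_image[OF ends_atD(1)[OF h]])
  show "connected (- arm h)"
    unfolding arm_def by (rule connected_compl_subarc[OF ends_atD(1)[OF h] arm_bounds[OF h]])
qed

text \<open>Since the face touches every subarc of the edge, it touches those that shrink to the
  vertex.\<close>

lemma face_near_vertex:
  assumes h: "h \<in> ends_at G v" and F: "F \<in> adjacent_faces G (fst h)" and r: "r > 0"
  shows "F \<inter> ball v r \<noteq> {}"
proof -
  note e = ends_atD(1)[OF h]
  have i: "snd h \<in> {0..1}" using ends_atD(2)[OF h] by auto
  have "(curve G (fst h) \<longlongrightarrow> v) (at (snd h) within {0..1})"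
    using continuous_on_curve[OF e order_refl] i ends_atD(3)[OF h] by (metis continuous_on_def)
  then have "\<forall>\<^sub>F t in at (snd h) within {0..1}. dist (curve G (fst h) t) v < r"
    using r by (rule tendstoD)
  then obtain d where d: "d > 0" "\<And>t. t \<in> {0..1} \<Longrightarrow> t \<noteq> snd h \<Longrightarrow> dist t (snd h) < d \<Longrightarrow> dist (curve G (fst h) t) v < r"
    unfolding eventually_at by auto
  obtain a b where ab: "0 \<le> a" "a < b" "b \<le> 1" "\<And>t. t \<in> {a<..<b} \<Longrightarrow> t \<in> {0..1} \<and> t \<noteq> snd h \<and> dist t (snd h) < d"
  proof (cases "snd h = 0")
    case True
    show thesis
      by (rule that[of 0 "min d 1"]) (use True d(1) in \<open>auto simp: dist_real_def\<close>)
  next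
    case False
    then have "snd h = 1" using ends_atD(2)[OF h] by simp
    then show thesis
      by (intro that[of "max (1 - d) 0" 1]) (use d(1) in \<open>auto simp: dist_real_def\<close>)
  qed
  have "F \<in> arc_faces (fst h) a b"
    using arc_faces_eq[OF e ab(1-3)] F by simp
  then obtain t where t: "t \<in> {a<..<b}" "curve G (fst h) t \<in> closure F"
    unfolding arc_faces_def by blast
  then have "curve G (fst h) t \<in> ball v r"
    using d(2)[of t] ab(4)[OF t(1)] by (simp add: dist_commute)
  then show ?thesis
    using t(2) open_Int_closure_eq_empty[OF open_ball, of v r F] by blast
qed

lemma open_arm_colouring:
  assumes h: "h \<in> ends_at G v" and x: "x \<in> open_arm h"
    and c: "\<And>F F'. F \<in> adjacent_faces G (fst h) \<Longrightarrow> F' \<in> adjacent_faces G (fst h) \<Longrightarrow> c F = c F'"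
  shows "\<exists>e a b. e \<in> edges G \<and> 0 \<le> a \<and> b \<le> 1 \<and> x \<in> curve G e ` {a<..<b} \<and>
        (\<forall>F\<in>arc_faces e a b. \<forall>F'\<in>arc_faces e a b. c F = c F')"
proof (rule exI[of _ "fst h"], rule exI[of _ "arm_low (snd h)"], rule exI[of _ "arm_high (snd h)"], intro conjI ballI)
  show "x \<in> curve G (fst h) ` {arm_low (snd h)<..<arm_high (snd h)}"
    using x by (simp add: open_arm_def)
  fix F F'
  assume "F \<in> arc_faces (fst h) (arm_low (snd h)) (arm_high (snd h))"
    "F' \<in> arc_faces (fst h) (arm_low (snd h)) (arm_high (snd h))"
  then show "c F = c F'"
    unfolding arc_faces_arm[OF h] by (rule c)
qed (use arm_bounds[OF h] ends_atD(1)[OF h] in simp_all)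

lemma adjacent_faces_nonempty: "e \<in> edges G \<Longrightarrow> adjacent_faces G e \<noteq> {}"
  by (erule adjacent_faces_pair) simp

text \<open>Otherwise a walk around \<open>v\<close>, in a punctured ball that meets only the arms,
  could never leave the faces of \<open>h\<close>: crossing \<open>h\<close> stays among them, and
  the other edges do not touch them. But the faces of \<open>h0\<close> also come close to
  \<open>v\<close>.\<close>

lemma vertex_faces_meet:
  assumes v: "v \<in> verts G" and h: "h \<in> ends_at G v" and h0: "h0 \<in> ends_at G v"
    and disj: "\<And>h'. h' \<in> ends_at G v \<Longrightarrow> h' \<noteq> h \<Longrightarrow> adjacent_faces G (fst h) \<inter> adjacent_faces G (fst h') = {}"
  shows "h0 = h"
proof (rule ccontr)
  assume ne: "h0 \<noteq> h"
  obtain F where F: "F \<in> adjacent_faces G (fst h)"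
    using adjacent_faces_nonempty[OF ends_atD(1)[OF h]] by blast
  obtain F' where F': "F' \<in> adjacent_faces G (fst h0)"
    using adjacent_faces_nonempty[OF ends_atD(1)[OF h0]] by blast
  have FF: "F \<in> faces G" "F' \<in> faces G"
    using F F' adjacent_faces_subset_faces by blast+
  have "open (- outside_arms v)" "v \<in> - outside_arms v"
    using compact_outside_arms vertex_notin_outside_arms[OF v] by (auto simp: open_Compl compact_imp_closed)
  then obtain r where r: "r > 0" "ball v r \<subseteq> - outside_arms v"
    using open_contains_ball by metis
  obtain y z where yz: "y \<in> F \<inter> ball v r" "z \<in> F' \<inter> ball v r"
    using face_near_vertex[OF h F r(1)] face_near_vertex[OF h0 F' r(1)] by blast
  have vX: "v \<in> graph_set G" using v by (simp add: graph_set_def)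
  have off: "y \<notin> graph_set G" "z \<notin> graph_set G"
    using yz face_disjoint[OF FF(1)] face_disjoint[OF FF(2)] by blast+
  have "(face y \<in> adjacent_faces G (fst h)) = (face z \<in> adjacent_faces G (fst h))"
  proof (rule face_function_constant[of "ball v r - {v}" "\<lambda>F. F \<in> adjacent_faces G (fst h)"])
    show "open (ball v r - {v})" by (simp add: open_delete)
    show "connected (ball v r - {v})" by (rule connected_punctured_ball) simp
    show "y \<in> ball v r - {v} - graph_set G" "z \<in> ball v r - {v} - graph_set G"
      using yz off vX by auto
    fix x assume x: "x \<in> (ball v r - {v}) \<inter> graph_set G"
    then have "x \<notin> outside_arms v" "x \<noteq> v" using r(2) by auto
    then obtain h' where h': "h' \<in> ends_at G v" "x \<in> arm h'"
      using x graph_set_arms h by blast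
    then have "x \<in> open_arm h'"
      using \<open>x \<notin> outside_arms v\<close> \<open>x \<noteq> v\<close> arm_Int_outside[OF v h'(1)] unfolding arm_eq[OF h'(1)] by blast
    then show "\<exists>e a b. e \<in> edges G \<and> 0 \<le> a \<and> b \<le> 1 \<and> x \<in> curve G e ` {a<..<b} \<and>
        (\<forall>F\<in>arc_faces e a b. \<forall>F'\<in>arc_faces e a b. (F \<in> adjacent_faces G (fst h)) = (F' \<in> adjacent_faces G (fst h)))"
    proof (rule open_arm_colouring[OF h'(1)])
      fix F F' assume "F \<in> adjacent_faces G (fst h')" "F' \<in> adjacent_faces G (fst h')"
      then show "(F \<in> adjacent_faces G (fst h)) = (F' \<in> adjacent_faces G (fst h))"
        using disj[OF h'(1)] by (cases "h' = h") auto
    qed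
  qed
  then have "F' \<in> adjacent_faces G (fst h)"
    using face_eqI[OF FF(1)] face_eqI[OF FF(2)] yz F by auto
  then show False
    using disj[OF h0 ne] F' by blast
qed

text \<open>The arm of \<open>h\<close> meets \<open>outside_arms v\<close> only in its tip, so by
  Janiszewski's theorem \<open>A\<close> and \<open>B\<close> are joined by a passage that crosses
  only the other arms. If each of these avoided \<open>A\<close> or had only \<open>A\<close> along
  it, the passage could not leave \<open>A\<close>.\<close>

lemma vertex_faces_parity:
  assumes v: "v \<in> verts G" and h: "h \<in> ends_at G v"
    and AB: "A \<in> adjacent_faces G (fst h)" "B \<in> adjacent_faces G (fst h)" "A \<noteq> B"
  shows "\<exists>h'\<in>ends_at G v. h' \<noteq> h \<and> A \<in> adjacent_faces G (fst h') \<and> adjacent_faces G (fst h') \<noteq> {A}"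
proof (rule ccontr)
  assume "\<not> ?thesis"
  then have other: "\<And>h'. h' \<in> ends_at G v \<Longrightarrow> h' \<noteq> h \<Longrightarrow> A \<notin> adjacent_faces G (fst h') \<or> adjacent_faces G (fst h') = {A}"
    by blast
  have FF: "A \<in> faces G" "B \<in> faces G"
    using AB adjacent_faces_subset_faces by blast+
  obtain y z where yz: "y \<in> A" "z \<in> B"
    using face_nonempty[OF FF(1)] face_nonempty[OF FF(2)] by blast
  have off: "y \<notin> graph_set G" "z \<notin> graph_set G"
    using yz face_disjoint[OF FF(1)] face_disjoint[OF FF(2)] by blast+
  have armX: "arm h \<subseteq> graph_set G" using graph_set_arms h by blast
  have 1: "connected_component (- outside_arms v) y z"
    by (rule faces_connected_through[OF arm_compact_connected(3)[OF h] arm_Int_outside(2)[OF v h] outside_arms_subset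
        FF(1) adjacent_face_meets_open_arm[OF h AB(1)] yz(1) FF(2) adjacent_face_meets_open_arm[OF h AB(2)] yz(2)])
  have "y \<in> - arm h" "z \<in> - arm h"
    using off armX by blast+
  then have 2: "connected_component (- arm h) y z"
    using arm_compact_connected(4)[OF h] unfolding connected_component_def by blast
  have cc: "connected_component (- (arm h \<union> outside_arms v)) y z"
    using Janiszewski[OF arm_compact_connected(1)[OF h] compact_imp_closed[OF compact_outside_arms] _ 2 1]
      arm_Int_outside(1)[OF v h] by simp
  let ?W = "connected_component_set (- (arm h \<union> outside_arms v)) y"
  have "(face y = A) = (face z = A)"
  proof (rule face_function_constant[of ?W "\<lambda>F. F = A"])
    show "open ?W"
      by (intro open_connected_component open_Compl closed_Un compact_imp_closed arm_compact_connected(1)[OF h] compact_outside_arms)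
    show "connected ?W" by simp
    have "y \<in> - (arm h \<union> outside_arms v)" using cc connected_component_in by blast
    then show "y \<in> ?W - graph_set G" "z \<in> ?W - graph_set G"
      using cc off by auto
    fix x assume x: "x \<in> ?W \<inter> graph_set G"
    then have "x \<notin> arm h \<union> outside_arms v" using connected_component_in by fastforce
    then have nx: "x \<notin> arm h" "x \<notin> outside_arms v" "x \<noteq> v" using arm_eq[OF h] by auto
    then obtain h' where h': "h' \<in> ends_at G v" "x \<in> arm h'"
      using x graph_set_arms h by blast
    then have "h' \<noteq> h" using nx by blast
    have "x \<in> open_arm h'"
      using nx h'(2) arm_Int_outside[OF v h'(1)] unfolding arm_eq[OF h'(1)] by blast
    then show "\<exists>e a b. e \<in> edges G \<and> 0 \<le> a \<and> b \<le> 1 \<and> x \<in> curve G e ` {a<..<b} \<and>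
        (\<forall>F\<in>arc_faces e a b. \<forall>F'\<in>arc_faces e a b. (F = A) = (F' = A))"
      by (rule open_arm_colouring[OF h'(1)]) (use other[OF h'(1) \<open>h' \<noteq> h\<close>] in auto)
  qed
  then show False
    using face_eqI[OF FF(1) yz(1)] face_eqI[OF FF(2) yz(2)] AB(3) by simp
qed

text \<open>If all three edges touched the same two faces, each arm could be crossed to join them
  off the other two arms and the rest. Then \<open>tripod_not_separating\<close> joins them in the
  complement of the whole graph.\<close>

lemma vertex_not_three_equal_pairs:
  assumes v: "v \<in> verts G" and E: "ends_at G v = {h1, h2, h3}" "h1 \<noteq> h2" "h1 \<noteq> h3" "h2 \<noteq> h3"
    and AB: "adjacent_faces G (fst h1) = {A, B}" "adjacent_faces G (fst h2) = {A, B}" "adjacent_faces G (fst h3) = {A, B}"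
  shows "A = B"
proof -
  have h: "h1 \<in> ends_at G v" "h2 \<in> ends_at G v" "h3 \<in> ends_at G v" using E by auto
  have FF: "A \<in> faces G" "B \<in> faces G"
    using AB(1) adjacent_faces_subset_faces[of "fst h1"] by auto
  obtain p q where pq: "p \<in> A" "q \<in> B"
    using face_nonempty[OF FF(1)] face_nonempty[OF FF(2)] by blast
  let ?T = "outside_arms v"
  have X: "graph_set G = ?T \<union> arm h1 \<union> arm h2 \<union> arm h3"
    using graph_set_arms[of v] E(1) by auto
  have disj: "open_arm h \<inter> arm h' = {}" if "h \<in> ends_at G v" "h' \<in> ends_at G v" "h \<noteq> h'" for h h'
  proof -
    have "v \<notin> open_arm h"
      using curve_not_vertex[OF ends_atD(1)[OF that(1)]] v arm_bounds[OF that(1)]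
      unfolding open_arm_def by fastforce
    moreover have "open_arm h \<subseteq> arm h" using arm_eq[OF that(1)] by blast
    ultimately have "open_arm h \<inter> arm h' \<subseteq> {v}" using arm_Int_arm[OF v that] by auto
    then show ?thesis using \<open>v \<notin> open_arm h\<close> by auto
  qed
  have conn: "connected_component (- (?T \<union> arm h' \<union> arm h'')) p q"
    if "h \<in> ends_at G v" "h' \<in> ends_at G v" "h'' \<in> ends_at G v" "h \<noteq> h'" "h \<noteq> h''" "adjacent_faces G (fst h) = {A, B}" for h h' h''
  proof (rule faces_connected_through[OF arm_compact_connected(3)[OF that(1)] _ _
      FF(1) adjacent_face_meets_open_arm[OF that(1)] pq(1) FF(2) adjacent_face_meets_open_arm[OF that(1)] pq(2)])
    show "open_arm h \<inter> (?T \<union> arm h' \<union> arm h'') = {}"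
      using disj[OF that(1,2,4)] disj[OF that(1,3,5)] arm_Int_outside(2)[OF v that(1)] by blast
    show "?T \<union> arm h' \<union> arm h'' \<subseteq> graph_set G"
      using that(2,3) graph_set_arms[of v] by blast
  qed (use that(6) in auto)
  have "connected_component (- (?T \<union> arm h1 \<union> arm h2 \<union> arm h3)) p q"
  proof (rule tripod_not_separating[where v=v])
    show "compact ?T" by (rule compact_outside_arms)
    show "arm h1 \<inter> arm h2 = {v}" "arm h1 \<inter> arm h3 = {v}" "arm h2 \<inter> arm h3 = {v}"
      using arm_Int_arm[OF v] h E by auto
    show "arm h1 \<inter> ?T = {arm_tip h1}" "arm h2 \<inter> ?T = {arm_tip h2}" "arm h3 \<inter> ?T = {arm_tip h3}"
      using arm_Int_outside(1)[OF v] h by auto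
    show "connected_component (- (?T \<union> arm h1 \<union> arm h2)) p q"
      using conn[OF h(3,1,2)] E AB by auto
    show "connected_component (- (?T \<union> arm h1 \<union> arm h3)) p q"
      using conn[OF h(2,1,3)] E AB by auto
    show "connected_component (- (?T \<union> arm h2 \<union> arm h3)) p q"
      using conn[OF h(1,2,3)] E AB by auto
  qed (use h arm_compact_connected in auto)
  then show ?thesis
    using face_connected_componentD[of p q] face_eqI[OF FF(1) pq(1)] face_eqI[OF FF(2) pq(2)] X by simp
qed

text \<open>Each face is numbered after the edge opposite to its sector. At a bridge or a loop edge
  some of the three coincide.\<close>

lemma trivalent_vertex_faces:
  assumes v: "v \<in> verts G" and E: "ends_at G v = {h1, h2, h3}" "h1 \<noteq> h2" "h1 \<noteq> h3" "h2 \<noteq> h3"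
  obtains F1 F2 F3 where "adjacent_faces G (fst h1) = {F2, F3}" "adjacent_faces G (fst h2) = {F3, F1}"
    "adjacent_faces G (fst h3) = {F1, F2}"
proof -
  have h: "h1 \<in> ends_at G v" "h2 \<in> ends_at G v" "h3 \<in> ends_at G v" using E by auto
  obtain a1 b1 where P1: "adjacent_faces G (fst h1) = {a1, b1}"
    by (rule adjacent_faces_pair[OF ends_atD(1)[OF h(1)]])
  obtain a2 b2 where P2: "adjacent_faces G (fst h2) = {a2, b2}"
    by (rule adjacent_faces_pair[OF ends_atD(1)[OF h(2)]])
  obtain a3 b3 where P3: "adjacent_faces G (fst h3) = {a3, b3}"
    by (rule adjacent_faces_pair[OF ends_atD(1)[OF h(3)]])
  show thesis
  proof (rule triangle_pattern[OF P1 P2 P3])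
    show "adjacent_faces G (fst h1) \<inter> (adjacent_faces G (fst h2) \<union> adjacent_faces G (fst h3)) \<noteq> {}"
      using vertex_faces_meet[OF v h(1) h(2)] E by auto
    show "adjacent_faces G (fst h2) \<inter> (adjacent_faces G (fst h1) \<union> adjacent_faces G (fst h3)) \<noteq> {}"
      using vertex_faces_meet[OF v h(2) h(1)] E by auto
    show "adjacent_faces G (fst h3) \<inter> (adjacent_faces G (fst h1) \<union> adjacent_faces G (fst h2)) \<noteq> {}"
      using vertex_faces_meet[OF v h(3) h(1)] E by auto
  next
    fix A B assume "A \<in> adjacent_faces G (fst h1)" "B \<in> adjacent_faces G (fst h1)" "A \<noteq> B"
    from vertex_faces_parity[OF v h(1) this]
    show "A \<in> adjacent_faces G (fst h2) \<and> adjacent_faces G (fst h2) \<noteq> {A} \<or>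
          A \<in> adjacent_faces G (fst h3) \<and> adjacent_faces G (fst h3) \<noteq> {A}"
      unfolding E(1) by blast
  next
    fix A B assume "A \<in> adjacent_faces G (fst h2)" "B \<in> adjacent_faces G (fst h2)" "A \<noteq> B"
    from vertex_faces_parity[OF v h(2) this]
    show "A \<in> adjacent_faces G (fst h1) \<and> adjacent_faces G (fst h1) \<noteq> {A} \<or>
          A \<in> adjacent_faces G (fst h3) \<and> adjacent_faces G (fst h3) \<noteq> {A}"
      unfolding E(1) by blast
  next
    fix A B assume "A \<in> adjacent_faces G (fst h3)" "B \<in> adjacent_faces G (fst h3)" "A \<noteq> B"
    from vertex_faces_parity[OF v h(3) this]
    show "A \<in> adjacent_faces G (fst h1) \<and> adjacent_faces G (fst h1) \<noteq> {A} \<or>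
          A \<in> adjacent_faces G (fst h2) \<and> adjacent_faces G (fst h2) \<noteq> {A}"
      unfolding E(1) by blast
  next
    fix A B assume "adjacent_faces G (fst h1) = {A, B}" "adjacent_faces G (fst h2) = {A, B}" "adjacent_faces G (fst h3) = {A, B}"
    then show "A = B" by (rule vertex_not_three_equal_pairs[OF v E])
  qed (rule that)
qed

end

section \<open>Functions on the faces with prescribed jumps\<close>

context plane_graph
begin

lemma curve_ends_in_verts:
  assumes "e \<in> edges G" "pathstart (curve G e) \<noteq> pathfinish (curve G e)"
  shows "curve G e 0 \<in> verts G" "curve G e 1 \<in> verts G" "curve G e 0 \<noteq> curve G e 1" "arc (curve G e)"
proof -
  have "pathstart (curve G e) \<in> verts G \<and> pathfinish (curve G e) \<in> verts G
          \<or> pathstart (curve G e) = pathfinish (curve G e)"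
    using plane assms(1) unfolding finite_plane_graph_def by blast
  then show "curve G e 0 \<in> verts G" "curve G e 1 \<in> verts G" "curve G e 0 \<noteq> curve G e 1"
    using assms(2) by (auto simp: pathstart_def pathfinish_def)
  show "arc (curve G e)"
    using assms simple_path_curve by (simp add: arc_simple_path)
qed

lemma vertex_on_curve:
  assumes "e \<in> edges G" "v \<in> verts G" "v \<in> path_image (curve G e)"
  shows "(e, 0) \<in> ends_at G v \<or> (e, 1) \<in> ends_at G v"
proof -
  obtain t where t: "t \<in> {0..1}" "v = curve G e t"
    using assms(3) unfolding path_image_def by blast
  then have "t \<notin> {0<..<1}" using curve_not_vertex[OF assms(1)] assms(2) by auto
  then have "t = 0 \<or> t = 1" using t(1) by auto
  then show ?thesis using t assms(1) by (auto simp: ends_at_def)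
qed

text \<open>A path through whole edges, recorded with its edge set, its last vertex and the edge-end
  by which it arrives. No other edge-end at the last vertex belongs to the trail, so leaving by
  another one always uses a new edge.\<close>

definition trail :: "(real \<Rightarrow> complex) \<Rightarrow> 'e set \<Rightarrow> 'e \<times> real \<Rightarrow> complex \<Rightarrow> bool" where
  "trail p E h v \<longleftrightarrow> arc p \<and> E \<subseteq> edges G \<and> path_image p = (\<Union>e\<in>E. path_image (curve G e)) \<and>
     pathfinish p = v \<and> v \<in> verts G \<and> h \<in> ends_at G v \<and> fst h \<in> E \<and>
     (\<forall>h'\<in>ends_at G v. fst h' \<in> E \<longrightarrow> h' = h)"

lemma oriented_curve:
  assumes h: "h \<in> ends_at G v" and ns: "pathstart (curve G (fst h)) \<noteq> pathfinish (curve G (fst h))"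
  obtains q where "arc q" "pathstart q = v" "path_image q = path_image (curve G (fst h))"
    "pathfinish q = curve G (fst h) (1 - snd h)"
proof (cases "snd h = 0")
  case True
  show thesis
    by (rule that[of "curve G (fst h)"])
      (use True ends_atD[OF h] curve_ends_in_verts[OF ends_atD(1)[OF h] ns] in \<open>auto simp: pathstart_def pathfinish_def\<close>)
next
  case False
  then have "snd h = 1" using ends_atD(2)[OF h] by simp
  then have "pathfinish (curve G (fst h)) = v" "pathstart (curve G (fst h)) = curve G (fst h) (1 - snd h)"
    using ends_atD(3)[OF h] by (simp_all add: pathfinish_def pathstart_def)
  then show thesis
    using curve_ends_in_verts(4)[OF ends_atD(1)[OF h] ns]
    by (intro that[of "reversepath (curve G (fst h))"]) (simp_all add: arc_reversepath)
qed

text \<open>A trail with the greatest number of edges ends at a vertex that is not a leaf of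
  \<open>H\<close>; since it cannot be extended, the next edge runs back into it and closes a cycle.
  Loop edges and circle components are cycles by themselves.\<close>

lemma exists_cycle:
  assumes H: "H \<subseteq> edges G" "H \<noteq> {}"
    and no_leaf: "\<And>v h. v \<in> verts G \<Longrightarrow> h \<in> ends_at G v \<Longrightarrow> fst h \<in> H
      \<Longrightarrow> \<exists>h'\<in>ends_at G v. h' \<noteq> h \<and> fst h' \<in> H"
  obtains c where "simple_path c" "pathfinish c = pathstart c" "path_image c \<subseteq> (\<Union>e\<in>H. path_image (curve G e))"
proof (cases "\<exists>e\<in>H. pathstart (curve G e) = pathfinish (curve G e)")
  case True
  then obtain e where e: "e \<in> H" "pathstart (curve G e) = pathfinish (curve G e)" by blast
  show thesis
    by (rule that[of "curve G e"]) (use e H simple_path_curve in auto)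
next
  case False
  then have ns: "pathstart (curve G e) \<noteq> pathfinish (curve G e)" if "e \<in> H" for e
    using that by blast
  define P where "P x \<longleftrightarrow> (case x of (p, E, h, v) \<Rightarrow> trail p E h v \<and> E \<subseteq> H)" for x
  obtain e where e: "e \<in> H" using H by blast
  have e': "e \<in> edges G" using e H by blast
  have P0: "P (curve G e, {e}, (e, 1), curve G e 1)"
    using curve_ends_in_verts[OF e' ns[OF e]] e e' unfolding P_def trail_def
    by (auto simp: pathfinish_def ends_at_def)
  have bound: "\<forall>x. P x \<longrightarrow> card (fst (snd x)) < Suc (card (edges G))"
  proof (intro allI impI)
    fix x assume "P x"
    then have "fst (snd x) \<subseteq> edges G" unfolding P_def trail_def by (auto split: prod.splits)
    then show "card (fst (snd x)) < Suc (card (edges G))"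
      by (intro le_imp_less_Suc card_mono[OF finite_edges])
  qed
  obtain x where x: "P x" "\<forall>y. P y \<longrightarrow> card (fst (snd y)) \<le> card (fst (snd x))"
    using ex_has_greatest_nat[of P _ "\<lambda>x. card (fst (snd x))", OF P0 bound] by (elim exE conjE) (rule that)
  obtain p E h v where xe: "x = (p, E, h, v)" by (cases x) auto
  have tr: "trail p E h v" and EH: "E \<subseteq> H" using x(1) by (auto simp: P_def xe)
  have p: "arc p" "E \<subseteq> edges G" "path_image p = (\<Union>e\<in>E. path_image (curve G e))" "pathfinish p = v" "v \<in> verts G"
    "h \<in> ends_at G v" "fst h \<in> E" and uniq: "\<And>h'. h' \<in> ends_at G v \<Longrightarrow> fst h' \<in> E \<Longrightarrow> h' = h"
    using tr unfolding trail_def by auto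
  have max: "card E' \<le> card E" if "trail p' E' h' v'" "E' \<subseteq> H" for p' E' h' v'
    using x(2)[rule_format, of "(p', E', h', v')"] that by (simp add: P_def xe)
  have "fst h \<in> H" using p(7) EH by blast
  then obtain h' where h': "h' \<in> ends_at G v" "h' \<noteq> h" "fst h' \<in> H"
    using no_leaf[OF p(5,6)] by blast
  define e1 where "e1 = fst h'"
  have e1: "e1 \<in> edges G" "e1 \<in> H" "e1 \<notin> E"
    using h' H uniq[OF h'(1)] by (auto simp: e1_def)
  note ns1 = ns[OF e1(2)]
  obtain q where q: "arc q" "pathstart q = v" "path_image q = path_image (curve G e1)"
    "pathfinish q = curve G e1 (1 - snd h')"
    using oriented_curve[OF h'(1)] ns1 unfolding e1_def by blast
  define w where "w = pathfinish q"
  have w: "w \<in> verts G" "w \<noteq> v" "(e1, 1 - snd h') \<in> ends_at G w"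
    using curve_ends_in_verts[OF e1(1) ns1] ends_atD[OF h'(1)] q(4) e1(1)
    by (auto simp: w_def ends_at_def e1_def)
  have qv: "path_image q \<inter> verts G \<subseteq> {v, w}"
  proof
    fix u assume u: "u \<in> path_image q \<inter> verts G"
    then have "(e1, 0) \<in> ends_at G u \<or> (e1, 1) \<in> ends_at G u"
      using vertex_on_curve[OF e1(1), of u] q(3) by auto
    then have "curve G e1 0 = u \<or> curve G e1 1 = u" by (auto simp: ends_at_def)
    then show "u \<in> {v, w}"
      using ends_atD[OF h'(1)] q(4) by (auto simp: w_def e1_def)
  qed
  have meet: "path_image q \<inter> path_image p \<subseteq> {v, w}"
  proof -
    have "path_image q \<inter> path_image p \<subseteq> verts G"
    proof
      fix u assume "u \<in> path_image q \<inter> path_image p"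
      then obtain e2 where e2: "e2 \<in> E" "u \<in> path_image (curve G e2)" "u \<in> path_image (curve G e1)"
        unfolding p(3) q(3) by blast
      obtain s where s: "s \<in> {0..1}" "u = curve G e1 s"
        using e2(3) unfolding path_image_def by blast
      obtain t where t: "t \<in> {0..1}" "u = curve G e2 t"
        using e2(2) unfolding path_image_def by blast
      have "e2 \<in> edges G" "e1 \<noteq> e2" using e2(1) p(2) e1(3) by auto
      then show "u \<in> verts G"
        using distinct_curves_meet[OF e1(1), of e2 s t] s t by simp
    qed
    then show ?thesis using qv by blast
  qed
  show thesis
  proof (cases "w \<in> path_image p")
    case False
    have 1: "arc (p +++ q)"
      using p(1) q(1) by (rule arc_join) (use p(4) q(2) meet False in auto)
    have 2: "path_image (p +++ q) = (\<Union>e\<in>insert e1 E. path_image (curve G e))"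
      using p(3,4) q(2,3) by (simp add: path_image_join Un_commute)
    have 3: "k = (e1, 1 - snd h')" if k: "k \<in> ends_at G w" "fst k \<in> insert e1 E" for k
    proof -
      have "fst k \<notin> E"
      proof
        assume "fst k \<in> E"
        moreover have "w \<in> path_image (curve G (fst k))"
          using ends_atD[OF k(1)] unfolding path_image_def by force
        ultimately show False using False p(3) by blast
      qed
      then have fk: "fst k = e1" using k(2) by simp
      have "snd k \<noteq> snd h'"
        using ends_atD(3)[OF k(1)] ends_atD(3)[OF h'(1)] w(2) fk by (auto simp: e1_def)
      then have "snd k = 1 - snd h'"
        using ends_atD(2)[OF k(1)] ends_atD(2)[OF h'(1)] by auto
      then show ?thesis using fk by (simp add: prod_eq_iff)
    qed
    have "trail (p +++ q) (insert e1 E) (e1, 1 - snd h') w"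
      unfolding trail_def
    proof (intro conjI ballI impI)
      show "k = (e1, 1 - snd h')" if "k \<in> ends_at G w" "fst k \<in> insert e1 E" for k
        by (rule 3[OF that])
      show "pathfinish (p +++ q) = w" by (simp add: w_def)
    qed (use 1 2 p(2) e1(1) w in simp_all)
    then have "card (insert e1 E) \<le> card E"
      by (rule max) (use e1 EH in auto)
    then show thesis
      using e1(3) finite_subset[OF p(2) finite_edges] by simp
  next
    case True
    then obtain s where s: "s \<in> {0..1}" "w = p s"
      unfolding path_image_def by blast
    have "p 1 = v" using p(4) by (simp add: pathfinish_def)
    then have "s \<noteq> 1" using w(2) s by auto
    \<comment> \<open>The new edge meets the trail again at \<open>w\<close>; the part of the trail
      before \<open>w\<close> would be a tail of the cycle and is dropped.\<close>
    let ?r = "subpath s 1 p"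
    have r: "arc ?r" "pathstart ?r = w" "pathfinish ?r = v" "path_image ?r \<subseteq> path_image p"
      using arc_subpath_arc[OF p(1) s(1), of 1] \<open>s \<noteq> 1\<close> s \<open>p 1 = v\<close> path_image_subpath_subset[of s 1 p] by auto
    show thesis
    proof (rule that[of "?r +++ q"])
      show "simple_path (?r +++ q)"
        by (rule simple_path_join_loop[OF r(1) q(1)]) (use r q(2) meet in \<open>auto simp: w_def\<close>)
      show "pathfinish (?r +++ q) = pathstart (?r +++ q)"
        using r by (simp add: w_def)
      have "path_image (?r +++ q) \<subseteq> path_image p \<union> path_image q"
        using r q by (auto simp: path_image_join)
      also have "\<dots> \<subseteq> (\<Union>e\<in>H. path_image (curve G e))"
        unfolding p(3) q(3) using EH e1(2) by blast
      finally show "path_image (?r +++ q) \<subseteq> (\<Union>e\<in>H. path_image (curve G e))" .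
    qed
  qed
qed

text \<open>A breadth-first tree in the dual graph: \<open>N\<close> is the distance from
  \<open>F0\<close>, and \<open>par F\<close> is a neighbour closer to the root, across the edge
  \<open>pe F\<close>.\<close>

lemma exists_spanning_tree:
  assumes F0: "F0 \<in> faces G"
  obtains N :: "complex set \<Rightarrow> nat" and par pe where
    "\<And>F. F \<in> faces G \<Longrightarrow> F \<noteq> F0 \<Longrightarrow> par F \<in> faces G \<and> N (par F) < N F \<and> pe F \<in> edges G \<and>
       adjacent_faces G (pe F) = {par F, F}"
proof -
  define R where "R = {(F, F'). \<exists>e\<in>edges G. adjacent_faces G e = {F, F'}}"
  have reach: "(F0, F) \<in> R\<^sup>*" if F: "F \<in> faces G" for F
  proof -
    have "((F0, F) \<in> R\<^sup>*) = ((F0, F0) \<in> R\<^sup>*)"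
    proof (rule face_function_constant_all[where c="\<lambda>F. (F0, F) \<in> R\<^sup>*", OF _ F F0])
      fix e A B assume e: "e \<in> edges G" and AB: "A \<in> adjacent_faces G e" "B \<in> adjacent_faces G e"
      obtain C D where CD: "adjacent_faces G e = {C, D}" by (rule adjacent_faces_pair[OF e])
      have "(C, D) \<in> R" "(D, C) \<in> R"
        using e CD unfolding R_def by (auto simp: insert_commute)
      then have "A = B \<or> ((A, B) \<in> R \<and> (B, A) \<in> R)"
        using AB unfolding CD by auto
      then show "((F0, A) \<in> R\<^sup>*) = ((F0, B) \<in> R\<^sup>*)"
        by (auto intro: rtrancl_into_rtrancl)
    qed
    then show ?thesis by simp
  qed
  define N where "N F = (LEAST n. (F0, F) \<in> R ^^ n)" for F
  have "\<exists>F' e. F' \<in> faces G \<and> N F' < N F \<and> e \<in> edges G \<and> adjacent_faces G e = {F', F}"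
    if F: "F \<in> faces G" "F \<noteq> F0" for F
  proof -
    obtain n where "(F0, F) \<in> R ^^ n"
      using reach[OF F(1)] rtrancl_imp_relpow by blast
    then have "(F0, F) \<in> R ^^ N F" unfolding N_def by (rule LeastI)
    moreover have "N F \<noteq> 0"
      using calculation F(2) by (metis relpow_0_E)
    then obtain m where m: "N F = Suc m" using not0_implies_Suc by blast
    ultimately obtain F' where F': "(F0, F') \<in> R ^^ m" "(F', F) \<in> R"
      by (metis relpow_Suc_E)
    have "N F' \<le> m" unfolding N_def by (rule Least_le[where P="\<lambda>n. (F0, F') \<in> R ^^ n", OF F'(1)])
    moreover obtain e where e: "e \<in> edges G" "adjacent_faces G e = {F', F}"
      using F'(2) unfolding R_def by blast
    moreover have "F' \<in> faces G"
      using e adjacent_faces_subset_faces[of e] by auto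
    ultimately show ?thesis using m by (metis le_imp_less_Suc)
  qed
  then obtain par pe where "\<And>F. F \<in> faces G \<Longrightarrow> F \<noteq> F0 \<Longrightarrow> par F \<in> faces G \<and> N (par F) < N F \<and> pe F \<in> edges G \<and>
       adjacent_faces G (pe F) = {par F, F}"
    by metis
  then show thesis by (rule that)
qed

text \<open>If the tree crossed no edge of \<open>H\<close>, following parents down to
  \<open>F0\<close> would put all faces on one side of the cycle. But both sides of a Jordan curve
  are open and nonempty, so each contains points off the graph.\<close>

lemma cycle_separates_tree:
  assumes c: "simple_path c" "pathfinish c = pathstart c" "path_image c \<subseteq> (\<Union>e\<in>H. path_image (curve G e))"
    and H: "H \<subseteq> edges G" and F0: "F0 \<in> faces G"
    and tree: "\<And>F. F \<in> faces G \<Longrightarrow> F \<noteq> F0 \<Longrightarrow> par F \<in> faces G \<and> N (par F) < (N F :: nat) \<and> pe F \<in> edges G \<and>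
       adjacent_faces G (pe F) = {par F, F}"
  shows "\<exists>F\<in>faces G. F \<noteq> F0 \<and> pe F \<in> H"
proof (rule ccontr)
  assume "\<not> ?thesis"
  then have notH: "\<And>F. F \<in> faces G \<Longrightarrow> F \<noteq> F0 \<Longrightarrow> pe F \<notin> H" by blast
  let ?J = "path_image c"
  have JX: "?J \<subseteq> graph_set G"
    using c(3) H unfolding graph_set_def by blast
  have J: "inside ?J \<noteq> {}" "open (inside ?J)" "outside ?J \<noteq> {}" "open (outside ?J)"
    using Jordan_inside_outside[OF c(1,2)] by auto
  obtain z0 where z0: "z0 \<in> F0" using face_nonempty[OF F0] by blast
  have cc: "connected_component (- ?J) z z'"
    if F: "F \<in> faces G" "F \<noteq> F0" "z \<in> par F" "z' \<in> F" for F z z'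
  proof -
    note t = tree[OF F(1,2)]
    have e: "pe F \<in> edges G" using t by blast
    have "connected (curve G (pe F) ` {0<..<1})"
      by (rule connected_curve_image[OF e]) auto
    moreover have "curve G (pe F) ` {0<..<1} \<inter> ?J = {}"
    proof (rule ccontr)
      assume "curve G (pe F) ` {0<..<1} \<inter> ?J \<noteq> {}"
      then obtain s where s: "s \<in> {0<..<1}" "curve G (pe F) s \<in> ?J" by blast
      then obtain e' where e': "e' \<in> H" "curve G (pe F) s \<in> path_image (curve G e')"
        using c(3) by blast
      then obtain t where t: "t \<in> {0..1}" "curve G (pe F) s = curve G e' t"
        unfolding path_image_def by blast
      have "e' \<noteq> pe F" using notH[OF F(1,2)] e' by blast
      then have "curve G (pe F) s \<in> verts G"
        using distinct_curves_meet[OF e, of e' s t] e' H s t by auto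
      then show False using curve_not_vertex[OF e s(1)] by blast
    qed
    moreover have "closure A \<inter> curve G (pe F) ` {0<..<1} \<noteq> {}" if "A \<in> {par F, F}" for A
    proof -
      have "A \<in> arc_faces (pe F) 0 1"
        using that t adjacent_faces_eq[OF e] by blast
      then show ?thesis by (simp add: arc_faces_def)
    qed
    ultimately show ?thesis
      by (intro faces_connected_through[OF _ _ JX _ _ F(3) F(1) _ F(4)]) (use t in auto)
  qed
  have same: "z \<in> inside ?J \<longleftrightarrow> z0 \<in> inside ?J" if "F \<in> faces G" "z \<in> F" for F z
    using that
  proof (induction "N F" arbitrary: F z rule: less_induct)
    case less
    have inside_cc: "a \<in> inside ?J \<longleftrightarrow> b \<in> inside ?J" if "connected_component (- ?J) a b" for a b
    proof -
      have "connected_component_set (- ?J) a = connected_component_set (- ?J) b"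
        using connected_component_eq[of b "- ?J" a] that by simp
      moreover have "a \<notin> ?J" "b \<notin> ?J" using connected_component_in[OF that] by auto
      ultimately show ?thesis unfolding inside_def by simp
    qed
    show ?case
    proof (cases "F = F0")
      case True
      have "connected_component (- ?J) z z0"
        unfolding connected_component_def
        using connected_face[OF F0] face_disjoint[OF F0] JX less(3) z0 True by (intro exI[of _ F0]) blast
      then show ?thesis by (rule inside_cc)
    next
      case False
      note t = tree[OF less(2) False]
      then obtain y where y: "y \<in> par F" using face_nonempty by blast
      then have "y \<in> inside ?J \<longleftrightarrow> z0 \<in> inside ?J"
        using less(1)[of "par F" y] t by blast
      then show ?thesis using inside_cc[OF cc[OF less(2) False y less(3)]] by blast
    qed
  qed
  have ex: "\<exists>z. z \<in> U - graph_set G" if "open U" "U \<noteq> {}" for U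
    using interior_graph_set interior_maximal[OF _ that(1), of "graph_set G"] that(2) by blast
  obtain a where a: "a \<in> inside ?J" "a \<notin> graph_set G" using ex[OF J(2,1)] by blast
  obtain b where b: "b \<in> outside ?J" "b \<notin> graph_set G" using ex[OF J(4,3)] by blast
  have "b \<notin> inside ?J" using b(1) inside_Int_outside[of ?J] by blast
  then show False
    using same[OF face_in_faces[OF a(2)] in_face[OF a(2)]] same[OF face_in_faces[OF b(2)] in_face[OF b(2)]] a(1) by blast
qed

theorem exists_face_function:
  fixes \<Gamma> (structure)
  assumes \<Gamma>: "group \<Gamma>" and tri: "trivalent G"
    and \<Psi>: "\<And>e. e \<in> edges G \<Longrightarrow> \<Psi> e \<in> carrier \<Gamma>" "\<And>e. e \<in> edges G \<Longrightarrow> \<Psi> e \<otimes> \<Psi> e = \<one>"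
    and vertex: "\<And>v h1 h2 h3. v \<in> verts G \<Longrightarrow> ends_at G v = {h1, h2, h3} \<Longrightarrow> h1 \<noteq> h2 \<Longrightarrow> h1 \<noteq> h3 \<Longrightarrow> h2 \<noteq> h3
      \<Longrightarrow> \<Psi> (fst h1) \<otimes> \<Psi> (fst h2) = \<Psi> (fst h3)"
  obtains g where "\<And>F. F \<in> faces G \<Longrightarrow> g F \<in> carrier \<Gamma>"
    "\<And>e F F'. e \<in> edges G \<Longrightarrow> adjacent_faces G e = {F, F'} \<Longrightarrow> g F = \<Psi> e \<otimes> g F'"
proof -
  interpret group \<Gamma> by (rule \<Gamma>)
  have "graph_set G \<noteq> UNIV" using interior_graph_set by auto
  then obtain z0 where "z0 \<notin> graph_set G" by blast
  then have F0: "face z0 \<in> faces G" by (rule face_in_faces)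
  define F0 where "F0 = face z0"
  note F0 = F0[folded F0_def]
  obtain N :: "complex set \<Rightarrow> nat" and par pe where tree: "\<And>F. F \<in> faces G \<Longrightarrow> F \<noteq> F0 \<Longrightarrow>
      par F \<in> faces G \<and> N (par F) < N F \<and> pe F \<in> edges G \<and> adjacent_faces G (pe F) = {par F, F}"
    by (rule exists_spanning_tree[OF F0]) (rule that)
  \<comment> \<open>Recursion along the tree, well-founded because a parent has smaller
    \<open>N\<close>; the value at the root is \<open>\<one>\<close>.\<close>
  define Hf where "Hf f F = (if F \<in> faces G \<and> F \<noteq> F0 then \<Psi> (pe F) \<otimes> f (par F) else \<one>)" for f :: "complex set \<Rightarrow> 'a" and F
  define g where "g = wfrec (Wellfounded.measure N) Hf"
  have g_tree: "g F = \<Psi> (pe F) \<otimes> g (par F)" if "F \<in> faces G" "F \<noteq> F0" for F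
  proof -
    have "g F = Hf (cut g (Wellfounded.measure N) F) F"
      unfolding g_def by (rule wfrec[OF wf_measure])
    then show ?thesis
      using tree[OF that] that by (simp add: Hf_def cut_apply)
  qed
  have g_other: "g F = \<one>" if "\<not> (F \<in> faces G \<and> F \<noteq> F0)" for F
  proof -
    have "g F = Hf (cut g (Wellfounded.measure N) F) F"
      unfolding g_def by (rule wfrec[OF wf_measure])
    then show ?thesis
      using that by (simp add: Hf_def)
  qed
  have gc: "g F \<in> carrier \<Gamma>" for F
  proof (induction "N F" arbitrary: F rule: less_induct)
    case less
    then show ?case
      using g_tree[of F] g_other[of F] tree[of F] \<Psi>(1)[of "pe F"] by (cases "F \<in> faces G \<and> F \<noteq> F0") auto
  qed
  define good where "good e \<longleftrightarrow> (\<forall>F F'. adjacent_faces G e = {F, F'} \<longrightarrow> g F = \<Psi> e \<otimes> g F')" for e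
  \<comment> \<open>Since \<open>\<Psi> e\<close> is an involution, the condition for one order of
    the two faces gives the other.\<close>
  have good_if: "good e" if e: "e \<in> edges G" and FF: "adjacent_faces G e = {F, F'}" "g F = \<Psi> e \<otimes> g F'" for e F F'
  proof -
    have "\<Psi> e \<otimes> g F = (\<Psi> e \<otimes> \<Psi> e) \<otimes> g F'"
      using FF(2) \<Psi>(1)[OF e] gc by (simp add: m_assoc)
    then have "g F' = \<Psi> e \<otimes> g F"
      using \<Psi>(2)[OF e] gc by simp
    then show ?thesis
      using FF unfolding good_def by (auto simp: doubleton_eq_iff)
  qed
  define H where "H = {e \<in> edges G. \<not> good e}"
  have tree_good: "pe F \<notin> H" if "F \<in> faces G" "F \<noteq> F0" for F
    using good_if[of "pe F" F "par F"] tree[OF that] g_tree[OF that] by (simp add: H_def insert_commute)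
  have "H = {}"
  proof (rule ccontr)
    assume "H \<noteq> {}"
    have HE: "H \<subseteq> edges G" by (auto simp: H_def)
    \<comment> \<open>Without a leaf the bad edges would contain a cycle, which the tree must cross;
      but it crosses only good edges.\<close>
    have "\<exists>v\<in>verts G. \<exists>h\<in>ends_at G v. fst h \<in> H \<and> (\<forall>h'\<in>ends_at G v. h' \<noteq> h \<longrightarrow> fst h' \<notin> H)"
    proof (rule ccontr)
      assume "\<not> ?thesis"
      then have nl: "\<And>v h. v \<in> verts G \<Longrightarrow> h \<in> ends_at G v \<Longrightarrow> fst h \<in> H
          \<Longrightarrow> \<exists>h'\<in>ends_at G v. h' \<noteq> h \<and> fst h' \<in> H"
        by blast
      obtain c where c: "simple_path c" "pathfinish c = pathstart c" "path_image c \<subseteq> (\<Union>e\<in>H. path_image (curve G e))"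
        by (rule exists_cycle[OF HE \<open>H \<noteq> {}\<close> nl])
      show False
        using cycle_separates_tree[where par=par and N=N and pe=pe, OF c HE F0 tree] tree_good by blast
    qed
    then obtain v h where vh: "v \<in> verts G" "h \<in> ends_at G v" "fst h \<in> H"
      "\<And>h'. h' \<in> ends_at G v \<Longrightarrow> h' \<noteq> h \<Longrightarrow> fst h' \<notin> H"
      by blast
    have "card (ends_at G v) = 3" using tri vh(1) by (simp add: trivalent_def)
    then have "card (ends_at G v - {h}) = 2" using vh(2) by (simp add: card_Diff_singleton)
    then obtain h2 h3 where h23: "ends_at G v - {h} = {h2, h3}" "h2 \<noteq> h3"
      by (auto simp: card_2_iff)
    then have E: "ends_at G v = {h, h2, h3}" "h \<noteq> h2" "h \<noteq> h3" "h2 \<noteq> h3"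
      using vh(2) by auto
    obtain F1 F2 F3 where F: "adjacent_faces G (fst h) = {F2, F3}" "adjacent_faces G (fst h2) = {F3, F1}"
      "adjacent_faces G (fst h3) = {F1, F2}"
      by (rule trivalent_vertex_faces[OF vh(1) E])
    have e: "fst h \<in> edges G" "fst h2 \<in> edges G" "fst h3 \<in> edges G"
      using ends_atD(1) E(1) by blast+
    have "good (fst h2)" "good (fst h3)"
      using vh(4)[of h2] vh(4)[of h3] E e by (auto simp: H_def)
    \<comment> \<open>Going from \<open>F3\<close> by \<open>F1\<close> to \<open>F2\<close> around
      \<open>v\<close> crosses the two good edges, and the vertex relation turns the product of
      their jumps into the jump required at the third.\<close>
    then have "g F3 = \<Psi> (fst h2) \<otimes> g F1" "g F1 = \<Psi> (fst h3) \<otimes> g F2"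
      using F unfolding good_def by auto
    then have "g F3 = (\<Psi> (fst h2) \<otimes> \<Psi> (fst h3)) \<otimes> g F2"
      using \<Psi>(1) e gc by (simp add: m_assoc)
    also have "\<Psi> (fst h2) \<otimes> \<Psi> (fst h3) = \<Psi> (fst h)"
      by (rule vertex[OF vh(1)]) (use E in auto)
    finally have "good (fst h)"
      using good_if[OF e(1), of F3 F2] F(1) by (simp add: insert_commute)
    then show False using vh(3) by (simp add: H_def)
  qed
  show thesis
  proof (rule that[of g])
    show "g F = \<Psi> e \<otimes> g F'" if "e \<in> edges G" "adjacent_faces G e = {F, F'}" for e F F'
      using \<open>H = {}\<close> that unfolding H_def good_def by blast
  qed (rule gc)
qed

end

section \<open>Compactness\<close>

definition line_reflections :: "(complex^3^3) set" where
  "line_reflections = line_reflection ` (- {0})"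

definition reflection_of_line :: "(complex^3) set \<Rightarrow> complex^3^3" where
  "reflection_of_line L = line_reflection (SOME v. v \<noteq> 0 \<and> complex_line v = L)"

lemma reflection_of_complex_line:
  assumes "v \<noteq> 0" shows "reflection_of_line (complex_line v) = line_reflection v"
proof -
  have "(SOME w. w \<noteq> 0 \<and> complex_line w = complex_line v) \<noteq> 0 \<and>
      complex_line (SOME w. w \<noteq> 0 \<and> complex_line w = complex_line v) = complex_line v"
    by (rule someI[of _ v]) (use assms in simp)
  then show ?thesis
    unfolding reflection_of_line_def using complex_line_eq_iff assms by blast
qed

lemma CP2E:
  assumes "L \<in> CP2" obtains v where "v \<noteq> 0" "L = complex_line v"
  using assms by (auto simp: CP2_def)

lemma reflection_of_line:
  assumes "L \<in> CP2"
  shows "reflection_of_line L \<in> carrier SU3" "reflection_of_line L ** reflection_of_line L = mat 1"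
    "reflection_of_line L \<in> line_reflections" "eigenspace_1 (reflection_of_line L) = L"
    "adjoint_matrix (reflection_of_line L) = reflection_of_line L"
  using assms
  by (auto elim!: CP2E simp: reflection_of_complex_line line_reflection_SU3 line_reflection_involution
      line_reflections_def eigenspace_line_reflection)

lemma reflection_of_eigenspace:
  assumes "A \<in> line_reflections"
  shows "eigenspace_1 A \<in> CP2" "reflection_of_line (eigenspace_1 A) = A"
proof -
  obtain v where "v \<noteq> 0" "A = line_reflection v"
    using assms by (auto simp: line_reflections_def)
  then show "eigenspace_1 A \<in> CP2" "reflection_of_line (eigenspace_1 A) = A"
    by (auto simp: eigenspace_line_reflection CP2_def reflection_of_complex_line)
qed

lemma conjugate_Phi_iff': "conjugate_in_SU3 A Phi \<longleftrightarrow> A \<in> line_reflections"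
  by (auto simp: conjugate_Phi_iff line_reflections_def)

lemma continuous_on_line_reflection: "continuous_on (- {0}) line_reflection"
  unfolding line_reflection_def
proof (intro continuous_on_vec_lambda continuous_on_diff continuous_on_divide continuous_on_const ballI)
  show "continuous_on (- {0}) (\<lambda>v::complex^3. 2 * (v $ i * cnj (v $ j)))" for i j
    by (intro continuous_intros)
  show "continuous_on (- {0}) (\<lambda>v::complex^3. hermitian v v)"
    unfolding hermitian_def by (intro continuous_intros)
qed auto

lemma compact_space_CP2: "compact_space CP2_topology"
proof -
  have "CP2 = complex_line ` sphere 0 1"
  proof
    show "CP2 \<subseteq> complex_line ` sphere 0 1"
    proof
      fix L assume "L \<in> CP2"
      then obtain v where v: "v \<noteq> 0" "L = complex_line v" by (rule CP2E)
      define w where "w = v /\<^sub>R norm v"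
      have "w = of_real (inverse (norm v)) *s v"
        by (simp add: w_def vec_eq_iff) (simp add: scaleR_conv_of_real)
      then have "complex_line w = L"
        using v complex_line_scale[of "of_real (inverse (norm v))" v] by simp
      moreover have "w \<in> sphere 0 1" using v(1) by (simp add: w_def)
      ultimately show "L \<in> complex_line ` sphere 0 1" by blast
    qed
    show "complex_line ` sphere 0 1 \<subseteq> CP2"
      unfolding CP2_def by (rule image_mono) auto
  qed
  moreover have "compactin (top_of_set (- {0})) (sphere (0::complex^3) 1)"
    by (auto simp: compactin_subtopology)
  then have "compactin CP2_topology (complex_line ` sphere 0 1)"
    by (rule image_compactin) (rule quotient_imp_continuous_map[OF quotient_map_complex_line])
  ultimately show ?thesis
    by (simp add: compact_space_def)
qed

text \<open>A continuous bijection from a compact space to a Hausdorff one. Through it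
  \<open>CP2_topology\<close> inherits the Hausdorff property, and \<open>eigenspace_1\<close> is
  continuous as the inverse map.\<close>

lemma homeomorphic_map_reflection_of_line:
  "homeomorphic_map CP2_topology (top_of_set line_reflections) reflection_of_line"
proof (rule continuous_imp_homeomorphic_map[OF _ compact_space_CP2])
  have "continuous_map (top_of_set (- {0})) (top_of_set line_reflections) (reflection_of_line \<circ> complex_line)"
  proof (rule continuous_map_eq)
    show "continuous_map (top_of_set (- {0})) (top_of_set line_reflections) line_reflection"
      using continuous_on_line_reflection by (auto simp: line_reflections_def)
  qed (simp add: reflection_of_complex_line)
  then show "continuous_map CP2_topology (top_of_set line_reflections) reflection_of_line"
    by (rule continuous_compose_quotient_map[OF quotient_map_complex_line])
  show "Hausdorff_space (top_of_set line_reflections)"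
    by (simp add: Hausdorff_space_subtopology)
  show "reflection_of_line ` topspace CP2_topology = topspace (top_of_set line_reflections)"
    by (auto simp: line_reflections_def CP2_def reflection_of_complex_line image_image)
  show "inj_on reflection_of_line (topspace CP2_topology)"
    by (rule inj_on_inverseI[of _ eigenspace_1]) (simp add: reflection_of_line)
qed

lemma continuous_map_eigenspace:
  "continuous_map (top_of_set line_reflections) CP2_topology eigenspace_1"
proof -
  obtain f where f: "homeomorphic_maps CP2_topology (top_of_set line_reflections) reflection_of_line f"
    using homeomorphic_map_reflection_of_line homeomorphic_map_maps by blast
  have eq: "f A = eigenspace_1 A" if "A \<in> line_reflections" for A
    using f reflection_of_eigenspace[OF that] by (metis homeomorphic_maps_def topspace_CP2_topology)
  have "continuous_map (top_of_set line_reflections) CP2_topology f"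
    using f unfolding homeomorphic_maps_def by blast
  then show ?thesis
    by (rule continuous_map_eq) (simp add: eq)
qed

lemma Hausdorff_space_CP2: "Hausdorff_space CP2_topology"
  using homeomorphic_Hausdorff_space homeomorphic_map_imp_homeomorphic_space[OF homeomorphic_map_reflection_of_line]
  by (metis Hausdorff_space_euclidean Hausdorff_space_subtopology)

lemma compact_line_reflections: "compact line_reflections"
  using homeomorphic_compact_space[OF homeomorphic_map_imp_homeomorphic_space[OF homeomorphic_map_reflection_of_line]]
    compact_space_CP2 by (simp add: compact_space_subtopology compactin_subtopology compact_space_def)

section \<open>Compactness of SU(3) and of the space of representations\<close>

lemma continuous_on_matrix_mult:
  fixes f g :: "'a::topological_space \<Rightarrow> complex^3^3"
  assumes "continuous_on S f" "continuous_on S g"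
  shows "continuous_on S (\<lambda>x. f x ** g x)"
  unfolding matrix_matrix_mult_def
  by (intro continuous_on_vec_lambda continuous_intros assms)

lemma SU3_entry_bound:
  assumes "A \<in> carrier SU3" shows "norm (A $ i $ j) \<le> 1"
proof -
  have "(A ** adjoint_matrix A) $ i $ i = 1"
    using assms by (simp add: SU3_carrier mat_def)
  then have "(\<Sum>k\<in>UNIV. A $ i $ k * cnj (A $ i $ k)) = 1"
    by (simp add: matrix_matrix_mult_def adjoint_matrix_def)
  then have "of_real (\<Sum>k\<in>UNIV. (norm (A $ i $ k))\<^sup>2) = (1::complex)"
    unfolding of_real_sum complex_norm_square .
  then have "(\<Sum>k\<in>UNIV. (norm (A $ i $ k))\<^sup>2) = 1"
    unfolding of_real_eq_1_iff .
  moreover have "(norm (A $ i $ j))\<^sup>2 \<le> (\<Sum>k\<in>UNIV. (norm (A $ i $ k))\<^sup>2)"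
    by (rule member_le_sum) auto
  ultimately show ?thesis
    using power2_le_imp_le[of "norm (A $ i $ j)" 1] by simp
qed

lemma compact_SU3: "compact (carrier SU3)"
proof -
  have "norm A \<le> 9" if "A \<in> carrier SU3" for A
  proof -
    have "norm (A $ i) \<le> (\<Sum>j\<in>UNIV. norm (A $ i $ j))" for i
      by (simp add: norm_vec_def L2_set_le_sum)
    also have "\<dots> i \<le> (\<Sum>j\<in>(UNIV::3 set). 1)" for i
      by (rule sum_mono) (rule SU3_entry_bound[OF that])
    finally have row: "norm (A $ i) \<le> 3" for i by simp
    have "norm A \<le> (\<Sum>i\<in>UNIV. norm (A $ i))"
      by (simp add: norm_vec_def[of A] L2_set_le_sum)
    also have "\<dots> \<le> (\<Sum>i\<in>(UNIV::3 set). 3)"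
      by (rule sum_mono) (rule row)
    finally show ?thesis by simp
  qed
  then have "bounded (carrier SU3)"
    unfolding bounded_iff by blast
  moreover have "closed (carrier SU3)"
  proof -
    have "continuous_on UNIV (\<lambda>A::complex^3^3. A ** adjoint_matrix A)"
      unfolding adjoint_matrix_def
      by (intro continuous_on_matrix_mult continuous_on_vec_lambda continuous_intros)
    then have "closed {A::complex^3^3. A ** adjoint_matrix A = mat 1}"
      by (intro closed_Collect_eq continuous_on_const)
    moreover have "continuous_on UNIV (\<lambda>A::complex^3^3. det A)"
      unfolding det_3 by (intro continuous_intros)
    then have "closed {A::complex^3^3. det A = 1}"
      by (intro closed_Collect_eq continuous_on_const)
    moreover have "carrier SU3 = {A. A ** adjoint_matrix A = mat 1} \<inter> {A. det A = 1}"
      by (auto simp: SU3_carrier)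
    ultimately show ?thesis by (simp add: closed_Int)
  qed
  ultimately show ?thesis by (simp add: compact_eq_bounded_closed)
qed

text \<open>By Tychonoff's theorem the product of copies of \<open>SU3\<close> is compact. The
  homomorphism equations and the conditions on meridians each involve finitely many coordinates;
  they are closed because multiplication is continuous and the set of reflections is
  compact.\<close>

lemma compact_space_R_Phi:
  assumes b: "b \<in> graph_complement G"
    and mer: "\<And>e. e \<in> edges G \<Longrightarrow> meridians G b e \<subseteq> carrier (graph_group G b)"
  shows "compact_space (R_Phi_topology G b)"
proof -
  let ?C = "carrier (graph_group G b)"
  let ?P = "product_topology (\<lambda>_. top_of_set (carrier SU3)) ?C"
  have grp: "group (graph_group G b)" by (rule group_fundamental_group[OF b])
  have proj: "continuous_map ?P euclidean (\<lambda>\<rho>. \<rho> x)" if "x \<in> ?C" for x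
    using continuous_map_product_projection[OF that, of "\<lambda>_. top_of_set (carrier SU3)"]
    by (simp add: continuous_map_in_subtopology)
  have tops: "topspace ?P = (\<Pi>\<^sub>E x\<in>?C. carrier SU3)" by simp
  define M where "M x y = {\<rho> \<in> topspace ?P. \<rho> (x \<otimes>\<^bsub>graph_group G b\<^esub> y) = \<rho> x ** \<rho> y}" for x y
  define N where "N x = {\<rho> \<in> topspace ?P. \<rho> x \<in> line_reflections}" for x
  have M: "closedin ?P (M x y)" if xy: "x \<in> ?C" "y \<in> ?C" for x y
    unfolding M_def
  proof (rule closedin_continuous_maps_eq[of euclidean])
    show "continuous_map ?P euclidean (\<lambda>\<rho>. \<rho> (x \<otimes>\<^bsub>graph_group G b\<^esub> y))"
      using xy by (intro proj monoid.m_closed group.is_monoid[OF grp])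
    have "continuous_map ?P (prod_topology euclidean euclidean) (\<lambda>\<rho>. (\<rho> x, \<rho> y))"
      by (intro continuous_map_pairedI proj xy)
    then have "continuous_map ?P euclidean (\<lambda>\<rho>. (\<rho> x, \<rho> y))"
      by simp
    moreover have "continuous_map euclidean euclidean (\<lambda>p::(complex^3^3) \<times> (complex^3^3). fst p ** snd p)"
      by (simp add: continuous_on_matrix_mult continuous_on_fst continuous_on_snd)
    ultimately have "continuous_map ?P euclidean ((\<lambda>p. fst p ** snd p) \<circ> (\<lambda>\<rho>. (\<rho> x, \<rho> y)))"
      by (rule continuous_map_compose)
    then show "continuous_map ?P euclidean (\<lambda>\<rho>. \<rho> x ** \<rho> y)"
      by (simp add: o_def)
  qed simp
  have N: "closedin ?P (N x)" if "x \<in> ?C" for x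
    unfolding N_def using closedin_continuous_map_preimage[OF proj[OF that], of line_reflections]
      compact_line_reflections compact_imp_closed by auto
  \<comment> \<open>Including the whole product makes the family visibly nonempty and keeps its
    intersection inside the space of extensional functions.\<close>
  define \<K> where "\<K> = insert (topspace ?P) ((\<lambda>(x, y). M x y) ` (?C \<times> ?C) \<union> N ` (\<Union>e\<in>edges G. meridians G b e))"
  have "closedin ?P (\<Inter> \<K>)"
  proof (rule closedin_Inter)
    fix K assume "K \<in> \<K>"
    then consider "K = topspace ?P" | x y where "x \<in> ?C" "y \<in> ?C" "K = M x y"
      | e x where "e \<in> edges G" "x \<in> meridians G b e" "K = N x"
      unfolding \<K>_def by blast
    then show "closedin ?P K"
    proof cases
      case 1
      then show ?thesis by (simp only: closedin_topspace)
    next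
      case 2
      then show ?thesis using M by blast
    next
      case 3
      then show ?thesis using N mer by blast
    qed
  qed (simp add: \<K>_def)
  moreover have "\<Inter> \<K> = R_Phi G b"
  proof (intro equalityI subsetI)
    fix \<rho> assume \<rho>: "\<rho> \<in> \<Inter> \<K>"
    then have 1: "\<rho> \<in> topspace ?P" by (simp add: \<K>_def)
    have 2: "\<rho> (x \<otimes>\<^bsub>graph_group G b\<^esub> y) = \<rho> x ** \<rho> y" if "x \<in> ?C" "y \<in> ?C" for x y
    proof -
      have "M x y \<in> \<K>" using that unfolding \<K>_def by force
      then have "\<rho> \<in> M x y" using \<rho> by blast
      then show ?thesis by (simp add: M_def)
    qed
    have 3: "\<rho> x \<in> line_reflections" if "e \<in> edges G" "x \<in> meridians G b e" for e x
    proof -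
      have "N x \<in> \<K>" using that unfolding \<K>_def by blast
      then have "\<rho> \<in> N x" using \<rho> by blast
      then show ?thesis by (simp add: N_def)
    qed
    show "\<rho> \<in> R_Phi G b"
      using 1 2 3 unfolding R_Phi_def tops PiE_def by (auto simp: hom_def conjugate_Phi_iff')
  next
    fix \<rho> assume \<rho>: "\<rho> \<in> R_Phi G b"
    then have hom: "\<rho> \<in> hom (graph_group G b) SU3" and top: "\<rho> \<in> topspace ?P"
      unfolding R_Phi_def tops PiE_def by (auto simp: hom_def)
    show "\<rho> \<in> \<Inter> \<K>"
    proof (rule InterI)
      fix K assume "K \<in> \<K>"
      then consider "K = topspace ?P" | x y where "x \<in> ?C" "y \<in> ?C" "K = M x y"
        | e x where "e \<in> edges G" "x \<in> meridians G b e" "K = N x"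
        unfolding \<K>_def by blast
      then show "\<rho> \<in> K"
      proof cases
        case 1
        then show ?thesis using top by simp
      next
        case 2
        then show ?thesis using hom_mult[OF hom] top by (simp add: M_def)
      next
        case 3
        then show ?thesis using \<rho> top unfolding R_Phi_def conjugate_Phi_iff' N_def by blast
      qed
    qed
  qed
  moreover have "compact_space ?P"
    using compact_SU3 by (simp add: compact_space_product_topology compact_space_subtopology)
  ultimately show ?thesis
    unfolding R_Phi_topology_def by (metis closedin_compact_space compact_space_subtopology)
qed

section \<open>Representations and decorations\<close>

lemma loop_class_eqD:
  assumes "loop_class S p = loop_class S q" "p \<in> loops_at S b"
  shows "homotopic_paths S p q"
proof -
  have "p \<in> loop_class S p" using assms(2) by (simp add: loop_class_def loops_at_def)
  then have "p \<in> loop_class S q" using assms(1) by simp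
  then show ?thesis by (simp add: loop_class_def homotopic_paths_sym)
qed

lemma loops_at_ends: "p \<in> loops_at S b \<Longrightarrow> path p \<and> path_image p \<subseteq> S \<and> p 0 = b \<and> p 1 = b"
  by (auto simp: loops_at_def pathstart_def pathfinish_def)

text \<open>Extensional, as \<open>R_Phi\<close> demands; by homotopy invariance the loop chosen in
  a class does not matter when the base point lies above the plane.\<close>

definition holonomy_rep ::
    "('a, 'm) monoid_scheme \<Rightarrow> complex set \<Rightarrow> complex \<times> real \<Rightarrow> (complex \<Rightarrow> 'a)
      \<Rightarrow> (real \<Rightarrow> complex \<times> real) set \<Rightarrow> 'a" where
  "holonomy_rep \<Gamma> X b g = (\<lambda>x\<in>carrier (fundamental_group (- (X \<times> {0})) b).
      holonomy \<Gamma> X g (SOME p. p \<in> loops_at (- (X \<times> {0})) b \<and> loop_class (- (X \<times> {0})) p = x))"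

lemma holonomy_cong:
  assumes "\<And>z. z \<notin> X \<Longrightarrow> g z = g' z"
  shows "holonomy \<Gamma> X g p = holonomy \<Gamma> X g' p"
proof -
  have "flat_section \<Gamma> X g p {0..1} = flat_section \<Gamma> X g' p {0..1}"
    using assms by (intro ext) (simp add: flat_section_def)
  then show ?thesis by (simp add: holonomy_def)
qed

lemma in_fundamental_group_loop:
  "x \<in> carrier (fundamental_group S b) \<longleftrightarrow> (\<exists>p\<in>loops_at S b. x = loop_class S p)"
  by (auto simp: fundamental_group_def)

context flat_bundle
begin

lemma holonomy_rep_loop:
  assumes b: "snd b > 0" and p: "p \<in> loops_at (- (X \<times> {0})) b"
  shows "holonomy_rep \<Gamma> X b g (loop_class (- (X \<times> {0})) p) = holonomy \<Gamma> X g p"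
proof -
  let ?S = "- (X \<times> {0})"
  define q where "q = (SOME q. q \<in> loops_at ?S b \<and> loop_class ?S q = loop_class ?S p)"
  have "q \<in> loops_at ?S b \<and> loop_class ?S q = loop_class ?S p"
    unfolding q_def by (rule someI[of _ p]) (use p in simp)
  then have "homotopic_paths ?S q p" and q: "q \<in> loops_at ?S b"
    using loop_class_eqD by blast+
  then have "holonomy \<Gamma> X g q = holonomy \<Gamma> X g p"
    using loops_at_ends[OF q] b by (intro holonomy_homotopic) auto
  moreover have "loop_class ?S p \<in> carrier (fundamental_group ?S b)"
    using p in_fundamental_group_loop by blast
  ultimately show ?thesis
    by (simp add: holonomy_rep_def q_def)
qed

lemma holonomy_rep_hom:
  assumes b: "snd b > 0"
  shows "holonomy_rep \<Gamma> X b g \<in> hom (fundamental_group (- (X \<times> {0})) b) \<Gamma>"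
proof (rule homI)
  let ?S = "- (X \<times> {0})"
  fix x assume "x \<in> carrier (fundamental_group ?S b)"
  then obtain p where p: "p \<in> loops_at ?S b" "x = loop_class ?S p"
    using in_fundamental_group_loop by blast
  have "holonomy \<Gamma> X g p \<in> carrier \<Gamma>"
    using loops_at_ends[OF p(1)] b by (intro holonomy_closed) auto
  then show "holonomy_rep \<Gamma> X b g x \<in> carrier \<Gamma>"
    using holonomy_rep_loop[OF b p(1)] p(2) by simp
  fix y assume "y \<in> carrier (fundamental_group ?S b)"
  then obtain q where q: "q \<in> loops_at ?S b" "y = loop_class ?S q"
    using in_fundamental_group_loop by blast
  have "holonomy \<Gamma> X g (p +++ q) = holonomy \<Gamma> X g p \<otimes> holonomy \<Gamma> X g q"
    using loops_at_ends[OF p(1)] loops_at_ends[OF q(1)] b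
    by (intro holonomy_join) (auto simp: pathstart_def pathfinish_def)
  then show "holonomy_rep \<Gamma> X b g (x \<otimes>\<^bsub>fundamental_group ?S b\<^esub> y) = holonomy_rep \<Gamma> X b g x \<otimes> holonomy_rep \<Gamma> X b g y"
    unfolding p(2) q(2) fundamental_group_mult[OF p(1) q(1)]
    using holonomy_rep_loop[OF b] p(1) q(1) loops_at_join by metis
qed

lemma flat_bundle_right_mult:
  assumes "c \<in> carrier \<Gamma>"
  shows "flat_bundle \<Gamma> X (\<lambda>z. g z \<otimes> c)"
proof (unfold_locales)
  show "closed X" by (rule X)
  fix z assume z: "z \<notin> X"
  show "g z \<otimes> c \<in> carrier \<Gamma>" using g_carrier[OF z] assms by simp
  show "\<forall>\<^sub>F w in at z. g z \<otimes> c = g w \<otimes> c"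
    using g_local[OF z] by eventually_elim simp
qed

text \<open>A constant on the right only changes the trivialisation over the lower part:
  \<open>b\<close> is multiplied by it, while \<open>a\<close>, which alone enters the holonomy,
  stays the same.\<close>

lemma holonomy_right_mult:
  assumes c: "c \<in> carrier \<Gamma>"
    and p: "path p" "path_image p \<subseteq> - (X \<times> {0})" "snd (p 0) > 0" "snd (p 1) > 0"
  shows "holonomy \<Gamma> X (\<lambda>z. g z \<otimes> c) p = holonomy \<Gamma> X g p"
proof -
  obtain a b where s: "flat_section \<Gamma> X g p {0..1} a b"
    using flat_section_path_exists p by blast
  note * = s[unfolded flat_section_def]
  have "flat_section \<Gamma> X (\<lambda>z. g z \<otimes> c) p {0..1} a (\<lambda>x. b x \<otimes> c)"
    unfolding flat_section_def
  proof (intro conjI ballI impI)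
    fix x :: real assume x: "x \<in> {0..1}"
    show "a x \<in> carrier \<Gamma>" "\<forall>\<^sub>F y in at x within {0..1}. a x = a y" if "p x \<in> upper_part X"
      using * x that by blast+
    show "b x \<otimes> c \<in> carrier \<Gamma>" if "p x \<in> lower_part X"
      using * x that c by blast
    show "\<forall>\<^sub>F y in at x within {0..1}. b x \<otimes> c = b y \<otimes> c" if "p x \<in> lower_part X"
    proof -
      have "\<forall>\<^sub>F y in at x within {0..1}. b x = b y" using * x that by blast
      then show ?thesis by eventually_elim simp
    qed
    show "b x \<otimes> c = a x \<otimes> (g (fst (p x)) \<otimes> c)" if "fst (p x) \<notin> X"
    proof -
      have "p x \<in> upper_part X" using that by (simp add: upper_part_def)
      then have "a x \<in> carrier \<Gamma>" "b x = a x \<otimes> g (fst (p x))" using * x that by blast+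
      then show ?thesis using c g_carrier[OF that] by (simp add: m_assoc)
    qed
  qed
  then have "holonomy \<Gamma> X (\<lambda>z. g z \<otimes> c) p = inv (a 0) \<otimes> a 1"
    by (rule flat_bundle.holonomy_eq[OF flat_bundle_right_mult[OF c] _ p])
  then show ?thesis
    using holonomy_eq[OF s p] by simp
qed

lemma g_const_on_connected:
  assumes "connected C" "C \<inter> X = {}" "z \<in> C" "w \<in> C"
  shows "g z = g w"
proof (rule connected_local_const[OF assms(1,3,4)], intro ballI)
  fix a assume "a \<in> C"
  then have "a \<notin> X" using assms(2) by blast
  from g_local[OF this] show "\<forall>\<^sub>F b in at a within C. g a = g b"
    by (rule filter_leD[OF at_le[OF subset_UNIV]])
qed

end

context plane_graph
begin

lemma graph_complement_eq: "graph_complement G = - (graph_set G \<times> {0})"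
  by (simp add: graph_complement_def)

lemma flat_bundle_faces:
  assumes "group \<Gamma>" "\<And>F. F \<in> faces G \<Longrightarrow> \<gamma> F \<in> carrier \<Gamma>"
  shows "flat_bundle \<Gamma> (graph_set G) (\<lambda>z. \<gamma> (face z))"
proof -
  interpret group \<Gamma> by (rule assms(1))
  show ?thesis
  proof (unfold_locales)
    show "closed (graph_set G)" by (rule closed_graph_set)
    fix z assume z: "z \<notin> graph_set G"
    show "\<gamma> (face z) \<in> carrier \<Gamma>" using assms(2) face_in_faces[OF z] by blast
    have "open (face z)" "z \<in> face z" using z by (simp_all add: open_face face_in_faces in_face)
    moreover have "\<gamma> (face z) = \<gamma> (face w)" if "w \<in> face z" for w
      using face_eqI[OF face_in_faces[OF z] that] by simp
    ultimately show "\<forall>\<^sub>F w in at z. \<gamma> (face z) = \<gamma> (face w)"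
      unfolding eventually_at_topological by blast
  qed
qed

lemma meridian_exists:
  assumes e: "e \<in> edges G" and b: "snd b > 0"
  shows "\<exists>p. meridian_loop G b e p"
proof -
  obtain F F' where FF: "adjacent_faces G e = {F, F'}" by (rule adjacent_faces_pair[OF e])
  have faces: "F \<in> faces G" "F' \<in> faces G" using FF adjacent_faces_subset_faces[of e] by auto
  obtain z w where zw: "z \<in> F" "w \<in> F'" using face_nonempty[OF faces(1)] face_nonempty[OF faces(2)] by blast
  then have off: "z \<notin> graph_set G" "w \<notin> graph_set G"
    using face_disjoint[OF faces(1)] face_disjoint[OF faces(2)] by blast+
  \<comment> \<open>Four segments: down to \<open>z\<close> in the plane, on to a point below, up to
    \<open>w\<close>, and back. The nested joins put the crossings at parameters 1/4 and
    3/4.\<close>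
  define p where "p = (linepath b (z, 0) +++ linepath (z, 0) (0, -1)) +++ (linepath (0, -1) (w, 0) +++ linepath (w, 0) b)"
  have h1: "snd (linepath b (z, 0) t) = (1 - t) * snd b" for t by (simp add: linepath_def)
  have h2: "snd (linepath (z, 0::real) (0::complex, -1) t) = - t" for t by (simp add: linepath_def)
  have h3: "snd (linepath (0::complex, -1::real) (w, 0) t) = t - 1" for t by (simp add: linepath_def)
  have h4: "snd (linepath (w, 0) b t) = t * snd b" for t by (simp add: linepath_def)
  have ends: "p 0 = b" "p 1 = b" "p (1/4) = (z, 0)" "p (3/4) = (w, 0)"
    by (simp_all add: p_def joinpaths_def linepath_def zero_prod_def)
  have up1: "snd (p u) > 0" if "u \<in> {0..<1/4}" for u
    using that b by (simp add: p_def joinpaths_def h1)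
  have low: "snd (p u) < 0" if "u \<in> {1/4<..<3/4}" for u
    using that by (auto simp: p_def joinpaths_def h2 h3)
  have up2: "snd (p u) > 0" if "u \<in> {3/4<..1}" for u
    using that b by (simp add: p_def joinpaths_def h4)
  have "p u \<in> graph_complement G" if u: "u \<in> {0..1}" for u
  proof -
    consider "u \<in> {0..<1/4}" | "u = 1/4" | "u \<in> {1/4<..<3/4}" | "u = 3/4" | "u \<in> {3/4<..1}"
      using u by fastforce
    then show ?thesis
    proof cases
      case 1 then show ?thesis using up1[of u] by (cases "p u") (auto simp: graph_complement_def)
    next
      case 2
      have "p u = (z, 0)" unfolding 2 by (rule ends(3))
      then show ?thesis using off by (simp add: graph_complement_def)
    next
      case 3 then show ?thesis using low[of u] by (cases "p u") (auto simp: graph_complement_def)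
    next
      case 4
      have "p u = (w, 0)" unfolding 4 by (rule ends(4))
      then show ?thesis using off by (simp add: graph_complement_def)
    next
      case 5 then show ?thesis using up2[of u] by (cases "p u") (auto simp: graph_complement_def)
    qed
  qed
  then have "path_image p \<subseteq> graph_complement G" by (auto simp: path_image_def)
  moreover have "path p" by (simp add: p_def)
  ultimately have "p \<in> loops_at (graph_complement G) b"
    using ends by (simp add: loops_at_def pathstart_def pathfinish_def)
  moreover have "snd (p u) > 0" if "u \<in> {0..<1/4} \<union> {3/4<..1}" for u
    using that up1 up2 by blast
  ultimately have "meridian_loop G b e p"
    unfolding meridian_loop_def
    by (intro conjI exI[of _ F] exI[of _ F'] exI[of _ "1/4"] exI[of _ "3/4"])
      (use FF zw ends low in simp_all)
  then show "\<exists>p. meridian_loop G b e p"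
    by (intro exI[of "meridian_loop G b e" p])
qed

lemma meridian_holonomy:
  assumes \<Gamma>: "group \<Gamma>" and \<gamma>: "\<And>F. F \<in> faces G \<Longrightarrow> \<gamma> F \<in> carrier \<Gamma>" and b: "snd b > 0"
    and p: "meridian_loop G b e p"
  obtains F F' where "adjacent_faces G e = {F, F'}"
    "holonomy_rep \<Gamma> (graph_set G) b (\<lambda>z. \<gamma> (face z)) (loop_class (graph_complement G) p) =
       \<gamma> F \<otimes>\<^bsub>\<Gamma>\<^esub> inv\<^bsub>\<Gamma>\<^esub> \<gamma> F'"
proof -
  interpret fb: flat_bundle \<Gamma> "graph_set G" "\<lambda>z. \<gamma> (face z)"
    by (rule flat_bundle_faces[OF \<Gamma> \<gamma>])
  from p obtain F F' s t where loop: "p \<in> loops_at (graph_complement G) b" and FF: "adjacent_faces G e = {F, F'}"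
    and st: "0 < s" "s < t" "t < 1" and up: "\<forall>u \<in> {0..<s} \<union> {t<..1}. snd (p u) > 0"
    and low: "\<forall>u \<in> {s<..<t}. snd (p u) < 0" and cr: "fst (p s) \<in> F" "fst (p t) \<in> F'"
    unfolding meridian_loop_def by blast
  note loop' = loop[unfolded graph_complement_eq]
  have faces: "F \<in> faces G" "F' \<in> faces G" using FF adjacent_faces_subset_faces[of e] by auto
  have off: "fst (p s) \<notin> graph_set G" "fst (p t) \<notin> graph_set G"
    using cr face_disjoint[OF faces(1)] face_disjoint[OF faces(2)] by blast+
  have "holonomy \<Gamma> (graph_set G) (\<lambda>z. \<gamma> (face z)) p = \<gamma> (face (fst (p s))) \<otimes>\<^bsub>\<Gamma>\<^esub> inv\<^bsub>\<Gamma>\<^esub> \<gamma> (face (fst (p t)))"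
    by (rule fb.holonomy_crossing[OF _ _ st _ _ off]) (use loops_at_ends[OF loop'] up low in auto)
  then have "holonomy_rep \<Gamma> (graph_set G) b (\<lambda>z. \<gamma> (face z)) (loop_class (graph_complement G) p) =
       \<gamma> F \<otimes>\<^bsub>\<Gamma>\<^esub> inv\<^bsub>\<Gamma>\<^esub> \<gamma> F'"
    unfolding graph_complement_eq fb.holonomy_rep_loop[OF b loop'] face_eqI[OF faces(1) cr(1)] face_eqI[OF faces(2) cr(2)] .
  then show thesis by (rule that[OF FF])
qed

text \<open>A locally constant function is constant on each connected face, so the transition
  function from \<open>hom_eq_holonomy\<close> descends to the faces.\<close>

lemma hom_eq_holonomy_rep:
  assumes \<Gamma>: "group \<Gamma>" and b: "snd b > 0"
    and \<rho>: "\<rho> \<in> hom (graph_group G b) \<Gamma>" "\<rho> \<in> extensional (carrier (graph_group G b))"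
  obtains \<gamma> where "\<And>F. F \<in> faces G \<Longrightarrow> \<gamma> F \<in> carrier \<Gamma>"
    "\<rho> = holonomy_rep \<Gamma> (graph_set G) b (\<lambda>z. \<gamma> (face z))"
proof -
  let ?X = "graph_set G"
  have "?X \<noteq> UNIV" using interior_graph_set by auto
  then obtain g where g: "flat_bundle \<Gamma> ?X g"
    "\<And>p. p \<in> loops_at (- (?X \<times> {0})) b \<Longrightarrow> \<rho> (loop_class (- (?X \<times> {0})) p) = holonomy \<Gamma> ?X g p"
    using hom_eq_holonomy[OF \<Gamma> closed_graph_set _ b \<rho>(1)[unfolded graph_complement_eq]] by metis
  interpret g: flat_bundle \<Gamma> ?X g by (rule g(1))
  define \<gamma> where "\<gamma> F = g (SOME z. z \<in> F)" for F
  have some: "(SOME z. z \<in> F) \<in> F" if "F \<in> faces G" for F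
    using face_nonempty[OF that] some_in_eq by blast
  have \<gamma>: "\<gamma> F \<in> carrier \<Gamma>" if "F \<in> faces G" for F
    unfolding \<gamma>_def by (rule g.g_carrier) (use some[OF that] face_disjoint[OF that] in blast)
  have g\<gamma>: "g z = \<gamma> (face z)" if z: "z \<notin> ?X" for z
    unfolding \<gamma>_def
    by (rule g.g_const_on_connected[of "face z"])
      (use face_in_faces[OF z] connected_face face_disjoint some in_face[OF z] in blast)+
  interpret fb: flat_bundle \<Gamma> ?X "\<lambda>z. \<gamma> (face z)"
    by (rule flat_bundle_faces[OF \<Gamma> \<gamma>])
  have "\<rho> = holonomy_rep \<Gamma> ?X b (\<lambda>z. \<gamma> (face z))"
  proof (rule extensionalityI[OF \<rho>(2)])
    show "holonomy_rep \<Gamma> ?X b (\<lambda>z. \<gamma> (face z)) \<in> extensional (carrier (graph_group G b))"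
      by (simp add: holonomy_rep_def graph_complement_eq)
    fix x assume "x \<in> carrier (graph_group G b)"
    then obtain p where p: "p \<in> loops_at (- (?X \<times> {0})) b" "x = loop_class (- (?X \<times> {0})) p"
      unfolding graph_complement_eq in_fundamental_group_loop by blast
    show "\<rho> x = holonomy_rep \<Gamma> ?X b (\<lambda>z. \<gamma> (face z)) x"
      unfolding p(2) g(2)[OF p(1)] fb.holonomy_rep_loop[OF b p(1)] by (rule holonomy_cong[OF g\<gamma>])
  qed
  with \<gamma> show thesis by (rule that)
qed

text \<open>Both orders of the two faces are covered, which is consistent because reflections are
  involutions. An edge with only one face would force its reflection to be the identity, so in that
  case no \<open>\<gamma>\<close> qualifies.\<close>

definition jumps :: "('e \<Rightarrow> (complex^3) set) \<Rightarrow> (complex set \<Rightarrow> complex^3^3) \<Rightarrow> bool" where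
  "jumps D \<gamma> \<longleftrightarrow> (\<forall>F\<in>faces G. \<gamma> F \<in> carrier SU3) \<and>
     (\<forall>e\<in>edges G. D e \<in> CP2 \<and>
       (\<forall>F F'. adjacent_faces G e = {F, F'} \<longrightarrow> \<gamma> F = reflection_of_line (D e) ** \<gamma> F'))"

abbreviation rep_of :: "complex \<times> real \<Rightarrow> (complex set \<Rightarrow> complex^3^3) \<Rightarrow> (real \<Rightarrow> complex \<times> real) set \<Rightarrow> complex^3^3" where
  "rep_of b \<gamma> \<equiv> holonomy_rep SU3 (graph_set G) b (\<lambda>z. \<gamma> (face z))"

lemma meridiansE:
  assumes "x \<in> meridians G b e"
  obtains p where "meridian_loop G b e p" "x = loop_class (graph_complement G) p"
  using assms by (auto simp: meridians_def)

text \<open>A meridian crosses the two faces of \<open>e\<close> in one order or the other, and both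
  orders give the same reflection. Hence the decoration does not depend on the chosen
  meridian.\<close>

lemma jumps_meridian:
  assumes j: "jumps D \<gamma>" and b: "snd b > 0" and e: "e \<in> edges G" and x: "x \<in> meridians G b e"
  shows "rep_of b \<gamma> x = reflection_of_line (D e)"
proof -
  obtain p where p: "meridian_loop G b e p" "x = loop_class (graph_complement G) p"
    using x by (rule meridiansE)
  have \<gamma>: "\<And>F. F \<in> faces G \<Longrightarrow> \<gamma> F \<in> carrier SU3" using j by (simp add: jumps_def)
  obtain F F' where FF: "adjacent_faces G e = {F, F'}" "rep_of b \<gamma> x = \<gamma> F \<otimes>\<^bsub>SU3\<^esub> inv\<^bsub>SU3\<^esub> \<gamma> F'"
    by (rule meridian_holonomy[OF group_SU3 \<gamma> b p(1), folded p(2)])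
  have F': "\<gamma> F' \<in> carrier SU3" using \<gamma> FF(1) adjacent_faces_subset_faces[of e] by auto
  have "\<gamma> F = reflection_of_line (D e) ** \<gamma> F'" using j e FF(1) unfolding jumps_def by blast
  then have "rep_of b \<gamma> x = reflection_of_line (D e) ** (\<gamma> F' ** adjoint_matrix (\<gamma> F'))"
    using FF(2) F' by (simp add: SU3_inv matrix_mul_assoc)
  then show ?thesis using F' by (simp add: SU3_carrier)
qed

lemma meridians_nonempty: "e \<in> edges G \<Longrightarrow> snd b > 0 \<Longrightarrow> meridians G b e \<noteq> {}"
  using meridian_exists by (auto simp: meridians_def)

lemma some_meridian: "e \<in> edges G \<Longrightarrow> snd b > 0 \<Longrightarrow> (SOME x. x \<in> meridians G b e) \<in> meridians G b e"
  using meridians_nonempty some_in_eq by blast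

lemma meridians_subset_carrier: "meridians G b e \<subseteq> carrier (graph_group G b)"
  by (auto simp: meridians_def meridian_loop_def fundamental_group_def)

lemma jumps_decoration_of:
  assumes "jumps D \<gamma>" "snd b > 0" "e \<in> edges G"
  shows "decoration_of G b (rep_of b \<gamma>) e = D e"
  using jumps_meridian[OF assms some_meridian[OF assms(3,2)]] assms(1,3) reflection_of_line(4)
  by (simp add: decoration_of_def jumps_def)

lemma jumps_in_R_Phi:
  assumes j: "jumps D \<gamma>" and b: "snd b > 0"
  shows "rep_of b \<gamma> \<in> R_Phi G b"
proof -
  interpret fb: flat_bundle SU3 "graph_set G" "\<lambda>z. \<gamma> (face z)"
    by (rule flat_bundle_faces[OF group_SU3]) (use j in \<open>simp add: jumps_def\<close>)
  have "rep_of b \<gamma> \<in> hom (graph_group G b) SU3"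
    unfolding graph_complement_eq by (rule fb.holonomy_rep_hom[OF b])
  moreover have "rep_of b \<gamma> \<in> extensional (carrier (graph_group G b))"
    by (simp add: holonomy_rep_def graph_complement_eq)
  moreover have "conjugate_in_SU3 (rep_of b \<gamma> x) Phi" if "e \<in> edges G" "x \<in> meridians G b e" for e x
    unfolding jumps_meridian[OF j b that] conjugate_Phi_iff'
    by (rule reflection_of_line(3)) (use j that(1) in \<open>simp add: jumps_def\<close>)
  ultimately show ?thesis by (simp add: R_Phi_def)
qed

text \<open>The meridian chosen in \<open>decoration_of\<close> gives the jump for one order of the
  faces; the other order follows since its image is an involution.\<close>

lemma R_Phi_jumps:
  assumes \<rho>: "\<rho> \<in> R_Phi G b" and b: "snd b > 0"
  obtains \<gamma> where "\<rho> = rep_of b \<gamma>" "jumps (decoration_of G b \<rho>) \<gamma>"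
proof -
  have hom: "\<rho> \<in> hom (graph_group G b) SU3" "\<rho> \<in> extensional (carrier (graph_group G b))"
    and conj: "\<And>e x. e \<in> edges G \<Longrightarrow> x \<in> meridians G b e \<Longrightarrow> \<rho> x \<in> line_reflections"
    using \<rho> by (auto simp: R_Phi_def conjugate_Phi_iff')
  obtain \<gamma> where \<gamma>: "\<And>F. F \<in> faces G \<Longrightarrow> \<gamma> F \<in> carrier SU3" and eq: "\<rho> = rep_of b \<gamma>"
    by (rule hom_eq_holonomy_rep[OF group_SU3 b hom]) (rule that)
  have "jumps (decoration_of G b \<rho>) \<gamma>"
    unfolding jumps_def
  proof (intro conjI ballI allI impI)
    fix e assume e: "e \<in> edges G"
    define x where "x = (SOME x. x \<in> meridians G b e)"
    have x: "x \<in> meridians G b e" unfolding x_def by (rule some_meridian[OF e b])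
    have D: "decoration_of G b \<rho> e = eigenspace_1 (\<rho> x)"
      using e by (simp add: decoration_of_def x_def)
    note R = reflection_of_eigenspace[OF conj[OF e x]]
    show "decoration_of G b \<rho> e \<in> CP2" using R(1) D by simp
    define A where "A = \<rho> x"
    have A: "A \<in> line_reflections" "reflection_of_line (decoration_of G b \<rho> e) = A"
      using conj[OF e x] R(2) D by (simp_all add: A_def)
    have AA: "A ** A = mat 1"
    proof -
      obtain v where "v \<noteq> 0" "A = line_reflection v"
        using A(1) by (auto simp: line_reflections_def)
      then show ?thesis by (simp add: line_reflection_involution)
    qed
    obtain p where p: "meridian_loop G b e p" "x = loop_class (graph_complement G) p"
      using x by (rule meridiansE)
    obtain B B' where BB: "adjacent_faces G e = {B, B'}" "rep_of b \<gamma> x = \<gamma> B \<otimes>\<^bsub>SU3\<^esub> inv\<^bsub>SU3\<^esub> \<gamma> B'"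
      by (rule meridian_holonomy[OF group_SU3 \<gamma> b p(1), folded p(2)])
    have B': "\<gamma> B' \<in> carrier SU3" using \<gamma> BB(1) adjacent_faces_subset_faces[of e] by auto
    have "A = \<gamma> B ** adjoint_matrix (\<gamma> B')"
      using BB(2) B' by (simp add: A_def eq SU3_inv)
    then have 1: "A ** \<gamma> B' = \<gamma> B"
      by (simp add: SU3_adjoint_left[OF B'] flip: matrix_mul_assoc)
    then have 2: "A ** \<gamma> B = \<gamma> B'"
      using AA by (metis matrix_mul_assoc matrix_mul_lid)
    fix F F' assume "adjacent_faces G e = {F, F'}"
    then have "F = B \<and> F' = B' \<or> F = B' \<and> F' = B"
      using BB(1) by (auto simp: doubleton_eq_iff)
    then show "\<gamma> F = reflection_of_line (decoration_of G b \<rho> e) ** \<gamma> F'"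
      using 1 2 A(2) by auto
  qed (rule \<gamma>)
  with eq show thesis by (rule that)
qed

text \<open>Passing once around a vertex multiplies by all three reflections and returns to the same
  value. So their product is the identity, and two of them multiply to the third.\<close>

lemma jumps_admissible:
  assumes tri: "trivalent G" and j: "jumps D \<gamma>" and D: "D \<in> extensional (edges G)"
  shows "D \<in> admissible_decorations G"
proof -
  have "orthogonal_lines (D (fst h)) (D (fst h'))"
    if v: "v \<in> verts G" and h: "h \<in> ends_at G v" "h' \<in> ends_at G v" "h \<noteq> h'" for v h h'
  proof -
    have "card (ends_at G v) = 3" using tri v by (simp add: trivalent_def)
    then have "card (ends_at G v - {h, h'}) = 1"
      using h by (simp add: card_Diff_subset)
    then obtain h'' where "ends_at G v - {h, h'} = {h''}" using card_1_singletonE by blast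
    then have E: "ends_at G v = {h, h', h''}" "h \<noteq> h'" "h \<noteq> h''" "h' \<noteq> h''" using h by auto
    obtain F1 F2 F3 where F: "adjacent_faces G (fst h) = {F2, F3}" "adjacent_faces G (fst h') = {F3, F1}"
      "adjacent_faces G (fst h'') = {F1, F2}"
      by (rule trivalent_vertex_faces[OF v E])
    have e: "fst h \<in> edges G" "fst h' \<in> edges G" "fst h'' \<in> edges G"
      using ends_atD(1) E(1) by blast+
    have F2: "F2 \<in> faces G" using F(1) adjacent_faces_subset_faces[of "fst h"] by auto
    have C: "D (fst h) \<in> CP2" "D (fst h') \<in> CP2" "D (fst h'') \<in> CP2"
      using j e by (auto simp: jumps_def)
    define R where "R k = reflection_of_line (D (fst k))" for k :: "'e \<times> real"
    have g: "\<gamma> F2 = R h ** \<gamma> F3" "\<gamma> F3 = R h' ** \<gamma> F1" "\<gamma> F1 = R h'' ** \<gamma> F2"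
      using j e F unfolding jumps_def R_def by blast+
    then have "\<gamma> F2 = (R h ** R h' ** R h'') ** \<gamma> F2"
      by (metis matrix_mul_assoc)
    then have "\<gamma> F2 ** adjoint_matrix (\<gamma> F2) = (R h ** R h' ** R h'') ** (\<gamma> F2 ** adjoint_matrix (\<gamma> F2))"
      by (metis matrix_mul_assoc)
    moreover have "\<gamma> F2 ** adjoint_matrix (\<gamma> F2) = mat 1"
      using j F2 by (auto simp: jumps_def SU3_carrier)
    ultimately have "R h ** R h' ** R h'' = mat 1" by simp
    then have "R h ** R h' ** (R h'' ** R h'') = R h''"
      by (simp add: matrix_mul_assoc)
    then have RR: "R h ** R h' = R h''"
      using reflection_of_line(2)[OF C(3)] by (simp add: R_def)
    obtain a where a: "a \<noteq> 0" "D (fst h) = complex_line a" using C(1) by (rule CP2E)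
    obtain b where b: "b \<noteq> 0" "D (fst h') = complex_line b" using C(2) by (rule CP2E)
    obtain c where c: "c \<noteq> 0" "D (fst h'') = complex_line c" using C(3) by (rule CP2E)
    have "hermitian a b = 0"
      using orthogonal_if_reflections_commute[OF a(1) b(1) c(1)] RR a b c
      by (simp add: R_def reflection_of_complex_line)
    then show ?thesis using a b orthogonal_complex_lines by simp
  qed
  moreover have "D \<in> edges G \<rightarrow>\<^sub>E CP2"
    using j D by (auto simp: jumps_def PiE_def)
  ultimately show ?thesis by (simp add: admissible_decorations_def)
qed

lemma admissible_jumps:
  assumes tri: "trivalent G" and D: "D \<in> admissible_decorations G"
  obtains \<gamma> where "jumps D \<gamma>"
proof -
  have C: "\<And>e. e \<in> edges G \<Longrightarrow> D e \<in> CP2"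
    and orth: "\<And>v h h'. v \<in> verts G \<Longrightarrow> h \<in> ends_at G v \<Longrightarrow> h' \<in> ends_at G v \<Longrightarrow> h \<noteq> h'
      \<Longrightarrow> orthogonal_lines (D (fst h)) (D (fst h'))"
    using D by (auto simp: admissible_decorations_def)
  obtain \<gamma> where \<gamma>: "\<And>F. F \<in> faces G \<Longrightarrow> \<gamma> F \<in> carrier SU3"
    "\<And>e F F'. e \<in> edges G \<Longrightarrow> adjacent_faces G e = {F, F'} \<Longrightarrow> \<gamma> F = reflection_of_line (D e) \<otimes>\<^bsub>SU3\<^esub> \<gamma> F'"
  proof (rule exists_face_function[OF group_SU3 tri, of "\<lambda>e. reflection_of_line (D e)"])
    fix v h1 h2 h3
    assume v: "v \<in> verts G" and E: "ends_at G v = {h1, h2, h3}" "h1 \<noteq> h2" "h1 \<noteq> h3" "h2 \<noteq> h3"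
    have h: "h1 \<in> ends_at G v" "h2 \<in> ends_at G v" "h3 \<in> ends_at G v" using E by auto
    obtain x where x: "x \<noteq> 0" "D (fst h1) = complex_line x" using C[OF ends_atD(1)[OF h(1)]] by (rule CP2E)
    obtain y where y: "y \<noteq> 0" "D (fst h2) = complex_line y" using C[OF ends_atD(1)[OF h(2)]] by (rule CP2E)
    obtain z where z: "z \<noteq> 0" "D (fst h3) = complex_line z" using C[OF ends_atD(1)[OF h(3)]] by (rule CP2E)
    have "hermitian x y = 0" "hermitian y z = 0" "hermitian x z = 0"
      using orth[OF v h(1,2)] orth[OF v h(2,3)] orth[OF v h(1,3)] E(2-4) x y z
      by (simp_all add: orthogonal_complex_lines)
    then show "reflection_of_line (D (fst h1)) \<otimes>\<^bsub>SU3\<^esub> reflection_of_line (D (fst h2)) = reflection_of_line (D (fst h3))"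
      using x y z by (simp add: reflection_of_complex_line orthogonal_reflections_product)
  qed (use C reflection_of_line in auto)
  then have "jumps D \<gamma>"
    using C unfolding jumps_def SU3_mult by blast
  then show thesis by (rule that)
qed

text \<open>Across an edge the square of the reflection cancels in
  \<open>adjoint_matrix (\<gamma> F) ** \<gamma>' F\<close>, so this quotient is the same for all
  faces. The two functions differ by a constant on the right, which the holonomy does not
  see.\<close>

lemma jumps_unique:
  assumes j: "jumps D \<gamma>" and j': "jumps D \<gamma>'" and b: "snd b > 0"
  shows "rep_of b \<gamma> = rep_of b \<gamma>'"
proof -
  have \<gamma>: "\<And>F. F \<in> faces G \<Longrightarrow> \<gamma> F \<in> carrier SU3" and \<gamma>': "\<And>F. F \<in> faces G \<Longrightarrow> \<gamma>' F \<in> carrier SU3"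
    using j j' by (auto simp: jumps_def)
  interpret fb: flat_bundle SU3 "graph_set G" "\<lambda>z. \<gamma> (face z)"
    by (rule flat_bundle_faces[OF group_SU3 \<gamma>])
  interpret fb': flat_bundle SU3 "graph_set G" "\<lambda>z. \<gamma>' (face z)"
    by (rule flat_bundle_faces[OF group_SU3 \<gamma>'])
  define c where "c F = adjoint_matrix (\<gamma> F) ** \<gamma>' F" for F
  have const: "c A = c B" if "A \<in> faces G" "B \<in> faces G" for A B
  proof (rule face_function_constant_all[OF _ that])
    fix e F F' assume e: "e \<in> edges G" and F: "F \<in> adjacent_faces G e" "F' \<in> adjacent_faces G e"
    obtain A B where AB: "adjacent_faces G e = {A, B}" by (rule adjacent_faces_pair[OF e])
    let ?R = "reflection_of_line (D e)"
    have "D e \<in> CP2" using j e by (simp add: jumps_def)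
    note R = reflection_of_line[OF this]
    have "\<gamma> A = ?R ** \<gamma> B" "\<gamma>' A = ?R ** \<gamma>' B"
      using j j' e AB unfolding jumps_def by blast+
    then have "c A = adjoint_matrix (\<gamma> B) ** (?R ** ?R) ** \<gamma>' B"
      by (simp add: c_def adjoint_matrix_mult R(5) matrix_mul_assoc)
    then have "c A = c B" by (simp add: R(2) c_def)
    then show "c F = c F'" using F AB by auto
  qed
  have "graph_set G \<noteq> UNIV" using interior_graph_set by auto
  then obtain z0 where z0: "z0 \<notin> graph_set G" by blast
  define c0 where "c0 = c (face z0)"
  have c0: "c0 \<in> carrier SU3"
    unfolding c0_def c_def using \<gamma> \<gamma>' face_in_faces[OF z0] by (intro SU3_closed SU3_adjoint) auto
  have \<gamma>'_eq: "\<gamma>' (face z) = \<gamma> (face z) \<otimes>\<^bsub>SU3\<^esub> c0" if z: "z \<notin> graph_set G" for z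
  proof -
    have "c (face z) = c0" unfolding c0_def by (rule const[OF face_in_faces[OF z] face_in_faces[OF z0]])
    then have "\<gamma> (face z) ** c0 = (\<gamma> (face z) ** adjoint_matrix (\<gamma> (face z))) ** \<gamma>' (face z)"
      unfolding c_def by (metis matrix_mul_assoc)
    then show ?thesis using \<gamma>[OF face_in_faces[OF z]] by (simp add: SU3_carrier)
  qed
  show ?thesis
  proof (rule extensionalityI[of _ "carrier (graph_group G b)"])
    fix x assume "x \<in> carrier (graph_group G b)"
    then obtain p where p: "p \<in> loops_at (- (graph_set G \<times> {0})) b" "x = loop_class (- (graph_set G \<times> {0})) p"
      unfolding graph_complement_eq in_fundamental_group_loop by blast
    have "holonomy SU3 (graph_set G) (\<lambda>z. \<gamma>' (face z)) p = holonomy SU3 (graph_set G) (\<lambda>z. \<gamma> (face z) \<otimes>\<^bsub>SU3\<^esub> c0) p"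
      by (rule holonomy_cong[OF \<gamma>'_eq])
    also have "\<dots> = holonomy SU3 (graph_set G) (\<lambda>z. \<gamma> (face z)) p"
      using loops_at_ends[OF p(1)] b by (intro fb.holonomy_right_mult[OF c0]) auto
    finally show "rep_of b \<gamma> x = rep_of b \<gamma>' x"
      unfolding p(2) fb.holonomy_rep_loop[OF b p(1)] fb'.holonomy_rep_loop[OF b p(1)] by simp
  qed (simp_all add: holonomy_rep_def graph_complement_eq)
qed

text \<open>Each coordinate is evaluation at one chosen meridian, followed by the continuous map
  \<open>eigenspace_1\<close> on reflections.\<close>

lemma continuous_map_decoration_of:
  assumes tri: "trivalent G" and b: "snd b > 0"
  shows "continuous_map (R_Phi_topology G b) (decoration_topology G) (decoration_of G b)"
proof -
  have top: "topspace (R_Phi_topology G b) \<subseteq> R_Phi G b" by (simp add: R_Phi_topology_def)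
  have comp: "continuous_map (R_Phi_topology G b) CP2_topology (\<lambda>\<rho>. decoration_of G b \<rho> e)" if e: "e \<in> edges G" for e
  proof -
    define x where "x = (SOME x. x \<in> meridians G b e)"
    have x: "x \<in> meridians G b e" unfolding x_def by (rule some_meridian[OF e b])
    then have xc: "x \<in> carrier (graph_group G b)" using meridians_subset_carrier by blast
    have "continuous_map (R_Phi_topology G b) (top_of_set (carrier SU3)) (\<lambda>\<rho>. \<rho> x)"
      unfolding R_Phi_topology_def
      by (rule continuous_map_from_subtopology) (rule continuous_map_product_projection[OF xc])
    then have "continuous_map (R_Phi_topology G b) euclidean (\<lambda>\<rho>. \<rho> x)"
      by (simp add: continuous_map_in_subtopology)
    moreover have "\<rho> x \<in> line_reflections" if "\<rho> \<in> topspace (R_Phi_topology G b)" for \<rho>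
      using that top e x unfolding R_Phi_def conjugate_Phi_iff' by blast
    ultimately have "continuous_map (R_Phi_topology G b) (top_of_set line_reflections) (\<lambda>\<rho>. \<rho> x)"
      by (auto simp: continuous_map_in_subtopology)
    then have "continuous_map (R_Phi_topology G b) CP2_topology (eigenspace_1 \<circ> (\<lambda>\<rho>. \<rho> x))"
      by (rule continuous_map_compose[OF _ continuous_map_eigenspace])
    then show ?thesis
      by (rule continuous_map_eq) (simp add: decoration_of_def e x_def)
  qed
  have adm: "decoration_of G b \<rho> \<in> admissible_decorations G" if "\<rho> \<in> topspace (R_Phi_topology G b)" for \<rho>
  proof -
    have "\<rho> \<in> R_Phi G b" using that top by blast
    then obtain \<gamma> where "jumps (decoration_of G b \<rho>) \<gamma>" by (rule R_Phi_jumps[OF _ b])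
    then show ?thesis by (rule jumps_admissible[OF tri]) (simp add: decoration_of_def)
  qed
  show ?thesis
    unfolding decoration_topology_def continuous_map_in_subtopology continuous_map_componentwise
    using comp adm by (auto simp: decoration_of_def)
qed

end

theorem theorem2:
  fixes G :: "'e graph_data" and b :: "complex \<times> real"
  assumes "finite_plane_graph G" and "trivalent G" and "snd b > 0"
  shows "(\<forall>e \<in> edges G. meridians G b e \<noteq> {}) \<and>
         (\<forall>\<rho> \<in> R_Phi G b.
            (\<forall>e \<in> edges G. \<forall>x \<in> meridians G b e. decoration_of G b \<rho> e = eigenspace_1 (\<rho> x)) \<and>
            decoration_of G b \<rho> \<in> admissible_decorations G) \<and>
         homeomorphic_map (R_Phi_topology G b) (decoration_topology G) (decoration_of G b)"
proof -
  interpret plane_graph G by unfold_locales (rule assms(1))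
  note tri = assms(2) and b = assms(3)
  have well_defined: "decoration_of G b \<rho> e = eigenspace_1 (\<rho> x)"
    if \<rho>: "\<rho> \<in> R_Phi G b" and e: "e \<in> edges G" and x: "x \<in> meridians G b e" for \<rho> e x
  proof -
    obtain \<gamma> where \<gamma>: "\<rho> = rep_of b \<gamma>" "jumps (decoration_of G b \<rho>) \<gamma>"
      by (rule R_Phi_jumps[OF \<rho> b])
    have "\<rho> x = reflection_of_line (decoration_of G b \<rho> e)"
      using jumps_meridian[OF \<gamma>(2) b e x] \<gamma>(1) by simp
    moreover have "decoration_of G b \<rho> e \<in> CP2" using \<gamma>(2) e by (simp add: jumps_def)
    ultimately show ?thesis by (simp add: reflection_of_line(4))
  qed
  have adm: "decoration_of G b \<rho> \<in> admissible_decorations G" if \<rho>: "\<rho> \<in> R_Phi G b" for \<rho>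
  proof -
    obtain \<gamma> where "jumps (decoration_of G b \<rho>) \<gamma>" by (rule R_Phi_jumps[OF \<rho> b])
    then show ?thesis by (rule jumps_admissible[OF tri]) (simp add: decoration_of_def)
  qed
  have topR: "topspace (R_Phi_topology G b) = R_Phi G b"
    by (auto simp: R_Phi_topology_def R_Phi_def hom_def PiE_def)
  have topD: "topspace (decoration_topology G) = admissible_decorations G"
    by (auto simp: decoration_topology_def admissible_decorations_def)
  have "homeomorphic_map (R_Phi_topology G b) (decoration_topology G) (decoration_of G b)"
  proof (rule continuous_imp_homeomorphic_map)
    show "continuous_map (R_Phi_topology G b) (decoration_topology G) (decoration_of G b)"
      by (rule continuous_map_decoration_of[OF tri b])
    show "compact_space (R_Phi_topology G b)"
      by (rule compact_space_R_Phi[OF _ meridians_subset_carrier])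
        (use b in \<open>auto simp: graph_complement_def mem_Times_iff\<close>)
    show "Hausdorff_space (decoration_topology G)"
      unfolding decoration_topology_def
      by (rule Hausdorff_space_subtopology) (simp add: Hausdorff_space_product_topology Hausdorff_space_CP2)
    show "decoration_of G b ` topspace (R_Phi_topology G b) = topspace (decoration_topology G)"
      unfolding topR topD
    proof
      show "decoration_of G b ` R_Phi G b \<subseteq> admissible_decorations G"
        using adm by (rule image_subsetI)
      show "admissible_decorations G \<subseteq> decoration_of G b ` R_Phi G b"
      proof
        fix D assume D: "D \<in> admissible_decorations G"
        obtain \<gamma> where \<gamma>: "jumps D \<gamma>" by (rule admissible_jumps[OF tri D])
        have "D \<in> extensional (edges G)" using D by (auto simp: admissible_decorations_def PiE_def)
        then have "D = decoration_of G b (rep_of b \<gamma>)"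
          using jumps_decoration_of[OF \<gamma> b]
          by (intro extensionalityI[of D "edges G"]) (simp_all add: decoration_of_def[of G b "rep_of b \<gamma>"])
        then show "D \<in> decoration_of G b ` R_Phi G b"
          using jumps_in_R_Phi[OF \<gamma> b] by (rule image_eqI)
      qed
    qed
    show "inj_on (decoration_of G b) (topspace (R_Phi_topology G b))"
      unfolding topR
    proof (rule inj_onI)
      fix \<rho> \<rho>' assume \<rho>: "\<rho> \<in> R_Phi G b" "\<rho>' \<in> R_Phi G b" and eq: "decoration_of G b \<rho> = decoration_of G b \<rho>'"
      obtain \<gamma> where \<gamma>: "\<rho> = rep_of b \<gamma>" "jumps (decoration_of G b \<rho>) \<gamma>" by (rule R_Phi_jumps[OF \<rho>(1) b])
      obtain \<gamma>' where \<gamma>': "\<rho>' = rep_of b \<gamma>'" "jumps (decoration_of G b \<rho>') \<gamma>'" by (rule R_Phi_jumps[OF \<rho>(2) b])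
      show "\<rho> = \<rho>'"
        unfolding \<gamma>(1) \<gamma>'(1) by (rule jumps_unique[OF \<gamma>(2) \<gamma>'(2)[folded eq] b])
    qed
  qed
  then show ?thesis
    using meridians_nonempty b well_defined adm by blast
qed

end
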